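(* Let $n\ge 1$ and let $(M,\mathcal{D},g)$ be one of the $(2n+1)$-dimensional contact sub-Riemannian model spaces: the Heisenberg group $\mathbb{H}^n$ ($M=\mathbb{R}^{2n+1}$), the sphere $M=S^{2n+1}$ with parameter $k>0$, or the anti-de Sitter space $M=H^{2n+1}$ with parameter $k>0$. Let $S$ be the model hypersurface in $(M,\mathcal{D},g)$ and let $C(S)$ be its set of characteristic points. Then the intrinsic sub-Laplacian $\Delta$ defined on $S\setminus C(S)$ is stochastically complete; in particular, the stochastic process with generator $\frac12\Delta$ started at any point of $S\setminus C(S)$ almost surely does not hit $C(S)$.
   Context: General definitions. For a contact form $\omega$ on $M$ ($\dim M=2n+1$) with contact structure $\mathcal{D}=\ker\omega$ and fibre inner product $g$ on $\mathcal{D}$, $M$ is oriented by $\Omega=\omega\wedge(\mathrm{d}\omega)^n$. For an oriented hypersurface $S\subset M$, $C(S)=\{x\in S:T_xS=\mathcal{D}_x\}$ and $\mathcal{F}=\mathcal{D}\cap TS$ on $S\setminus C(S)$. The sub-Riemannian normal $N$ along $S\setminus C(S)$ is the vector field with $\omega(N)=0$, $g(N,N)=1$, $g(N,Y)=0$ for all $Y$ in $\mathcal{F}$, such that $(N,Z_1,\dots,Z_{2n})$ is positively oriented in $M$ for every positively oriented local frame $(Z_1,\dots,Z_{2n})$ of $S\setminus C(S)$. Set $\mu=\iota_N\Omega$ on $S\setminus C(S)$. For smooth $f$ on $S\setminus C(S)$, the horizontal gradient $\nabla_Sf$ is the unique vector field in $\mathcal{F}$ with $g(\nabla_Sf,Y)=\mathrm{d}f(Y)$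 for all $Y$ in $\mathcal{F}$, and the intrinsic sub-Laplacian is $\Delta f=\operatorname{div}_\mu(\nabla_Sf)$ (it does not depend on the choice of orientation of $S$). Stochastic completeness of $\Delta$ on $S\setminus C(S)$: the diffusion process on $S\setminus C(S)$ with generator $\frac12\Delta$, started at any point of $S\setminus C(S)$, almost surely has infinite lifetime (it almost surely does not leave every compact subset of $S\setminus C(S)$ in finite time). Hitting $C(S)$ means that the process, viewed in $S$, reaches $C(S)$ in finite time. Model spaces and model hypersurfaces (all contact forms below satisfy the normalisation $(\mathrm{d}\omega)^n|_{\mathcal{D}}=n!\,\mathrm{vol}_g$): (1) Heisenberg group: $M=\mathbb{R}^{2n+1}$ with coordinates $(x_1,\dots,x_{2n+1})$, $\omega=\frac12\sum_{m=1}^n(x_{2m-1}\mathrm{d}x_{2m}-x_{2m}\mathrm{d}x_{2m-1})-\mathrm{d}x_{2n+1}$, $\mathcal{D}=\ker\omega$, $g=\sum_{i=1}^{2n}\mathrm{d}x_i\otimes\mathrm{d}x_i$ on $\mathcal{D}$. Model hypersurface: $S=\{x_{2n+1}=0\}$, with $C(S)=\{0\}$. (2) Sphere with parameter $k>0$: $M=S^{2n+1}=\{x\in\mathbb{R}^{2n+2}:\sum_{i=1}^{2n+2}x_i^2=1\}$, $\omega=\frac{1}{2k^2}\sum_{m=1}^{n+1}(x_{2m-1}\mathrm{d}x_{2m}-x_{2m}\mathrm{d}x_{2m-1})$ restricted to $S^{2n+1}$, $\mathcal{D}=\ker\omega$, $g=\frac{1}{k^2}\langle\cdot,\cdot\rangle|_{\mathcal{D}}$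 with $\langle\cdot,\cdot\rangle$ the Euclidean inner product. Model hypersurface: $S=S^{2n+1}\cap\{x_{2n+2}=0\}$; $C(S)$ consists of the two points with $x_1=\dots=x_{2n}=0$, $x_{2n+1}=\pm1$. (3) Anti-de Sitter space with parameter $k>0$: $M=H^{2n+1}=\{x\in\mathbb{R}^{2n+2}:\sum_{i=1}^{2n}x_i^2-x_{2n+1}^2-x_{2n+2}^2=-1\}$, $\omega=\frac{1}{2k^2}\sum_{m=1}^{n+1}(x_{2m-1}\mathrm{d}x_{2m}-x_{2m}\mathrm{d}x_{2m-1})$ restricted to $H^{2n+1}$, $\mathcal{D}=\ker\omega$, $g=\frac1{k^2}\eta|_{\mathcal{D}}$ with $\eta=\sum_{i=1}^{2n}\mathrm{d}x_i\otimes\mathrm{d}x_i-\mathrm{d}x_{2n+1}\otimes\mathrm{d}x_{2n+1}-\mathrm{d}x_{2n+2}\otimes\mathrm{d}x_{2n+2}$ (which is positive definite on $\mathcal{D}$). Model hypersurface: $S=H^{2n+1}\cap\{x_{2n+2}=0,\ x_{2n+1}>0\}$; $C(S)$ is the single point with $x_1=\dots=x_{2n}=0$, $x_{2n+1}=1$. *)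

theory Defs
  imports "HOL-Probability.Probability" "HOL-Combinatorics.Permutations"
begin

section \<open>Calculus on submanifolds of a Euclidean space\<close>

text \<open>All manifolds occurring here are embedded submanifolds of a Euclidean space, and points
  and tangent vectors are elements of that space. For an embedded submanifold the velocities of
  curves form the usual tangent space.\<close>

definition tangent_space :: "'a::euclidean_space set \<Rightarrow> 'a \<Rightarrow> 'a set" where
  "tangent_space M p = {v. \<exists>\<gamma> e. e > 0 \<and> (\<forall>t. \<bar>t\<bar> < e \<longrightarrow> \<gamma> t \<in> M) \<and> \<gamma> 0 = p \<and>
     (\<gamma> has_vector_derivative v) (at (0::real))}"

primrec Ck_on :: "nat \<Rightarrow> ('a::euclidean_space \<Rightarrow> real) \<Rightarrow> 'a set \<Rightarrow> bool" where
  "Ck_on 0 f U = continuous_on U f"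
| "Ck_on (Suc k) f U = ((\<forall>x\<in>U. f differentiable (at x)) \<and>
     (\<forall>v. Ck_on k (\<lambda>x. frechet_derivative f (at x) v) U))"

definition smooth_on_submanifold :: "'a::euclidean_space set \<Rightarrow> ('a \<Rightarrow> real) \<Rightarrow> bool" where
  "smooth_on_submanifold S f \<longleftrightarrow>
     (\<forall>p\<in>S. \<exists>U h. open U \<and> p \<in> U \<and> (\<forall>k. Ck_on k h U) \<and> (\<forall>q\<in>S \<inter> U. f q = h q))"

definition test_function :: "'a::euclidean_space set \<Rightarrow> ('a \<Rightarrow> real) \<Rightarrow> bool" where
  "test_function S f \<longleftrightarrow> smooth_on_submanifold S f \<and>
     (\<exists>K. compact K \<and> K \<subseteq> S \<and> (\<forall>p\<in>S - K. f p = 0))"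

text \<open>The derivative of a map defined on \<open>S\<close> in a direction tangent to \<open>S\<close>. As a linear map on
  the ambient space a derivative within \<open>S\<close> is not unique, but its values on tangent vectors
  of \<open>S\<close> are; it is only ever applied to those.\<close>

definition deriv_along ::
    "'a::euclidean_space set \<Rightarrow> 'a \<Rightarrow> 'a \<Rightarrow> ('a \<Rightarrow> 'b::real_normed_vector) \<Rightarrow> 'b" where
  "deriv_along S p v f = frechet_derivative f (at p within S) v"

section \<open>Differential forms\<close>

text \<open>A \<open>k\<close>-form sends a point and a sequence of vectors, of which only the first \<open>k\<close> matter,
  to a number. The wedge product is normalised so that
  \<open>(\<alpha> \<and> \<beta>)(u,v) = \<alpha>(u) \<beta>(v) - \<alpha>(v) \<beta>(u)\<close> for 1-forms, and correspondingly
  \<open>d\<omega>(u,v) = u(\<omega>(v)) - v(\<omega>(u))\<close> for constant vector fields. Forms on \<open>M\<close> are represented by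
  forms on the ambient space; since the exterior derivative commutes with restriction to \<open>M\<close>,
  it may be computed in the ambient space.\<close>

type_synonym 'a form = "'a \<Rightarrow> (nat \<Rightarrow> 'a) \<Rightarrow> real"

definition wedge :: "nat \<Rightarrow> nat \<Rightarrow> 'a form \<Rightarrow> 'a form \<Rightarrow> 'a form" where
  "wedge k l \<alpha> \<beta> = (\<lambda>p v. (\<Sum>\<pi> | \<pi> permutes {..<k + l}.
     of_int (sign \<pi>) * \<alpha> p (\<lambda>i. v (\<pi> i)) * \<beta> p (\<lambda>i. v (\<pi> (k + i)))) / (fact k * fact l))"

primrec wedge_power :: "nat \<Rightarrow> 'a form \<Rightarrow> nat \<Rightarrow> 'a form" where
  "wedge_power k \<alpha> 0 = (\<lambda>p v. 1)"
| "wedge_power k \<alpha> (Suc j) = wedge k (k * j) \<alpha> (wedge_power k \<alpha> j)"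

definition ext_deriv :: "nat \<Rightarrow> 'a::euclidean_space form \<Rightarrow> 'a form" where
  "ext_deriv k \<alpha> = (\<lambda>p v. \<Sum>i\<le>k. (- 1) ^ i *
     frechet_derivative (\<lambda>q. \<alpha> q (\<lambda>j. if j < i then v j else v (Suc j))) (at p) (v i))"

definition interior_product :: "('a \<Rightarrow> 'a) \<Rightarrow> 'a form \<Rightarrow> 'a form" where
  "interior_product X \<alpha> = (\<lambda>p v. \<alpha> p (case_nat (X p) v))"

text \<open>The Lie derivative along \<open>X\<close> (tangent to \<open>S\<close>) of an \<open>m\<close>-form \<open>\<mu>\<close> on \<open>S\<close>. Differentiating
  \<open>\<mu>\<^bsub>\<phi>\<^sub>t(p)\<^esub>(d\<phi>\<^sub>t v\<^sub>0, \<dots>, d\<phi>\<^sub>t v\<^bsub>m-1\<^esub>)\<close> at \<open>t = 0\<close>, with \<open>\<phi>\<close> the flow of \<open>X\<close> on \<open>S\<close>, gives the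
  formula below on tangent vectors \<open>v\<^sub>i\<close> of \<open>S\<close> at \<open>p\<close>. Here \<open>\<mu>\<^sub>q\<close> and \<open>X\<close> are needed for
  \<open>q \<in> S\<close> only, but \<open>\<mu>\<^sub>q\<close> must be given as a form on the ambient space; the result does not
  depend on which one represents the form on \<open>S\<close>.\<close>

definition lie_derivative ::
    "nat \<Rightarrow> 'a::euclidean_space set \<Rightarrow> ('a \<Rightarrow> 'a) \<Rightarrow> 'a form \<Rightarrow> 'a form" where
  "lie_derivative m S X \<mu> = (\<lambda>p v. deriv_along S p (X p) (\<lambda>q. \<mu> q v) +
     (\<Sum>i<m. \<mu> p (v(i := deriv_along S p (v i) X))))"

definition divergence ::
    "nat \<Rightarrow> 'a::euclidean_space set \<Rightarrow> 'a form \<Rightarrow> ('a \<Rightarrow> 'a) \<Rightarrow> 'a \<Rightarrow> real" where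
  "divergence m S \<mu> X p = (THE c. \<forall>v. (\<forall>i<m. v i \<in> tangent_space S p) \<longrightarrow>
     lie_derivative m S X \<mu> p v = c * \<mu> p v)"

text \<open>An orientation of an \<open>m\<close>-dimensional submanifold \<open>S\<close>, given by a continuous nowhere
  vanishing \<open>m\<close>-form \<open>\<sigma>\<close> on \<open>S\<close>: a frame \<open>Z\<close> of \<open>S\<close> is positively oriented iff \<open>\<sigma>(Z) > 0\<close>.\<close>

definition orientation_form :: "nat \<Rightarrow> 'a::euclidean_space set \<Rightarrow> 'a form \<Rightarrow> bool" where
  "orientation_form m S \<sigma> \<longleftrightarrow>
     (\<forall>p\<in>S.
        (\<forall>v w. (\<forall>i<m. v i = w i) \<longrightarrow> \<sigma> p v = \<sigma> p w) \<and>
        (\<forall>v i a b u w. i < m \<and> (\<forall>j<m. v j \<in> tangent_space S p) \<and>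
            u \<in> tangent_space S p \<and> w \<in> tangent_space S p \<longrightarrow>
          \<sigma> p (v(i := a *\<^sub>R u + b *\<^sub>R w)) = a * \<sigma> p (v(i := u)) + b * \<sigma> p (v(i := w))) \<and>
        (\<forall>v i j. i < j \<and> j < m \<and> (\<forall>l<m. v l \<in> tangent_space S p) \<and> v i = v j \<longrightarrow>
          \<sigma> p v = 0) \<and>
        (\<exists>v. (\<forall>j<m. v j \<in> tangent_space S p) \<and> \<sigma> p v \<noteq> 0)) \<and>
     (\<forall>U V. openin (top_of_set S) U \<and>
          (\<forall>i<m. continuous_on U (V i) \<and> (\<forall>p\<in>U. V i p \<in> tangent_space S p)) \<longrightarrow>
        continuous_on U (\<lambda>p. \<sigma> p (\<lambda>i. V i p)))"

section \<open>Contact sub-Riemannian manifolds and hypersurfaces\<close>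

text \<open>A manifold of dimension \<open>2n + 1\<close> with contact form \<open>\<omega>\<close> and fibre inner product \<open>g\<close>.
  The fields \<open>cform\<close> and \<open>cmetric\<close> are given on the ambient space, but only their restrictions
  to \<open>TM\<close>, respectively to the contact structure, are meaningful.\<close>

record 'a contact_space =
  chalf :: nat
  cmanifold :: "'a set"
  cform :: "'a \<Rightarrow> 'a \<Rightarrow> real"
  cmetric :: "'a \<Rightarrow> 'a \<Rightarrow> 'a \<Rightarrow> real"

definition contact_plane :: "'a::euclidean_space contact_space \<Rightarrow> 'a \<Rightarrow> 'a set" where
  "contact_plane M p = {v \<in> tangent_space (cmanifold M) p. cform M p v = 0}"

definition contact_volume :: "'a::euclidean_space contact_space \<Rightarrow> 'a form" where
  "contact_volume M = (let \<omega> = (\<lambda>p v. cform M p (v 0)) in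
     wedge 1 (2 * chalf M) \<omega> (wedge_power 2 (ext_deriv 1 \<omega>) (chalf M)))"

definition characteristic_set :: "'a::euclidean_space contact_space \<Rightarrow> 'a set \<Rightarrow> 'a set" where
  "characteristic_set M S = {p \<in> S. tangent_space S p = contact_plane M p}"

definition regular_part :: "'a::euclidean_space contact_space \<Rightarrow> 'a set \<Rightarrow> 'a set" where
  "regular_part M S = S - characteristic_set M S"

definition horizontal_space :: "'a::euclidean_space contact_space \<Rightarrow> 'a set \<Rightarrow> 'a \<Rightarrow> 'a set" where
  "horizontal_space M S p = contact_plane M p \<inter> tangent_space S p"

text \<open>The manifold \<open>M\<close> is oriented by \<open>contact_volume M\<close>, the hypersurface \<open>S\<close> by \<open>\<sigma>\<close>.\<close>

definition subriem_normal ::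
    "'a::euclidean_space contact_space \<Rightarrow> 'a set \<Rightarrow> 'a form \<Rightarrow> 'a \<Rightarrow> 'a" where
  "subriem_normal M S \<sigma> p = (THE N. N \<in> tangent_space (cmanifold M) p \<and>
     cform M p N = 0 \<and> cmetric M p N N = 1 \<and>
     (\<forall>Y\<in>horizontal_space M S p. cmetric M p N Y = 0) \<and>
     (\<forall>Z. (\<forall>i<2 * chalf M. Z i \<in> tangent_space S p) \<and> \<sigma> p Z > 0 \<longrightarrow>
        contact_volume M p (case_nat N Z) > 0))"

definition hypersurface_volume ::
    "'a::euclidean_space contact_space \<Rightarrow> 'a set \<Rightarrow> 'a form \<Rightarrow> 'a form" where
  "hypersurface_volume M S \<sigma> = interior_product (subriem_normal M S \<sigma>) (contact_volume M)"

definition horizontal_gradient ::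
    "'a::euclidean_space contact_space \<Rightarrow> 'a set \<Rightarrow> ('a \<Rightarrow> real) \<Rightarrow> 'a \<Rightarrow> 'a" where
  "horizontal_gradient M S f p = (THE v. v \<in> horizontal_space M S p \<and>
     (\<forall>Y\<in>horizontal_space M S p. cmetric M p v Y = deriv_along (regular_part M S) p Y f))"

definition sub_laplacian ::
    "'a::euclidean_space contact_space \<Rightarrow> 'a set \<Rightarrow> 'a form \<Rightarrow> ('a \<Rightarrow> real) \<Rightarrow> 'a \<Rightarrow> real" where
  "sub_laplacian M S \<sigma> f = divergence (2 * chalf M) (regular_part M S)
     (hypersurface_volume M S \<sigma>) (horizontal_gradient M S f)"

section \<open>Diffusion processes and stochastic completeness\<close>

text \<open>Time is \<open>[0, \<infinity>)\<close>; the values of \<open>F\<close> and \<open>X\<close> at negative times play no role.\<close>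

definition martingale :: "'w measure \<Rightarrow> (real \<Rightarrow> 'w measure) \<Rightarrow> (real \<Rightarrow> 'w \<Rightarrow> real) \<Rightarrow> bool" where
  "martingale P F Y \<longleftrightarrow>
     (\<forall>t\<ge>0. integrable P (Y t) \<and> Y t \<in> borel_measurable (F t)) \<and>
     (\<forall>s t. 0 \<le> s \<and> s \<le> t \<longrightarrow> (AE w in P. real_cond_exp P (F s) (Y t) w = Y s w))"

text \<open>\<open>(X\<^sub>t)\<^bsub>0 \<le> t < \<zeta>\<^esub>\<close> is a diffusion process with generator \<open>L\<close> in the manifold \<open>S\<close>, started at
  \<open>x\<close>, with explosion time \<open>\<zeta>\<close>: a continuous adapted process which leaves every compact subset
  of \<open>S\<close> as \<open>t \<rightarrow> \<zeta>\<close> if \<open>\<zeta> < \<infinity>\<close>, and which solves the martingale problem for \<open>L\<close> on smooth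
  compactly supported functions. These are extended by \<open>0\<close> to the cemetery point where the
  process stays from time \<open>\<zeta>\<close> on. The value of \<open>X\<^sub>t\<close> for \<open>t \<ge> \<zeta>\<close> is irrelevant.\<close>

definition diffusion_process ::
    "'a::euclidean_space set \<Rightarrow> (('a \<Rightarrow> real) \<Rightarrow> 'a \<Rightarrow> real) \<Rightarrow> 'a \<Rightarrow>
     'w measure \<Rightarrow> (real \<Rightarrow> 'w measure) \<Rightarrow> (real \<Rightarrow> 'w \<Rightarrow> 'a) \<Rightarrow> ('w \<Rightarrow> ereal) \<Rightarrow> bool" where
  "diffusion_process S L x P F X \<zeta> \<longleftrightarrow>
     prob_space P \<and> filtration (space P) F \<and> (\<forall>t. subalgebra P (F t)) \<and>
     (\<forall>t\<ge>0. \<forall>B\<in>sets borel. {w \<in> space P. ereal t < \<zeta> w \<and> X t w \<in> B} \<in> sets (F t)) \<and>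
     (AE w in P. X 0 w = x) \<and>
     (\<forall>w\<in>space P. 0 < \<zeta> w \<and>
        (\<forall>t\<ge>0. ereal t < \<zeta> w \<longrightarrow> X t w \<in> S) \<and>
        continuous_on {t. 0 \<le> t \<and> ereal t < \<zeta> w} (\<lambda>t. X t w) \<and>
        (\<forall>T. \<zeta> w = ereal T \<longrightarrow>
           (\<forall>K. compact K \<and> K \<subseteq> S \<longrightarrow> (\<forall>\<^sub>F t in at_left T. X t w \<notin> K)))) \<and>
     (\<forall>f. test_function S f \<longrightarrow>
        martingale P F (\<lambda>t w. (if ereal t < \<zeta> w then f (X t w) else 0) - f (X 0 w) -
          (LINT s:{0..t}|lborel. (if ereal s < \<zeta> w then L f (X s w) else 0))))"

text \<open>The type argument is the type of the sample space of the process.\<close>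

definition stochastically_complete ::
    "'w itself \<Rightarrow> 'a::euclidean_space set \<Rightarrow> (('a \<Rightarrow> real) \<Rightarrow> 'a \<Rightarrow> real) \<Rightarrow> bool" where
  "stochastically_complete _ S \<Delta> \<longleftrightarrow>
     (\<forall>x\<in>S. \<forall>(P :: 'w measure) F X \<zeta>.
        diffusion_process S (\<lambda>f p. \<Delta> f p / 2) x P F X \<zeta> \<longrightarrow> (AE w in P. \<zeta> w = \<infinity>))"

definition hits :: "'a::euclidean_space set \<Rightarrow> (real \<Rightarrow> 'a) \<Rightarrow> ereal \<Rightarrow> bool" where
  "hits C X \<zeta> \<longleftrightarrow>
     (\<exists>T>0. ereal T \<le> \<zeta> \<and> (\<exists>c\<in>C. (X \<longlongrightarrow> c) (at_left T)))"

definition almost_surely_avoids ::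
    "'w itself \<Rightarrow> 'a::euclidean_space set \<Rightarrow> (('a \<Rightarrow> real) \<Rightarrow> 'a \<Rightarrow> real) \<Rightarrow> 'a set \<Rightarrow> bool" where
  "almost_surely_avoids _ S \<Delta> C \<longleftrightarrow>
     (\<forall>x\<in>S. \<forall>(P :: 'w measure) F X \<zeta>.
        diffusion_process S (\<lambda>f p. \<Delta> f p / 2) x P F X \<zeta> \<longrightarrow>
          (AE w in P. \<not> hits C (\<lambda>t. X t w) (\<zeta> w)))"

section \<open>The model spaces and model hypersurfaces\<close>

text \<open>Here \<open>n = CARD('n)\<close>, and \<open>\<real>\<^bsup>2n\<^esup>\<close> is represented by \<open>complex ^ 'n\<close> with
  \<open>x\<^bsub>2m-1\<^esub> = Re (z $ m)\<close> and \<open>x\<^bsub>2m\<^esub> = Im (z $ m)\<close>; its inner product is the real Euclidean one.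
  The last coordinate of \<open>\<real>\<^bsup>2n+1\<^esup>\<close> is a real number, the last two coordinates of \<open>\<real>\<^bsup>2n+2\<^esup>\<close> are
  the real and imaginary parts of a complex number.\<close>

definition area_form :: "complex \<Rightarrow> complex \<Rightarrow> real" where
  "area_form z v = Re z * Im v - Im z * Re v"

definition heisenberg :: "((complex ^ 'n::finite) \<times> real) contact_space" where
  "heisenberg = \<lparr> chalf = CARD('n), cmanifold = UNIV,
     cform = (\<lambda>p v. 1 / 2 * (\<Sum>m\<in>UNIV. area_form (fst p $ m) (fst v $ m)) - snd v),
     cmetric = (\<lambda>p u v. fst u \<bullet> fst v) \<rparr>"

definition heisenberg_hypersurface :: "((complex ^ 'n::finite) \<times> real) set" where
  "heisenberg_hypersurface = {p. snd p = 0}"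

definition sphere_contact :: "real \<Rightarrow> ((complex ^ 'n::finite) \<times> complex) contact_space" where
  "sphere_contact k = \<lparr> chalf = CARD('n), cmanifold = {p. p \<bullet> p = 1},
     cform = (\<lambda>p v. 1 / (2 * k\<^sup>2) *
       ((\<Sum>m\<in>UNIV. area_form (fst p $ m) (fst v $ m)) + area_form (snd p) (snd v))),
     cmetric = (\<lambda>p u v. 1 / k\<^sup>2 * (u \<bullet> v)) \<rparr>"

definition sphere_hypersurface :: "((complex ^ 'n::finite) \<times> complex) set" where
  "sphere_hypersurface = {p. p \<bullet> p = 1 \<and> Im (snd p) = 0}"

definition ads_product ::
    "(complex ^ 'n::finite) \<times> complex \<Rightarrow> (complex ^ 'n) \<times> complex \<Rightarrow> real" where
  "ads_product u v = fst u \<bullet> fst v - snd u \<bullet> snd v"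

definition anti_de_sitter :: "real \<Rightarrow> ((complex ^ 'n::finite) \<times> complex) contact_space" where
  "anti_de_sitter k = \<lparr> chalf = CARD('n), cmanifold = {p. ads_product p p = - 1},
     cform = (\<lambda>p v. 1 / (2 * k\<^sup>2) *
       ((\<Sum>m\<in>UNIV. area_form (fst p $ m) (fst v $ m)) + area_form (snd p) (snd v))),
     cmetric = (\<lambda>p u v. 1 / k\<^sup>2 * ads_product u v) \<rparr>"

definition anti_de_sitter_hypersurface :: "((complex ^ 'n::finite) \<times> complex) set" where
  "anti_de_sitter_hypersurface =
     {p. ads_product p p = - 1 \<and> Im (snd p) = 0 \<and> Re (snd p) > 0}"

end

theory Submission
  imports Defs "HOL-Computational_Algebra.Polynomial"
begin

text \<open>In all three models the hypersurface is a quadric \<open>\<epsilon> |z|\<^sup>2 + u\<^sup>2 = 1\<close> in \<open>\<complex>\<^sup>n \<times> \<real>\<close>, and the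
  contact volume is a constant multiple of the determinant of \<open>\<complex>\<^sup>n \<times> \<complex>\<close> with the position vector
  in its first slot. For a function \<open>\<psi>\<close> of \<open>\<rho> = |z|\<^sup>2\<close> this gives
  \<open>\<Delta>\<psi> = 2 \<kappa> (2 \<rho> u\<^sup>2 \<psi>'' + ((2n + 1) u\<^sup>2 - \<epsilon> \<rho>) \<psi>')\<close>, so that \<open>V = 2 ln (1 + \<rho>) - ln \<rho>\<close> is a
  nonnegative exhaustion function of the complement of the characteristic points with \<open>\<Delta>V\<close> bounded
  above. Composing \<open>V / R\<close> with a decreasing cutoff that is convex on \<open>[0, \<infinity>)\<close> yields test functions
  \<open>f\<^sub>R \<le> 1\<close> with \<open>f\<^sub>R \<rightarrow> 1\<close> and \<open>\<Delta>f\<^sub>R \<ge> - C / R\<close>, and taking expectations in the martingale problem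
  shows that the lifetime exceeds every \<open>t\<close> almost surely.\<close>

section \<open>Alternating forms\<close>

text \<open>Near a characteristic point \<Delta> acts on functions of |z|, to leading order, as a
  multiple of the generator of a Bessel process of dimension 2n + 1 \<ge> 3, which does not reach 0.
  Hence the barrier - ln \<rho>: the leading term 2 \<kappa> (1 - 2n) / \<rho> of its image is
  negative. The summand 2 ln (1 + \<rho>) makes V nonnegative, as (1 + \<rho>)^2 \<ge> \<rho>, and
  leaves growth like ln \<rho> at infinity for the two noncompact models. V has no compact support
  and \<Delta>V is unbounded below, so V enters only through cutoffs whose first two derivatives
  have a fixed sign on its range. The obstacle is that \<open>sub_laplacian\<close> is built from
  definite descriptions and sums over permutations. Normal, gradient and volume are identified in
  closed form before anything is differentiated, and no determinant is evaluated: a top-degree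
  alternating form is fixed by its value on one frame, and only the nonvanishing of that value
  matters. The orientation contributes a sign, which continuity makes locally constant and which
  cancels in the divergence.\<close>

definition alternating_form :: "nat \<Rightarrow> 'a::real_vector set \<Rightarrow> ((nat \<Rightarrow> 'a) \<Rightarrow> real) \<Rightarrow> bool" where
  "alternating_form m T \<beta> \<longleftrightarrow>
     (\<forall>v w. (\<forall>i<m. v i = w i) \<longrightarrow> \<beta> v = \<beta> w) \<and>
     (\<forall>v i a b u w. i < m \<and> (\<forall>j<m. v j \<in> T) \<and> u \<in> T \<and> w \<in> T \<longrightarrow>
        \<beta> (v(i := a *\<^sub>R u + b *\<^sub>R w)) = a * \<beta> (v(i := u)) + b * \<beta> (v(i := w))) \<and>
     (\<forall>v i j. i < j \<and> j < m \<and> (\<forall>l<m. v l \<in> T) \<and> v i = v j \<longrightarrow> \<beta> v = 0)"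

lemma alternating_form_cong:
  assumes "alternating_form m T \<beta>" "\<And>i. i < m \<Longrightarrow> v i = w i"
  shows "\<beta> v = \<beta> w"
  using assms(1)[unfolded alternating_form_def, THEN conjunct1, rule_format, of v w] assms(2) by simp

lemma alternating_form_lin:
  assumes "alternating_form m T \<beta>" "i < m" "\<And>j. j < m \<Longrightarrow> v j \<in> T" "u \<in> T" "w \<in> T"
  shows "\<beta> (v(i := a *\<^sub>R u + b *\<^sub>R w)) = a * \<beta> (v(i := u)) + b * \<beta> (v(i := w))"
  using assms(1)[unfolded alternating_form_def, THEN conjunct2, THEN conjunct1,
      THEN spec[of _ v], THEN spec[of _ i], THEN spec[of _ a], THEN spec[of _ b],
      THEN spec[of _ u], THEN spec[of _ w], THEN mp] assms(2-) by simp

lemma alternating_form_eq_0: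
  assumes "alternating_form m T \<beta>" "i < m" "j < m" "i \<noteq> j" "\<And>j. j < m \<Longrightarrow> v j \<in> T" "v i = v j"
  shows "\<beta> v = 0"
  using assms(1)[unfolded alternating_form_def, THEN conjunct2, THEN conjunct2,
      THEN spec[of _ v], THEN spec[of _ "min i j"], THEN spec[of _ "max i j"], THEN mp] assms(2-)
  by (cases "i < j") (simp_all add: min_def max_def)

lemma alternating_form_mono:
  assumes alt: "alternating_form m T \<beta>" and "T' \<subseteq> T"
  shows "alternating_form m T' \<beta>"
  unfolding alternating_form_def
proof (intro conjI allI impI; (elim conjE)?)
  show "\<beta> v = \<beta> w" if "\<forall>i<m. v i = w i" for v w
    using that by (intro alternating_form_cong[OF alt]) simp
  show "\<beta> (v(i := a *\<^sub>R u + b *\<^sub>R w)) = a * \<beta> (v(i := u)) + b * \<beta> (v(i := w))"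
    if "i < m" "\<forall>j<m. v j \<in> T'" "u \<in> T'" "w \<in> T'" for v i a b u w
    using that assms(2) by (intro alternating_form_lin[OF alt]) auto
  show "\<beta> v = 0" if "i < j" "j < m" "\<forall>l<m. v l \<in> T'" "v i = v j" for v i j
    using that assms(2) by (intro alternating_form_eq_0[OF alt, of i j]) auto
qed

lemma alternating_form_add:
  assumes "alternating_form m T \<beta>" "i < m" "\<And>j. j < m \<Longrightarrow> v j \<in> T" "u \<in> T" "w \<in> T"
  shows "\<beta> (v(i := u + w)) = \<beta> (v(i := u)) + \<beta> (v(i := w))"
  using alternating_form_lin[OF assms, where a = 1 and b = 1] by simp

lemma alternating_form_scale:
  assumes "alternating_form m T \<beta>" "i < m" "\<And>j. j < m \<Longrightarrow> v j \<in> T" "u \<in> T"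
  shows "\<beta> (v(i := a *\<^sub>R u)) = a * \<beta> (v(i := u))"
  using alternating_form_lin[OF assms assms(4), where a = a and b = 0] by simp

lemma alternating_form_sum:
  assumes alt: "alternating_form m T \<beta>" and T: "subspace T"
    and i: "i < m" and v: "\<And>j. j < m \<Longrightarrow> v j \<in> T" and u: "\<And>l. l \<in> A \<Longrightarrow> u l \<in> T" and "finite A"
  shows "\<beta> (v(i := (\<Sum>l\<in>A. c l *\<^sub>R u l))) = (\<Sum>l\<in>A. c l * \<beta> (v(i := u l)))"
  using \<open>finite A\<close> u
proof (induction A rule: finite_induct)
  case empty
  have "0 \<in> T" using T by (rule subspace_0)
  then show ?case using alternating_form_scale[where v = v and a = 0 and u = 0, OF alt i v]
    by (simp add: fun_upd_def)
next
  case (insert x A)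
  have "(\<Sum>l\<in>A. c l *\<^sub>R u l) \<in> T"
    by (intro subspace_sum[OF T] subspace_mul[OF T] insert.prems) auto
  then have "\<beta> (v(i := c x *\<^sub>R u x + (\<Sum>l\<in>A. c l *\<^sub>R u l))) =
      c x * \<beta> (v(i := u x)) + \<beta> (v(i := (\<Sum>l\<in>A. c l *\<^sub>R u l)))"
    using alternating_form_lin[where v = v and u = "u x" and w = "\<Sum>l\<in>A. c l *\<^sub>R u l"
        and a = "c x" and b = 1, OF alt i v] insert.prems
    by simp
  with insert.IH insert.prems insert.hyps show ?case by (simp add: fun_upd_def)
qed

lemma alternating_form_swap:
  assumes alt: "alternating_form m T \<beta>" and T: "subspace T"
    and ij: "i < m" "j < m" "i \<noteq> j" and v: "\<And>l. l < m \<Longrightarrow> v l \<in> T"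
  shows "\<beta> (v \<circ> Transposition.transpose i j) = - \<beta> v"
proof -
  have *: "v \<circ> Transposition.transpose i j = v(i := v j, j := v i)"
    by (auto simp: fun_eq_iff transpose_def)
  have vT: "v i \<in> T" "v j \<in> T" "v i + v j \<in> T" using v ij T by (auto intro: subspace_add)
  have "0 = \<beta> (v(j := v i + v j, i := v i + v j))"
    using ij vT v by (intro alternating_form_eq_0[OF alt, of i j, symmetric]) auto
  also have "\<dots> = \<beta> (v(j := v i + v j, i := v i)) + \<beta> (v(j := v i + v j, i := v j))"
    using vT v by (intro alternating_form_add[OF alt ij(1)]) auto
  also have "\<dots> = \<beta> (v(i := v i, j := v i + v j)) + \<beta> (v(i := v j, j := v i + v j))"
    using ij by (simp add: fun_upd_twist)
  also have "\<beta> (v(i := v i, j := v i + v j)) = \<beta> (v(i := v i, j := v i)) + \<beta> (v(i := v i, j := v j))"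
    using vT v by (intro alternating_form_add[OF alt ij(2)]) auto
  also have "\<beta> (v(i := v i, j := v i)) = 0"
    using ij vT v by (intro alternating_form_eq_0[OF alt ij]) auto
  also have "\<beta> (v(i := v j, j := v i + v j)) = \<beta> (v(i := v j, j := v i)) + \<beta> (v(i := v j, j := v j))"
    using vT v by (intro alternating_form_add[OF alt ij(2)]) auto
  also have "\<beta> (v(i := v j, j := v j)) = 0"
    using ij vT v by (intro alternating_form_eq_0[OF alt ij]) auto
  finally have "0 = \<beta> v + \<beta> (v(i := v j, j := v i))"
    by (simp only: fun_upd_triv add_0_left add_0_right)
  with * show ?thesis by simp
qed

text \<open>Expanding the arguments slot by slot in the spanning family reduces the claim to tuples
  of members of e. Such a tuple either repeats a member or is a permutation of e, and there swaps
  lead back to the value at e.\<close>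

lemma alternating_form_vanishes:
  assumes alt: "alternating_form m T \<beta>" and T: "subspace T" and e: "\<And>i. i < m \<Longrightarrow> e i \<in> T"
    and span: "\<And>w. w \<in> T \<Longrightarrow> \<exists>c. w = (\<Sum>i<m. c i *\<^sub>R e i)" and 0: "\<beta> e = 0"
    and v: "\<And>i. i < m \<Longrightarrow> v i \<in> T"
  shows "\<beta> v = 0"
proof -
  have perm: "\<beta> (e \<circ> p) = 0" if "p permutes {..<m}" for p
    using finite_lessThan that
  proof (induction rule: permutes_rev_induct)
    case id
    then show ?case using 0 by simp
  next
    case (swap a b p)
    have "\<beta> ((e \<circ> p) \<circ> Transposition.transpose a b) = - \<beta> (e \<circ> p)"
    proof (rule alternating_form_swap[OF alt T])
      fix l assume "l < m"
      then have "p l < m" using permutes_in_image[OF swap.hyps(4)] by simp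
      then show "(e \<circ> p) l \<in> T" using e by simp
    qed (use swap in auto)
    with swap.IH show ?case by (simp add: comp_def)
  qed
  \<comment> \<open>Induction on the number j of leading slots that are still arbitrary; all later
    slots already hold members of e.\<close>
  have "\<beta> v = 0" if "j \<le> m" "\<forall>i<m. v i \<in> T" "\<forall>i<m. j \<le> i \<longrightarrow> v i \<in> e ` {..<m}" for j v
    using that
  proof (induction j arbitrary: v)
    case 0
    then have "\<forall>i\<in>{..<m}. \<exists>l. l < m \<and> v i = e l" by auto
    then obtain q where q: "\<And>i. i < m \<Longrightarrow> q i < m \<and> v i = e (q i)"
      by (metis lessThan_iff)
    show ?case
    proof (cases "inj_on q {..<m}")
      case True
      let ?p = "\<lambda>i. if i < m then q i else i"
      have inj: "inj_on ?p {..<m}" using True by (auto simp: inj_on_def)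
      have "?p ` {..<m} = {..<m}"
        by (rule endo_inj_surj) (use q inj in auto)
      with inj have "?p permutes {..<m}"
        by (intro bij_imp_permutes) (auto simp: bij_betw_def)
      then have "\<beta> (e \<circ> ?p) = 0" by (rule perm)
      moreover have "\<beta> v = \<beta> (e \<circ> ?p)"
        by (rule alternating_form_cong[OF alt]) (use q in auto)
      ultimately show ?thesis by simp
    next
      case False
      then obtain i j where "i < m" "j < m" "i \<noteq> j" "q i = q j"
        by (auto simp: inj_on_def)
      then show ?thesis using q 0
        by (intro alternating_form_eq_0[OF alt, of i j]) auto
    qed
  next
    case (Suc j)
    then have j: "j < m" by simp
    then obtain c where c: "v j = (\<Sum>l<m. c l *\<^sub>R e l)" using span Suc.prems by blast
    have "\<beta> v = \<beta> (v(j := (\<Sum>l<m. c l *\<^sub>R e l)))" using fun_upd_idem[of v j, OF c] by simp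
    also have "\<dots> = (\<Sum>l<m. c l * \<beta> (v(j := e l)))"
      by (rule alternating_form_sum[OF alt T j]) (use Suc.prems(2) e in auto)
    also have "\<dots> = 0"
    proof (intro sum.neutral ballI)
      fix l assume l: "l \<in> {..<m}"
      have "\<beta> (v(j := e l)) = 0"
      proof (rule Suc.IH)
        show "\<forall>i<m. j \<le> i \<longrightarrow> (v(j := e l)) i \<in> e ` {..<m}"
          using Suc.prems(3) l by (auto simp: Suc_le_eq)
      qed (use j Suc.prems(2) e l in auto)
      then show "c l * \<beta> (v(j := e l)) = 0" by simp
    qed
    finally show ?case .
  qed
  from this[of m v] v show ?thesis by auto
qed

lemma alternating_form_lincomb:
  assumes "alternating_form m T \<beta>" "alternating_form m T \<gamma>"
  shows "alternating_form m T (\<lambda>v. x * \<beta> v + y * \<gamma> v)"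
proof -
  have "x * \<beta> (v(i := a *\<^sub>R u + b *\<^sub>R w)) + y * \<gamma> (v(i := a *\<^sub>R u + b *\<^sub>R w)) =
      a * (x * \<beta> (v(i := u)) + y * \<gamma> (v(i := u))) + b * (x * \<beta> (v(i := w)) + y * \<gamma> (v(i := w)))"
    if "i < m \<and> (\<forall>j<m. v j \<in> T) \<and> u \<in> T \<and> w \<in> T" for v i a b u w
    using that alternating_form_lin[OF assms(1), of i v u w a b]
      alternating_form_lin[OF assms(2), of i v u w a b] by (simp add: algebra_simps)
  moreover have "x * \<beta> v + y * \<gamma> v = x * \<beta> w + y * \<gamma> w" if "\<forall>i<m. v i = w i" for v w
    using that alternating_form_cong[OF assms(1), of v w] alternating_form_cong[OF assms(2), of v w]
    by simp
  moreover have "x * \<beta> v + y * \<gamma> v = 0"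
    if "i < j \<and> j < m \<and> (\<forall>l<m. v l \<in> T) \<and> v i = v j" for v i j
    using that alternating_form_eq_0[OF assms(1), of i j v] alternating_form_eq_0[OF assms(2), of i j v]
    by simp
  ultimately show ?thesis unfolding alternating_form_def by blast
qed

text \<open>The combination of \<beta> and \<gamma> with coefficients \<gamma> e and - \<beta> e
  vanishes on the spanning family e, hence on all of T. This serves as the statement that top-degree
  forms are unique up to a factor.\<close>

lemma alternating_form_proportional:
  assumes \<beta>: "alternating_form m T \<beta>" and \<gamma>: "alternating_form m T \<gamma>" and T: "subspace T"
    and e: "\<And>i. i < m \<Longrightarrow> e i \<in> T" "\<And>w. w \<in> T \<Longrightarrow> \<exists>c. w = (\<Sum>i<m. c i *\<^sub>R e i)"
    and v: "\<And>i. i < m \<Longrightarrow> v i \<in> T"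
  shows "\<gamma> e * \<beta> v = \<beta> e * \<gamma> v"
  using alternating_form_vanishes[OF alternating_form_lincomb[OF \<beta> \<gamma>, of "\<gamma> e" "- \<beta> e"] T e _ v]
  by simp

text \<open>This is the infinitesimal action of L on a form. When two arguments coincide, all but
  two of the summands vanish, and those two differ by a swap of their slots.\<close>

lemma alternating_form_derivation:
  assumes alt: "alternating_form m T \<beta>" and T: "subspace T" and L: "linear L"
    and LT: "\<And>w. w \<in> T \<Longrightarrow> L w \<in> T"
  shows "alternating_form m T (\<lambda>v. \<Sum>i<m. \<beta> (v(i := L (v i))))"
proof -
  have "(\<Sum>l<m. \<beta> ((v(i := a *\<^sub>R u + b *\<^sub>R w))(l := L ((v(i := a *\<^sub>R u + b *\<^sub>R w)) l)))) =
      a * (\<Sum>l<m. \<beta> ((v(i := u))(l := L ((v(i := u)) l)))) +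
      b * (\<Sum>l<m. \<beta> ((v(i := w))(l := L ((v(i := w)) l))))"
    if "i < m \<and> (\<forall>j<m. v j \<in> T) \<and> u \<in> T \<and> w \<in> T" for v i a b u w
  proof -
    have i: "i < m" and v: "\<And>j. j < m \<Longrightarrow> v j \<in> T" and uw: "u \<in> T" "w \<in> T" using that by auto
    have "\<beta> ((v(i := a *\<^sub>R u + b *\<^sub>R w))(l := L ((v(i := a *\<^sub>R u + b *\<^sub>R w)) l))) =
        a * \<beta> ((v(i := u))(l := L ((v(i := u)) l))) + b * \<beta> ((v(i := w))(l := L ((v(i := w)) l)))"
      if l: "l < m" for l
    proof (cases "l = i")
      case True
      then show ?thesis using alternating_form_lin[where v = v and a = a and b = b, OF alt i v LT[OF uw(1)] LT[OF uw(2)]]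
        by (simp add: linear_add[OF L] linear_scale[OF L])
    next
      case False
      have "\<beta> ((v(l := L (v l)))(i := a *\<^sub>R u + b *\<^sub>R w)) =
          a * \<beta> ((v(l := L (v l)))(i := u)) + b * \<beta> ((v(l := L (v l)))(i := w))"
        by (rule alternating_form_lin[OF alt i _ uw]) (use v LT in auto)
      with False show ?thesis by (simp add: fun_upd_twist)
    qed
    then show ?thesis by (simp add: sum.distrib sum_distrib_left)
  qed
  moreover have "(\<Sum>l<m. \<beta> (v(l := L (v l)))) = (\<Sum>l<m. \<beta> (w(l := L (w l))))"
    if "\<forall>i<m. v i = w i" for v w
    by (intro sum.cong refl alternating_form_cong[OF alt]) (use that in auto)
  moreover have "(\<Sum>l<m. \<beta> (v(l := L (v l)))) = 0"
    if "i < j \<and> j < m \<and> (\<forall>l<m. v l \<in> T) \<and> v i = v j" for v i j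
  proof -
    have ij: "i < m" "j < m" "i \<noteq> j" and v: "\<And>j. j < m \<Longrightarrow> v j \<in> T" and eq: "v i = v j"
      using that by auto
    have "(\<Sum>l<m. \<beta> (v(l := L (v l)))) = (\<Sum>l\<in>{i, j}. \<beta> (v(l := L (v l))))"
    proof (rule sum.mono_neutral_right)
      show "\<forall>l\<in>{..<m} - {i, j}. \<beta> (v(l := L (v l))) = 0"
        using ij v eq LT by (auto intro!: alternating_form_eq_0[OF alt ij])
    qed (use ij in auto)
    also have "\<dots> = \<beta> (v(i := L (v i))) + \<beta> (v(j := L (v j)))" using ij by simp
    also have "v(j := L (v j)) = v(i := L (v i)) \<circ> Transposition.transpose i j"
    proof
      fix x
      show "(v(j := L (v j))) x = (v(i := L (v i)) \<circ> Transposition.transpose i j) x"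
        using eq ij by (cases "x = i"; cases "x = j") auto
    qed
    also have "\<beta> \<dots> = - \<beta> (v(i := L (v i)))"
      by (rule alternating_form_swap[OF alt T ij]) (use v LT in auto)
    finally show ?thesis by (simp add: fun_upd_def)
  qed
  ultimately show ?thesis unfolding alternating_form_def by blast
qed

text \<open>On the family e only the diagonal coefficient of \<open>L (e i)\<close> survives in slot
  i. The difference of the two sides is alternating in v, so agreement at e settles it. The
  coefficient functions c play the part of a dual basis.\<close>

lemma alternating_form_trace:
  assumes alt: "alternating_form m T \<beta>" and T: "subspace T" and L: "linear L"
    and LT: "\<And>w. w \<in> T \<Longrightarrow> L w \<in> T"
    and e: "\<And>i. i < m \<Longrightarrow> e i \<in> T" and span: "\<And>w. w \<in> T \<Longrightarrow> w = (\<Sum>i<m. c w i *\<^sub>R e i)"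
    and v: "\<And>i. i < m \<Longrightarrow> v i \<in> T"
  shows "(\<Sum>i<m. \<beta> (v(i := L (v i)))) = (\<Sum>i<m. c (L (e i)) i) * \<beta> v"
proof -
  have "\<beta> (e(i := L (e i))) = c (L (e i)) i * \<beta> e" if i: "i < m" for i
  proof -
    have "\<beta> (e(i := L (e i))) = \<beta> (e(i := (\<Sum>l<m. c (L (e i)) l *\<^sub>R e l)))"
      by (rule arg_cong[OF span[OF LT[OF e[OF i]]], of "\<lambda>x. \<beta> (e(i := x))"])
    also have "\<dots> = (\<Sum>l<m. c (L (e i)) l * \<beta> (e(i := e l)))"
      by (rule alternating_form_sum[OF alt T i]) (use e in auto)
    also have "\<dots> = (\<Sum>l\<in>{i}. c (L (e i)) l * \<beta> (e(i := e l)))"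
    proof (rule sum.mono_neutral_right)
      show "\<forall>l\<in>{..<m} - {i}. c (L (e i)) l * \<beta> (e(i := e l)) = 0"
      proof
        fix l assume l: "l \<in> {..<m} - {i}"
        have "\<beta> (e(i := e l)) = 0"
          by (rule alternating_form_eq_0[OF alt i, of l]) (use e l in auto)
        then show "c (L (e i)) l * \<beta> (e(i := e l)) = 0" by simp
      qed
    qed (use i in auto)
    finally show ?thesis by simp
  qed
  then have e0: "(\<Sum>i<m. \<beta> (e(i := L (e i)))) = (\<Sum>i<m. c (L (e i)) i) * \<beta> e"
    by (simp add: sum_distrib_right)
  let ?t = "\<Sum>i<m. c (L (e i)) i"
  have "1 * (\<Sum>i<m. \<beta> (v(i := L (v i)))) + (- ?t) * \<beta> v = 0"
  proof (rule alternating_form_vanishes[OF alternating_form_lincomb[OF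
          alternating_form_derivation[OF alt T L LT] alt, of 1 "- ?t"] T e])
    show "\<exists>c. w = (\<Sum>i<m. c i *\<^sub>R e i)" if "w \<in> T" for w using span[OF that] by blast
  qed (use e0 v in auto)
  then show ?thesis by simp
qed

section \<open>Wedge products as antisymmetrisations\<close>

text \<open>There is no factor 1 / m!, so that the factorials in \<open>wedge\<close> remain visible
  as explicit constants.\<close>

definition alternation :: "nat \<Rightarrow> ((nat \<Rightarrow> 'a) \<Rightarrow> real) \<Rightarrow> (nat \<Rightarrow> 'a) \<Rightarrow> real" where
  "alternation m t v = (\<Sum>\<pi> | \<pi> permutes {..<m}. of_int (sign \<pi>) * t (\<lambda>i. v (\<pi> i)))"

lemma sign_comp_permutes:
  assumes "p permutes S" "q permutes S" "finite S"
  shows "sign (p \<circ> q) = sign p * sign q"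
  using assms by (intro sign_compose) (auto simp: permutation_permutes)

lemma alternating_form_alternation:
  fixes t :: "(nat \<Rightarrow> 'a::real_vector) \<Rightarrow> real"
  assumes cong: "\<And>v w. (\<And>i. i < m \<Longrightarrow> v i = w i) \<Longrightarrow> t v = t w"
    and lin: "\<And>v i a b u w. i < m \<Longrightarrow>
      t (v(i := a *\<^sub>R u + b *\<^sub>R w)) = a * t (v(i := u)) + b * t (v(i := w))"
  shows "alternating_form m UNIV (alternation m t)"
  unfolding alternating_form_def
proof (intro conjI allI impI; (elim conjE)?)
  show "alternation m t v = alternation m t w" if vw: "\<forall>i<m. v i = w i" for v w
    unfolding alternation_def
  proof (intro sum.cong refl arg_cong2[where f = "(*)"] cong)
    fix \<pi> i assume "\<pi> \<in> {\<pi>. \<pi> permutes {..<m}}" "i < m"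
    then have "\<pi> i < m" using permutes_in_image[of \<pi> "{..<m}" i] by simp
    then show "v (\<pi> i) = w (\<pi> i)" using vw by simp
  qed
  show "alternation m t (v(i := a *\<^sub>R u + b *\<^sub>R w)) =
      a * alternation m t (v(i := u)) + b * alternation m t (v(i := w))"
    if i: "i < m" for v i a b u w
  proof -
    have "of_int (sign \<pi>) * t (\<lambda>k. (v(i := a *\<^sub>R u + b *\<^sub>R w)) (\<pi> k)) =
        a * (of_int (sign \<pi>) * t (\<lambda>k. (v(i := u)) (\<pi> k))) +
        b * (of_int (sign \<pi>) * t (\<lambda>k. (v(i := w)) (\<pi> k)))" if \<pi>: "\<pi> permutes {..<m}" for \<pi>
    proof -
      \<comment> \<open>After permuting, the vector of slot i is read in slot
        \<open>inv \<pi> i\<close>.\<close>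
      have *: "(\<lambda>k. (v(i := x)) (\<pi> k)) = (\<lambda>k. v (\<pi> k))(inv \<pi> i := x)" for x
        using permutes_inverses[OF \<pi>] by (auto simp: fun_eq_iff)
      have "inv \<pi> i < m"
        using permutes_in_image[OF permutes_inv[OF \<pi>], of i] i by simp
      then show ?thesis unfolding * by (subst lin) (auto simp: algebra_simps)
    qed
    then show ?thesis
      unfolding alternation_def by (simp add: sum.distrib sum_distrib_left)
  qed
  show "alternation m t v = 0" if ij: "i < j" "j < m" and eq: "v i = v j" for v i j
  proof -
    let ?\<tau> = "Transposition.transpose i j"
    have \<tau>: "?\<tau> permutes {..<m}" using ij by (intro permutes_swap_id) auto
    have "alternation m t v =
        (\<Sum>\<pi> | \<pi> permutes {..<m}. of_int (sign (?\<tau> \<circ> \<pi>)) * t (\<lambda>k. v ((?\<tau> \<circ> \<pi>) k)))"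
      unfolding alternation_def by (rule setum_permutations_compose_left[OF \<tau>])
    also have "\<dots> = (\<Sum>\<pi> | \<pi> permutes {..<m}. - (of_int (sign \<pi>) * t (\<lambda>k. v (\<pi> k))))"
    proof (rule sum.cong[OF refl])
      fix \<pi> assume "\<pi> \<in> {\<pi>. \<pi> permutes {..<m}}"
      then have "sign (?\<tau> \<circ> \<pi>) = - sign \<pi>"
        using ij by (subst sign_comp_permutes[OF \<tau>]) (auto simp: sign_swap_id)
      moreover have "v (?\<tau> k) = v k" for k using eq by (cases "k = i"; cases "k = j") auto
      ultimately show "of_int (sign (?\<tau> \<circ> \<pi>)) * t (\<lambda>k. v ((?\<tau> \<circ> \<pi>) k)) =
          - (of_int (sign \<pi>) * t (\<lambda>k. v (\<pi> k)))" by simp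
    qed
    also have "\<dots> = - alternation m t v" unfolding alternation_def by (simp add: sum_negf)
    finally show ?thesis by simp
  qed
qed

text \<open>Supplies the reindexing of \<open>wedge_alternation\<close>: a permutation of the last l
  slots, extended by the identity on the first k, keeps its sign.\<close>

lemma permutes_shift:
  fixes k l :: nat
  assumes \<rho>: "\<rho> permutes {..<l}"
  obtains \<rho>' where "\<rho>' permutes {..<k + l}" "sign \<rho>' = sign \<rho>"
    "\<And>i. i < k \<Longrightarrow> \<rho>' i = i" "\<And>i. \<rho>' (k + i) = k + \<rho> i"
proof -
  let ?f = "\<lambda>i. k + i"
  let ?r = "map_permutation {..<l} ?f \<rho>"
  have bij: "bij_betw ?f {..<l} {k..<k + l}"
    by (rule bij_betw_byWitness[where f' = "\<lambda>i. i - k"]) auto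
  have perm: "?r permutes {k..<k + l}"
    by (rule map_permutation_permutes[OF bij \<rho>])
  show ?thesis
  proof
    show "?r permutes {..<k + l}" by (rule permutes_subset[OF perm]) auto
    show "sign ?r = sign \<rho>" by (rule sign_map_permutation) (use \<rho> in auto)
    show "?r i = i" if "i < k" for i using perm that by (intro permutes_not_in) auto
    show "?r (k + i) = k + \<rho> i" for i
    proof (cases "i < l")
      case True
      then show ?thesis using map_permutation_apply[of ?f "{..<l}" i \<rho>] by simp
    next
      case False
      then have "\<rho> i = i" "?r (k + i) = k + i"
        using permutes_not_in[OF \<rho>] permutes_not_in[OF perm] by auto
      then show ?thesis by simp
    qed
  qed
qed

text \<open>Each permutation of the inner antisymmetrisation is absorbed into the outer sum by
  composing on the right with its extension. The inner sum therefore contributes l! equal copies,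
  which cancel the \<open>fact l\<close> in \<open>wedge\<close>.\<close>

lemma wedge_alternation:
  assumes cong: "\<And>p v w. (\<And>i. i < k \<Longrightarrow> v i = w i) \<Longrightarrow> \<alpha> p v = \<alpha> p w"
  shows "wedge k l \<alpha> (\<lambda>p v. c * alternation l (t p) v) p v =
    c / fact k * alternation (k + l) (\<lambda>v. \<alpha> p v * t p (\<lambda>i. v (k + i))) v"
proof -
  let ?S = "{\<pi>. \<pi> permutes {..<k + l}}" and ?R = "{\<rho>. \<rho> permutes {..<l}}"
  let ?T = "\<lambda>\<pi>. of_int (sign \<pi>) * \<alpha> p (\<lambda>i. v (\<pi> i)) * t p (\<lambda>i. v (\<pi> (k + i))) :: real"
  have "(\<Sum>\<pi>\<in>?S. of_int (sign \<pi>) * \<alpha> p (\<lambda>i. v (\<pi> i)) * of_int (sign \<rho>) * t p (\<lambda>i. v (\<pi> (k + \<rho> i))))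
      = (\<Sum>\<pi>\<in>?S. ?T \<pi>)" if \<rho>: "\<rho> permutes {..<l}" for \<rho>
  proof -
    obtain \<rho>' where \<rho>': "\<rho>' permutes {..<k + l}" "sign \<rho>' = sign \<rho>"
      "\<And>i. i < k \<Longrightarrow> \<rho>' i = i" "\<And>i. \<rho>' (k + i) = k + \<rho> i"
      using permutes_shift[where k = k, OF \<rho>] by metis
    have "(\<Sum>\<pi>\<in>?S. ?T \<pi>) = (\<Sum>\<pi>\<in>?S. ?T (\<pi> \<circ> \<rho>'))"
      by (rule sum_permutations_compose_right[OF \<rho>'(1)])
    also have "\<dots> = (\<Sum>\<pi>\<in>?S. of_int (sign \<pi>) * \<alpha> p (\<lambda>i. v (\<pi> i)) * of_int (sign \<rho>) *
        t p (\<lambda>i. v (\<pi> (k + \<rho> i))))"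
    proof (rule sum.cong[OF refl])
      fix \<pi> assume "\<pi> \<in> ?S"
      then have "sign (\<pi> \<circ> \<rho>') = sign \<pi> * sign \<rho>"
        using \<rho>' by (subst sign_comp_permutes[OF _ \<rho>'(1)]) auto
      moreover have "\<alpha> p (\<lambda>i. v ((\<pi> \<circ> \<rho>') i)) = \<alpha> p (\<lambda>i. v (\<pi> i))"
        by (rule cong) (simp add: \<rho>'(3))
      ultimately show "?T (\<pi> \<circ> \<rho>') = of_int (sign \<pi>) * \<alpha> p (\<lambda>i. v (\<pi> i)) * of_int (sign \<rho>) *
          t p (\<lambda>i. v (\<pi> (k + \<rho> i)))" by (simp add: \<rho>'(4))
    qed
    finally show ?thesis by simp
  qed
  then have "(\<Sum>\<rho>\<in>?R. \<Sum>\<pi>\<in>?S. of_int (sign \<pi>) * \<alpha> p (\<lambda>i. v (\<pi> i)) * of_int (sign \<rho>) *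
      t p (\<lambda>i. v (\<pi> (k + \<rho> i)))) = fact l * (\<Sum>\<pi>\<in>?S. ?T \<pi>)"
    by (simp add: card_permutations[OF refl finite_lessThan])
  then have "(\<Sum>\<pi>\<in>?S. of_int (sign \<pi>) * \<alpha> p (\<lambda>i. v (\<pi> i)) *
      alternation l (t p) (\<lambda>i. v (\<pi> (k + i)))) = fact l * (\<Sum>\<pi>\<in>?S. ?T \<pi>)"
    unfolding alternation_def
    by (subst (asm) sum.swap) (simp add: sum_distrib_left mult_ac)
  moreover have "wedge k l \<alpha> (\<lambda>p v. c * alternation l (t p) v) p v =
      c * (\<Sum>\<pi>\<in>?S. of_int (sign \<pi>) * \<alpha> p (\<lambda>i. v (\<pi> i)) *
        alternation l (t p) (\<lambda>i. v (\<pi> (k + i)))) / (fact k * fact l)"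
    unfolding wedge_def by (simp add: sum_distrib_left mult_ac)
  ultimately show ?thesis
    unfolding alternation_def by (simp add: mult_ac)
qed

lemma wedge_power_alternation:
  assumes cong: "\<And>p v w. (\<And>i. i < k \<Longrightarrow> v i = w i) \<Longrightarrow> \<alpha> p v = \<alpha> p w"
  shows "wedge_power k \<alpha> n =
    (\<lambda>p v. (1 / fact k) ^ n * alternation (k * n) (\<lambda>v. \<Prod>j<n. \<alpha> p (\<lambda>i. v (k * j + i))) v)"
proof (induction n)
  case 0
  show ?case by (simp add: alternation_def)
next
  case (Suc n)
  show ?case
  proof (intro ext)
    fix p v
    have "wedge_power k \<alpha> (Suc n) p v = (1 / fact k) ^ n / fact k * alternation (k + k * n)
        (\<lambda>v. \<alpha> p v * (\<Prod>j<n. \<alpha> p (\<lambda>i. v (k + (k * j + i))))) v"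
      unfolding wedge_power.simps Suc.IH by (rule wedge_alternation[OF cong])
    also have "(\<lambda>v. \<alpha> p v * (\<Prod>j<n. \<alpha> p (\<lambda>i. v (k + (k * j + i))))) =
        (\<lambda>v. \<Prod>j<Suc n. \<alpha> p (\<lambda>i. v (k * j + i)))"
      by (simp add: prod.lessThan_Suc_shift add.assoc del: prod.lessThan_Suc)
    finally show "wedge_power k \<alpha> (Suc n) p v = (1 / fact k) ^ Suc n *
        alternation (k * Suc n) (\<lambda>v. \<Prod>j<Suc n. \<alpha> p (\<lambda>i. v (k * j + i))) v" by simp
  qed
qed

section \<open>The volume form of a symplectic form\<close>

text \<open>For skew B this is 2^n times the wedge product of the 1-form B(x, .) with B^n. Up to a
  factor that is B^(n+1) with x inserted in its first slot, which is the determinant of the overview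
  when B is symplectic.\<close>

definition liouville_form :: "('a \<Rightarrow> 'a \<Rightarrow> real) \<Rightarrow> nat \<Rightarrow> 'a \<Rightarrow> (nat \<Rightarrow> 'a) \<Rightarrow> real" where
  "liouville_form B n x = alternation (1 + 2 * n)
     (\<lambda>v. B x (v 0) * (\<Prod>j<n. B (v (2 * j + 1)) (v (2 * j + 2))))"

lemma alternating_form_liouville:
  fixes B :: "'a::real_vector \<Rightarrow> 'a \<Rightarrow> real"
  assumes B: "bilinear B"
  shows "alternating_form (1 + 2 * n) UNIV (liouville_form B n x)"
  unfolding liouville_form_def
proof (rule alternating_form_alternation)
  note bil = bilinear_ladd[OF B] bilinear_radd[OF B] bilinear_lmul[OF B] bilinear_rmul[OF B]
  show "B x (v 0) * (\<Prod>j<n. B (v (2 * j + 1)) (v (2 * j + 2))) =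
      B x (w 0) * (\<Prod>j<n. B (w (2 * j + 1)) (w (2 * j + 2)))"
    if "\<And>i. i < 1 + 2 * n \<Longrightarrow> v i = w i" for v w
    using that by (intro arg_cong2[where f = "(*)"] prod.cong refl) auto
  show "B x ((v(i := a *\<^sub>R u + b *\<^sub>R w)) 0) *
        (\<Prod>j<n. B ((v(i := a *\<^sub>R u + b *\<^sub>R w)) (2 * j + 1)) ((v(i := a *\<^sub>R u + b *\<^sub>R w)) (2 * j + 2))) =
      a * (B x ((v(i := u)) 0) * (\<Prod>j<n. B ((v(i := u)) (2 * j + 1)) ((v(i := u)) (2 * j + 2)))) +
      b * (B x ((v(i := w)) 0) * (\<Prod>j<n. B ((v(i := w)) (2 * j + 1)) ((v(i := w)) (2 * j + 2))))"
    if "i < 1 + 2 * n" for v i a b u w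
    using that
  proof (induction n)
    case 0
    then show ?case by (simp add: bil)
  next
    case (Suc n)
    consider "i < 1 + 2 * n" | "i = 2 * n + 1" | "i = 2 * n + 2" using Suc.prems
      by (cases "i < 1 + 2 * n"; cases "i = 2 * n + 1") auto
    then show ?case
    proof cases
      case 1
      show ?thesis
        using arg_cong[OF Suc.IH[OF 1], of "\<lambda>y. y * B (v (2 * n + 1)) (v (2 * n + 2))"] 1
        by (simp add: algebra_simps)
    next
      case 2
      have "(\<Prod>j<n. B ((v(i := y)) (2 * j + 1)) ((v(i := y)) (2 * j + 2))) =
          (\<Prod>j<n. B (v (2 * j + 1)) (v (2 * j + 2)))" for y
        using 2 by (intro prod.cong) auto
      then show ?thesis using 2 by (simp add: bil algebra_simps)
    next
      case 3
      have "(\<Prod>j<n. B ((v(i := y)) (2 * j + 1)) ((v(i := y)) (2 * j + 2))) =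
          (\<Prod>j<n. B (v (2 * j + 1)) (v (2 * j + 2)))" for y
        using 3 by (intro prod.cong) auto
      then show ?thesis using 3 by (simp add: bil algebra_simps)
    qed
  qed
qed

lemma liouville_form_linear:
  assumes B: "bilinear B"
  shows "linear (\<lambda>x. liouville_form B n x v)"
  unfolding liouville_form_def alternation_def
  by (intro linear_compose_sum ballI linearI)
    (auto simp: bilinear_ladd[OF B] bilinear_lmul[OF B] algebra_simps)

text \<open>Contracting B(x, .) \<and> B^n with x leaves B(x, x) B^n and terms that contain B(x, .)
  twice. In the permutation sum, group by the slot c that receives x: c = 0 gives B(x, x) = 0, and
  otherwise swapping slot 0 with the partner of c keeps the product and flips the sign.\<close>

lemma liouville_form_self:
  fixes B :: "'a::real_vector \<Rightarrow> 'a \<Rightarrow> real"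
  assumes B: "bilinear B" and skew: "\<And>x y. B x y = - B y x" and a: "a < 1 + 2 * n" "w a = x"
  shows "liouville_form B n x w = 0"
proof -
  let ?S = "{\<pi>. \<pi> permutes {..<1 + 2 * n}}"
  let ?t = "\<lambda>v. B x (v 0) * (\<Prod>j<n. B (v (2 * j + 1)) (v (2 * j + 2)))"
  let ?f = "\<lambda>\<pi>. of_int (sign \<pi>) * ?t (\<lambda>i. w (\<pi> i))"
  have 0: "B x x = 0" using skew[of x x] by simp
  \<comment> \<open>Here c' is the partner of c in pair j; swapping it with slot 0 exchanges the two
    factors that involve x.\<close>
  have sym: "?t (y \<circ> Transposition.transpose 0 c') = ?t y"
    if j: "j < n" and c: "{c, c'} = {2 * j + 1, 2 * j + 2}" "y c = x" for y c c' j
  proof -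
    let ?y = "y \<circ> Transposition.transpose 0 c'"
    have split: "(\<Prod>i<n. B (z (2 * i + 1)) (z (2 * i + 2))) =
        B (z (2 * j + 1)) (z (2 * j + 2)) * (\<Prod>i\<in>{..<n} - {j}. B (z (2 * i + 1)) (z (2 * i + 2)))" for z
      using j by (subst prod.remove[of _ j]) auto
    have c': "c' = 2 * j + 1 \<or> c' = 2 * j + 2" using c(1) by blast
    have "(\<Prod>i\<in>{..<n} - {j}. B (?y (2 * i + 1)) (?y (2 * i + 2))) =
        (\<Prod>i\<in>{..<n} - {j}. B (y (2 * i + 1)) (y (2 * i + 2)))"
    proof (intro prod.cong refl)
      fix i assume i: "i \<in> {..<n} - {j}"
      then have "2 * i + 1 \<noteq> c'" "2 * i + 2 \<noteq> c'" using c' by auto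
      moreover have "2 * i + 1 \<noteq> 0" "2 * i + 2 \<noteq> 0" by auto
      ultimately show "B (?y (2 * i + 1)) (?y (2 * i + 2)) = B (y (2 * i + 1)) (y (2 * i + 2))"
        unfolding comp_def by (simp only: transpose_apply_other not_False_eq_True)
    qed
    moreover have "B x (?y 0) * B (?y (2 * j + 1)) (?y (2 * j + 2)) =
        B x (y 0) * B (y (2 * j + 1)) (y (2 * j + 2))"
    proof -
      have "(c = 2 * j + 1 \<and> c' = 2 * j + 2) \<or> (c = 2 * j + 2 \<and> c' = 2 * j + 1)"
        using c(1) by (auto simp: doubleton_eq_iff)
      then show ?thesis
      proof
        assume "c = 2 * j + 1 \<and> c' = 2 * j + 2"
        then show ?thesis using c(2) by simp
      next
        assume "c = 2 * j + 2 \<and> c' = 2 * j + 1"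
        then show ?thesis using c(2) skew[of _ x] by simp
      qed
    qed
    ultimately show ?thesis unfolding split[of ?y] split[of y] by (simp only: mult.assoc[symmetric])
  qed
  have "(\<Sum>\<pi> | \<pi> \<in> ?S \<and> \<pi> c = a. ?f \<pi>) = 0" if c: "c < 1 + 2 * n" for c
  proof (cases "c = 0")
    case True
    then show ?thesis using a 0 by (intro sum.neutral) auto
  next
    case False
    have "c = 2 * ((c - 1) div 2) + 1 \<or> c = 2 * ((c - 1) div 2) + 2"
      using False by presburger
    then obtain j where j: "c = 2 * j + 1 \<or> c = 2 * j + 2" by blast
    then obtain c' where c': "{c, c'} = {2 * j + 1, 2 * j + 2}" "c \<noteq> c'" "0 < c'" "c' < 1 + 2 * n" "j < n"
    proof (elim disjE)
      assume cj: "c = 2 * j + 1"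
      show thesis by (rule that[of "2 * j + 2"]) (use cj c in auto)
    next
      assume cj: "c = 2 * j + 2"
      show thesis by (rule that[of "2 * j + 1"]) (use cj c in auto)
    qed
    let ?\<tau> = "Transposition.transpose 0 c'"
    let ?A = "{\<pi>. \<pi> \<in> ?S \<and> \<pi> c = a}"
    have \<tau>: "?\<tau> permutes {..<1 + 2 * n}" using c' by (intro permutes_swap_id) auto
    have \<tau>c: "?\<tau> c = c" using False c' by (intro transpose_apply_other) auto
    have "sum ?f ?A = (\<Sum>\<pi>\<in>?A. ?f (\<pi> \<circ> ?\<tau>))"
      by (rule sum.reindex_bij_witness[of _ "\<lambda>\<pi>. \<pi> \<circ> ?\<tau>" "\<lambda>\<pi>. \<pi> \<circ> ?\<tau>"])
        (auto simp: comp_assoc \<tau>c intro!: permutes_compose[OF \<tau>[simplified]])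
    also have "\<dots> = (\<Sum>\<pi>\<in>?A. - ?f \<pi>)"
    proof (rule sum.cong[OF refl])
      fix \<pi> assume \<pi>: "\<pi> \<in> ?A"
      have "sign (\<pi> \<circ> ?\<tau>) = - sign \<pi>"
        using \<pi> c' by (subst sign_comp_permutes[OF _ \<tau>]) (auto simp: sign_swap_id)
      moreover have "?t (\<lambda>i. w ((\<pi> \<circ> ?\<tau>) i)) = ?t (\<lambda>i. w (\<pi> i))"
        using sym[OF \<open>j < n\<close> c'(1), of "\<lambda>i. w (\<pi> i)"] \<pi> a by (simp add: comp_def)
      ultimately show "?f (\<pi> \<circ> ?\<tau>) = - ?f \<pi>" by simp
    qed
    also have "\<dots> = - sum ?f ?A" by (simp add: sum_negf)
    finally show ?thesis by simp
  qed
  note zero = this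
  have "(\<Sum>c<1 + 2 * n. \<Sum>\<pi> | \<pi> \<in> ?S \<and> inv \<pi> a = c. ?f \<pi>) = 0"
  proof (rule sum.neutral, rule ballI)
    fix c assume c: "c \<in> {..<1 + 2 * n}"
    have "{\<pi>. \<pi> \<in> ?S \<and> inv \<pi> a = c} = {\<pi>. \<pi> \<in> ?S \<and> \<pi> c = a}"
      by (auto simp: permutes_inv_eq permutes_inverses)
    then show "sum ?f {\<pi>. \<pi> \<in> ?S \<and> inv \<pi> a = c} = 0" using zero[of c] c by simp
  qed
  also have "(\<Sum>c<1 + 2 * n. \<Sum>\<pi> | \<pi> \<in> ?S \<and> inv \<pi> a = c. ?f \<pi>) = sum ?f ?S"
  proof (rule sum.group)
    show "(\<lambda>\<pi>. inv \<pi> a) ` ?S \<subseteq> {..<1 + 2 * n}"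
    proof
      fix c assume "c \<in> (\<lambda>\<pi>. inv \<pi> a) ` ?S"
      then obtain \<pi> where "\<pi> permutes {..<1 + 2 * n}" "c = inv \<pi> a" by auto
      then show "c \<in> {..<1 + 2 * n}"
        using permutes_in_image[OF permutes_inv, of \<pi> "{..<1 + 2 * n}" a] a by simp
    qed
  qed (auto intro: finite_permutations)
  finally show ?thesis unfolding liouville_form_def alternation_def by simp
qed

text \<open>Counting x as slot 0 turns the form into one of degree 2n + 2, so that it behaves like a
  determinant. The new relation, an argument equal to x, is
  \<open>liouville_form_self\<close>.\<close>

lemma alternating_form_liouville_Suc:
  fixes B :: "'a::real_vector \<Rightarrow> 'a \<Rightarrow> real"
  assumes B: "bilinear B" and skew: "\<And>x y. B x y = - B y x"
  shows "alternating_form (2 + 2 * n) UNIV (\<lambda>w. liouville_form B n (w 0) (\<lambda>i. w (Suc i)))"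
  unfolding alternating_form_def
proof (intro conjI allI impI; (elim conjE)?)
  note alt = alternating_form_liouville[OF B, of n]
  let ?L = "\<lambda>w. liouville_form B n (w 0) (\<lambda>i. w (Suc i))"
  show "?L v = ?L w" if vw: "\<forall>i<2 + 2 * n. v i = w i" for v w
  proof -
    have "liouville_form B n (v 0) (\<lambda>i. v (Suc i)) = liouville_form B n (v 0) (\<lambda>i. w (Suc i))"
      by (rule alternating_form_cong[OF alt]) (use vw in simp)
    then show ?thesis using vw by simp
  qed
  show "?L (v(i := a *\<^sub>R u + b *\<^sub>R w)) = a * ?L (v(i := u)) + b * ?L (v(i := w))"
    if "i < 2 + 2 * n" for v i a b u w
  proof (cases i)
    case 0
    then show ?thesis
      using linear_add[OF liouville_form_linear[OF B]] linear_scale[OF liouville_form_linear[OF B]]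
      by simp
  next
    case (Suc l)
    have "(\<lambda>k. (v(i := y)) (Suc k)) = (\<lambda>k. v (Suc k))(l := y)" for y using Suc by auto
    then show ?thesis
      using Suc that alternating_form_lin[OF alt, of l "\<lambda>k. v (Suc k)" u w "v 0" a b] by simp
  qed
  show "?L v = 0" if "i < j" "j < 2 + 2 * n" "v i = v j" for v i j
  proof (cases i)
    case 0
    then show ?thesis
      using that liouville_form_self[OF B skew, of "j - 1" n "\<lambda>i. v (Suc i)" "v 0"] by simp
  next
    case (Suc l)
    then show ?thesis
      using that by (intro alternating_form_eq_0[OF alt, of l "j - 1"]) auto
  qed
qed

text \<open>The matrix of the standard symplectic form in a basis numbered from 1, with pairs (2j +
  1, 2j + 2). Index 0 is left for the vector that is fed to the 1-form B(x, .).\<close>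

definition darboux :: "nat \<Rightarrow> nat \<Rightarrow> real" where
  "darboux i k = (if odd i \<and> k = i + 1 then 1 else if odd k \<and> i = k + 1 then - 1 else 0)"

text \<open>The permutation exchanges the pairs (2j + 1, 2j + 2) and (2n + 1, 2n + 2) as blocks. It
  relabels a pair as the last one in \<open>sign_pair_product_nonneg\<close> without changing any
  matrix entry.\<close>

lemma darboux_swap_pairs:
  fixes j n x y :: nat
  defines "\<sigma> \<equiv> Transposition.transpose (2 * j + 1) (2 * n + 1) \<circ> Transposition.transpose (2 * j + 2) (2 * n + 2)"
  shows "darboux (\<sigma> x) (\<sigma> y) = darboux x y"
proof -
  define \<sigma>' where "\<sigma>' z = (if z = 2 * j + 1 then 2 * n + 1 else if z = 2 * j + 2 then 2 * n + 2
      else if z = 2 * n + 1 then 2 * j + 1 else if z = 2 * n + 2 then 2 * j + 2 else z)" for z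
  have neq: "2 * j + 1 \<noteq> 2 * n + 2" "2 * j + 2 \<noteq> 2 * n + 1" by presburger+
  have \<sigma>: "\<sigma> z = \<sigma>' z" for z
    unfolding \<sigma>_def \<sigma>'_def comp_def using neq by (auto simp: transpose_def)
  have par: "odd (\<sigma>' z) \<longleftrightarrow> odd z" for z unfolding \<sigma>'_def by auto
  have inj: "\<sigma>' u = \<sigma>' z \<longleftrightarrow> u = z" for u z unfolding \<sigma>'_def using neq by auto
  have suc: "\<sigma>' (z + 1) = \<sigma>' z + 1" if "odd z" for z
  proof -
    from that have "z + 1 = 2 * i + 2 \<longleftrightarrow> z = 2 * i + 1" "z + 1 \<noteq> 2 * i + 1" "z \<noteq> 2 * i + 2" for i
      by presburger+
    then show ?thesis unfolding \<sigma>'_def by auto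
  qed
  have "\<sigma>' y = \<sigma>' x + 1 \<longleftrightarrow> y = x + 1" if "odd x" for x y
    using suc[OF that] inj[of y "x + 1"] by simp
  then show ?thesis unfolding \<sigma> darboux_def par by (simp cong: conj_cong)
qed

text \<open>All nonzero terms of the permutation expansion have the same sign: exchanging whole
  pairs is even, and reversing one pair changes both the sign of \<pi> and one matrix entry. The
  induction relabels the values in the last two slots as 2n + 1 and 2n + 2.\<close>

lemma sign_pair_product_nonneg:
  assumes "\<pi> permutes {1..2 * n}"
  shows "0 \<le> of_int (sign \<pi>) * (\<Prod>j<n. darboux (\<pi> (2 * j + 1)) (\<pi> (2 * j + 2)))"
  using assms
proof (induction n arbitrary: \<pi>)
  case 0
  then have "\<pi> = id" by simp
  then show ?case by simp
next
  case (Suc n)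
  let ?F = "\<lambda>\<pi>. of_int (sign \<pi>) * (\<Prod>j<Suc n. darboux (\<pi> (2 * j + 1)) (\<pi> (2 * j + 2)))"
  let ?S = "{1..2 * Suc n}"
  \<comment> \<open>If 2n + 1 is fixed, then either 2n + 2 is fixed too and the induction hypothesis
    applies to the rest, or the last factor of the product is 0.\<close>
  have fixed: "0 \<le> ?F \<rho>" if \<rho>: "\<rho> permutes ?S" and last: "\<rho> (2 * n + 1) = 2 * n + 1" for \<rho>
  proof (cases "\<rho> (2 * n + 2) = 2 * n + 2")
    case True
    have "\<rho> permutes {1..2 * n}"
    proof (rule permutes_superset[OF \<rho>])
      fix x assume "x \<in> ?S - {1..2 * n}"
      then have "x = 2 * n + 1 \<or> x = 2 * n + 2" by auto
      then show "\<rho> x = x" using True last by auto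
    qed
    with Suc.IH[of \<rho>] show ?thesis using last True by (simp add: darboux_def mult.assoc)
  next
    case False
    then have "darboux (\<rho> (2 * n + 1)) (\<rho> (2 * n + 2)) = 0"
      using last by (simp add: darboux_def) presburger
    then show ?thesis by simp
  qed
  let ?i = "\<pi> (2 * n + 1)" and ?k = "\<pi> (2 * n + 2)"
  have ik: "?i \<in> ?S" "?k \<in> ?S" unfolding permutes_in_image[OF Suc.prems] by auto
  show ?case
  proof (cases "darboux ?i ?k = 0")
    case True
    then show ?thesis by simp
  next
    case False
    have "(odd ?i \<and> ?k = ?i + 1) \<or> (odd ?k \<and> ?i = ?k + 1)"
      using False by (auto simp: darboux_def split: if_splits)
    then obtain j where j: "(?i = 2 * j + 1 \<and> ?k = 2 * j + 2) \<or> (?i = 2 * j + 2 \<and> ?k = 2 * j + 1)"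
    proof (elim disjE conjE)
      assume "odd ?i" and k: "?k = ?i + 1"
      then obtain b where "?i = 2 * b + 1" by (elim oddE)
      then show thesis using that[of b] k by simp
    next
      assume "odd ?k" and i: "?i = ?k + 1"
      then obtain b where "?k = 2 * b + 1" by (elim oddE)
      then show thesis using that[of b] i by simp
    qed
    have "?i \<le> 2 * n + 2" "?k \<le> 2 * n + 2" using ik by simp_all
    with j have "j \<le> n" by linarith
    define \<sigma> where "\<sigma> = Transposition.transpose (2 * j + 1) (2 * n + 1) \<circ> Transposition.transpose (2 * j + 2) (2 * n + 2)"
    have t: "Transposition.transpose (2 * j + 1) (2 * n + 1) permutes ?S"
      "Transposition.transpose (2 * j + 2) (2 * n + 2) permutes ?S"
      using \<open>j \<le> n\<close> by (auto intro!: permutes_swap_id)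
    have \<sigma>: "\<sigma> permutes ?S" unfolding \<sigma>_def by (rule permutes_compose[OF t(2) t(1)])
    have "sign \<sigma> = 1" unfolding \<sigma>_def by (subst sign_comp_permutes[OF t]) (auto simp: sign_swap_id)
    have neq: "2 * j + 1 \<noteq> 2 * n + 2" "2 * j + 2 \<noteq> 2 * n + 1" by presburger+
    then have \<sigma>j: "\<sigma> (2 * j + 1) = 2 * n + 1" "\<sigma> (2 * j + 2) = 2 * n + 2"
      unfolding \<sigma>_def comp_def by (auto simp: transpose_def)
    let ?\<rho> = "\<sigma> \<circ> \<pi>"
    have \<rho>: "?\<rho> permutes ?S" by (rule permutes_compose[OF Suc.prems \<sigma>])
    have "sign ?\<rho> = sign \<pi>"
      using \<open>sign \<sigma> = 1\<close> by (subst sign_comp_permutes[OF \<sigma> Suc.prems]) auto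
    moreover have "darboux (?\<rho> x) (?\<rho> y) = darboux (\<pi> x) (\<pi> y)" for x y
      unfolding \<sigma>_def comp_def by (rule darboux_swap_pairs[unfolded comp_def])
    ultimately have F: "?F ?\<rho> = ?F \<pi>" by (simp only:)
    show ?thesis
    proof (cases "?i = 2 * j + 1")
      case True
      then have "?\<rho> (2 * n + 1) = 2 * n + 1" by (simp only: comp_apply \<sigma>j)
      from fixed[OF \<rho> this] show ?thesis by (simp only: F)
    next
      case False
      with j have "?i = 2 * j + 2" "?k = 2 * j + 1" by blast+
      then have last: "?\<rho> (2 * n + 1) = 2 * n + 2" "?\<rho> (2 * n + 2) = 2 * n + 1"
        by (simp_all only: comp_apply \<sigma>j)
      let ?\<tau> = "Transposition.transpose (2 * n + 1) (2 * n + 2)"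
      have \<tau>: "?\<tau> permutes ?S" by (intro permutes_swap_id) auto
      have "sign (?\<tau> \<circ> ?\<rho>) = - sign ?\<rho>"
        by (subst sign_comp_permutes[OF \<tau> \<rho>]) (auto simp: sign_swap_id)
      moreover have "(\<Prod>j<n. darboux ((?\<tau> \<circ> ?\<rho>) (2 * j + 1)) ((?\<tau> \<circ> ?\<rho>) (2 * j + 2))) =
          (\<Prod>j<n. darboux (?\<rho> (2 * j + 1)) (?\<rho> (2 * j + 2)))"
      proof (intro prod.cong refl)
        fix l assume l: "l \<in> {..<n}"
        have "?\<tau> (?\<rho> z) = ?\<rho> z" if "z < 2 * n + 1" for z
        proof (rule transpose_apply_other)
          have "z \<noteq> 2 * n + 1" "z \<noteq> 2 * n + 2" using that by auto
          then show "?\<rho> z \<noteq> 2 * n + 1" "?\<rho> z \<noteq> 2 * n + 2"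
            using inj_eq[OF permutes_inj[OF \<rho>]] last by metis+
        qed
        then have "?\<tau> (?\<rho> (2 * l + 1)) = ?\<rho> (2 * l + 1)" "?\<tau> (?\<rho> (2 * l + 2)) = ?\<rho> (2 * l + 2)"
          using l by simp_all
        then show "darboux ((?\<tau> \<circ> ?\<rho>) (2 * l + 1)) ((?\<tau> \<circ> ?\<rho>) (2 * l + 2)) =
            darboux (?\<rho> (2 * l + 1)) (?\<rho> (2 * l + 2))" by (simp only: comp_apply)
      qed
      moreover have "(?\<tau> \<circ> ?\<rho>) (2 * n + 1) = 2 * n + 1" "(?\<tau> \<circ> ?\<rho>) (2 * n + 2) = 2 * n + 2"
        using last by (simp_all only: comp_apply transpose_apply_first transpose_apply_second)
      ultimately have "?F (?\<tau> \<circ> ?\<rho>) = ?F ?\<rho>"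
        using last by (simp only: prod.lessThan_Suc) (simp add: darboux_def)
      moreover have "0 \<le> ?F (?\<tau> \<circ> ?\<rho>)"
        by (rule fixed[OF permutes_compose[OF \<rho> \<tau>]])
          (use last in \<open>simp only: comp_apply transpose_apply_second\<close>)
      ultimately show ?thesis by (simp only: F)
    qed
  qed
qed

text \<open>No term of the expansion is negative, so the identity permutation alone makes the sum
  positive. Permutations that move 0 contribute nothing because x is B-orthogonal to the other
  vectors.\<close>

lemma liouville_form_pos:
  assumes x0: "B x (w 0) > 0" and x: "\<And>i. i \<in> {1..2 * n} \<Longrightarrow> B x (w i) = 0"
    and a: "a > 0" and w: "\<And>i k. i \<in> {1..2 * n} \<Longrightarrow> k \<in> {1..2 * n} \<Longrightarrow> B (w i) (w k) = a * darboux i k"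
  shows "liouville_form B n x w > 0"
  unfolding liouville_form_def alternation_def
proof (rule sum_pos2[of _ id])
  show "0 < of_int (sign id) * (B x (w (id 0)) * (\<Prod>j<n. B (w (id (2 * j + 1))) (w (id (2 * j + 2)))))"
    using x0 a by (auto simp: w darboux_def intro!: prod_pos)
  show "0 \<le> of_int (sign \<pi>) * (B x (w (\<pi> 0)) * (\<Prod>j<n. B (w (\<pi> (2 * j + 1))) (w (\<pi> (2 * j + 2)))))"
    if "\<pi> \<in> {\<pi>. \<pi> permutes {..<1 + 2 * n}}" for \<pi>
  proof (cases "\<pi> 0 = 0")
    case True
    have \<pi>: "\<pi> permutes {1..2 * n}"
      by (rule permutes_superset[of _ "{..<1 + 2 * n}"]) (use that True in \<open>auto simp: Suc_le_eq\<close>)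
    have "(\<Prod>j<n. B (w (\<pi> (2 * j + 1))) (w (\<pi> (2 * j + 2)))) =
        (\<Prod>j<n. a * darboux (\<pi> (2 * j + 1)) (\<pi> (2 * j + 2)))"
    proof (intro prod.cong refl w)
      fix j assume "j \<in> {..<n}"
      then show "\<pi> (2 * j + 1) \<in> {1..2 * n}" "\<pi> (2 * j + 2) \<in> {1..2 * n}"
        unfolding permutes_in_image[OF \<pi>] by auto
    qed
    then have "of_int (sign \<pi>) * (B x (w (\<pi> 0)) * (\<Prod>j<n. B (w (\<pi> (2 * j + 1))) (w (\<pi> (2 * j + 2))))) =
        (B x (w 0) * a ^ n) * (of_int (sign \<pi>) * (\<Prod>j<n. darboux (\<pi> (2 * j + 1)) (\<pi> (2 * j + 2))))"
      using True by (simp add: prod.distrib)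
    also have "\<dots> \<ge> 0"
      by (rule mult_nonneg_nonneg[OF _ sign_pair_product_nonneg[OF \<pi>]]) (use x0 a in simp)
    finally show ?thesis .
  next
    case False
    from that have "\<pi> 0 \<in> {..<1 + 2 * n}" by (subst permutes_in_image) auto
    with False have "\<pi> 0 \<in> {1..2 * n}" by auto
    then have "B x (w (\<pi> 0)) = 0" by (rule x)
    then show ?thesis by simp
  qed
qed (auto intro: finite_permutations permutes_id)

section \<open>Conservative martingale problems\<close>

lemma martingale_expectation_eq:
  assumes "prob_space P" and F: "subalgebra P (F 0)" and Y: "martingale P F Y" and t: "0 \<le> t"
  shows "(LINT w|P. Y t w) = (LINT w|P. Y 0 w)"
proof -
  interpret prob_space P by fact
  interpret finite_measure_subalgebra P "F 0" by unfold_locales (rule F)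
  have int: "integrable P (Y t)" "integrable P (Y 0)" and
    AE: "AE w in P. real_cond_exp P (F 0) (Y t) w = Y 0 w"
    using Y t by (auto simp: martingale_def)
  have "(LINT w|P. Y t w) = (LINT w|P. real_cond_exp P (F 0) (Y t) w)"
    by (rule real_cond_exp_int(2)[OF int(1), symmetric])
  also have "\<dots> = (LINT w|P. Y 0 w)"
    by (rule integral_cong_AE) (use AE int in auto)
  finally show ?thesis .
qed

text \<open>The lower bound also holds if \<open>h\<close> is not integrable, because then the integral is \<open>0\<close>.\<close>

lemma set_integral_Icc_ge:
  fixes h :: "real \<Rightarrow> real"
  assumes "0 \<le> t" "0 \<le> c" "\<And>s. 0 \<le> s \<Longrightarrow> s \<le> t \<Longrightarrow> - c \<le> h s"
  shows "- (c * t) \<le> (LINT s:{0..t}|lborel. h s)"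
proof (cases "set_integrable lborel {0..t} h")
  case True
  have "(LINT s:{0..t}|lborel. - c) \<le> (LINT s:{0..t}|lborel. h s)"
    by (rule set_integral_mono[OF _ True]) (use assms in \<open>auto simp: set_integrable_def\<close>)
  also have "(LINT s:{0..t}|lborel. - c) = - (c * t)"
    using assms(1) by (simp add: set_lebesgue_integral_def)
  finally show ?thesis .
next
  case False
  then have "(LINT s:{0..t}|lborel. h s) = 0"
    unfolding set_integrable_def set_lebesgue_integral_def by (rule not_integrable_integral_eq)
  then show ?thesis using assms by simp
qed

text \<open>For the martingale Y belonging to f, 0 = E Y_0 = E Y_t is at most P(t < \<zeta>) - f x +
  \<epsilon> t, because f is at most 1 on S and 0 at the cemetery, while L f is at least -
  \<epsilon>. So P(t < \<zeta>) is at least 1 - \<epsilon> - \<epsilon> t for every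
  \<epsilon>.\<close>

lemma diffusion_process_conservative:
  fixes S :: "'a::euclidean_space set"
  assumes diff: "diffusion_process S L x P F X \<zeta>"
    and test: "\<And>\<epsilon>. \<epsilon> > 0 \<Longrightarrow> \<exists>f. test_function S f \<and> (\<forall>p\<in>S. f p \<le> 1) \<and> 1 - \<epsilon> \<le> f x \<and>
      (\<forall>p\<in>S. - \<epsilon> \<le> L f p)"
  shows "AE w in P. \<zeta> w = \<infinity>"
proof -
  have P: "prob_space P" and sub: "\<And>t. subalgebra P (F t)"
    and meas: "\<And>t B. 0 \<le> t \<Longrightarrow> B \<in> sets borel \<Longrightarrow> {w \<in> space P. ereal t < \<zeta> w \<and> X t w \<in> B} \<in> sets (F t)"
    and X0: "AE w in P. X 0 w = x"
    and pos: "\<And>w. w \<in> space P \<Longrightarrow> 0 < \<zeta> w"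
    and XS: "\<And>w t. w \<in> space P \<Longrightarrow> 0 \<le> t \<Longrightarrow> ereal t < \<zeta> w \<Longrightarrow> X t w \<in> S"
    and mart: "\<And>f. test_function S f \<Longrightarrow>
        martingale P F (\<lambda>t w. (if ereal t < \<zeta> w then f (X t w) else 0) - f (X 0 w) -
          (LINT s:{0..t}|lborel. (if ereal s < \<zeta> w then L f (X s w) else 0)))"
    using diff unfolding diffusion_process_def by blast+
  interpret prob_space P by fact
  have "AE w in P. ereal t < \<zeta> w" if t: "0 \<le> t" for t
  proof -
    let ?A = "{w \<in> space P. ereal t < \<zeta> w}"
    have A: "?A \<in> sets P"
      using meas[OF t, of UNIV] sub[of t] by (auto simp: subalgebra_def)
    have "1 - \<epsilon> - \<epsilon> * t \<le> prob ?A" if \<epsilon>: "\<epsilon> > 0" for \<epsilon>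
    proof -
      obtain f where f: "test_function S f" "\<And>p. p \<in> S \<Longrightarrow> f p \<le> 1" "1 - \<epsilon> \<le> f x"
        "\<And>p. p \<in> S \<Longrightarrow> - \<epsilon> \<le> L f p"
        using test[OF \<epsilon>] by blast
      define Y where "Y = (\<lambda>t w. (if ereal t < \<zeta> w then f (X t w) else 0) - f (X 0 w) -
          (LINT s:{0..t}|lborel. (if ereal s < \<zeta> w then L f (X s w) else 0)))"
      have Y: "martingale P F Y" unfolding Y_def by (rule mart[OF f(1)])
      have Y0: "Y 0 w = 0" if w: "w \<in> space P" for w
      proof -
        have "(LINT s:{0..0}|lborel. (if ereal s < \<zeta> w then L f (X s w) else 0)) = 0"
          unfolding set_lebesgue_integral_def
        proof (rule integral_eq_zero_AE)
          show "AE s in lborel. indicator {0..0} s *\<^sub>R (if ereal s < \<zeta> w then L f (X s w) else 0) = 0"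
            using AE_lborel_singleton[of 0] by eventually_elim (auto simp: indicator_def)
        qed
        then show ?thesis using pos[OF w] by (simp add: Y_def zero_ereal_def)
      qed
      have "0 = (LINT w|P. Y 0 w)"
        using Y0 by (subst Bochner_Integration.integral_cong[OF refl, of P _ "\<lambda>_. 0"]) auto
      also have "\<dots> = (LINT w|P. Y t w)"
        by (rule martingale_expectation_eq[where F = F, OF P sub Y t, symmetric])
      also have "\<dots> \<le> (LINT w|P. indicator ?A w - f x + \<epsilon> * t)"
      proof (rule integral_mono_AE)
        show "integrable P (Y t)" using Y t by (auto simp: martingale_def)
        show "integrable P (\<lambda>w. indicator ?A w - f x + \<epsilon> * t :: real)"
          using A by (intro Bochner_Integration.integrable_add Bochner_Integration.integrable_diff
              integrable_real_indicator) (auto simp: emeasure_eq_measure)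
        show "AE w in P. Y t w \<le> indicator ?A w - f x + \<epsilon> * t"
          using X0 AE_space
        proof eventually_elim
          case (elim w)
          have "- (\<epsilon> * t) \<le> (LINT s:{0..t}|lborel. (if ereal s < \<zeta> w then L f (X s w) else 0))"
          proof (rule set_integral_Icc_ge[OF t])
            show "- \<epsilon> \<le> (if ereal s < \<zeta> w then L f (X s w) else 0)" if "0 \<le> s" "s \<le> t" for s
              using f(4)[OF XS[OF elim(2) that(1)]] \<epsilon> by auto
          qed (use \<epsilon> in simp)
          moreover have "(if ereal t < \<zeta> w then f (X t w) else 0) \<le> indicator ?A w"
            using f(2)[OF XS[OF elim(2) t]] elim(2) by auto
          ultimately show ?case unfolding Y_def using elim(1) by simp
        qed
      qed
      also have "\<dots> = prob ?A - f x + \<epsilon> * t"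
        using A by (subst Bochner_Integration.integral_add Bochner_Integration.integral_diff;
            simp add: emeasure_eq_measure prob_space)+
      finally show ?thesis using f(3) by simp
    qed
    then have "1 \<le> prob ?A + \<delta>" if "\<delta> > 0" for \<delta>
    proof -
      \<comment> \<open>The choice \<epsilon> = \<delta> / (1 + t) makes the loss \<epsilon> +
        \<epsilon> t equal to \<delta>.\<close>
      have *: "\<delta> / (1 + t) > 0" using that t by simp
      have "\<delta> / (1 + t) + \<delta> / (1 + t) * t = \<delta> / (1 + t) * (1 + t)"
        by (simp only: distrib_left mult_1_right)
      also have "\<dots> = \<delta>" using t by simp
      finally have "\<delta> / (1 + t) + \<delta> / (1 + t) * t = \<delta>" .
      with \<open>\<And>\<epsilon>. \<epsilon> > 0 \<Longrightarrow> 1 - \<epsilon> - \<epsilon> * t \<le> prob ?A\<close>[OF *] show ?thesis by simp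
    qed
    then have "1 \<le> prob ?A" by (rule field_le_epsilon)
    then have "prob ?A = 1" using prob_le_1[of ?A] by simp
    from AE_prob_1[OF this] show ?thesis by simp
  qed
  then have "AE w in P. \<forall>n::nat. ereal (real n) < \<zeta> w"
    by (simp add: AE_all_countable)
  then show ?thesis
  proof eventually_elim
    case (elim w)
    show ?case
    proof (rule ccontr)
      assume "\<zeta> w \<noteq> \<infinity>"
      then obtain n :: nat where "\<zeta> w \<le> ereal (real n)"
      proof (cases "\<zeta> w")
        case (real r)
        then show ?thesis using that real_arch_simple[of r] by auto
      qed (use that[of 0] in auto)
      with elim show False by (metis leD)
    qed
  qed
qed

lemma stochastically_completeI:
  assumes "\<And>x \<epsilon>. x \<in> S \<Longrightarrow> \<epsilon> > 0 \<Longrightarrow> \<exists>f. test_function S f \<and> (\<forall>p\<in>S. f p \<le> 1) \<and> 1 - \<epsilon> \<le> f x \<and>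
    (\<forall>p\<in>S. - \<epsilon> \<le> \<Delta> f p / 2)"
  shows "stochastically_complete TYPE('w) S \<Delta>"
  unfolding stochastically_complete_def
proof (intro ballI allI impI)
  fix x F X \<zeta> and P :: "'w measure"
  assume "x \<in> S" and *: "diffusion_process S (\<lambda>f p. \<Delta> f p / 2) x P F X \<zeta>"
  then show "AE w in P. \<zeta> w = \<infinity>"
    by (intro diffusion_process_conservative[OF *]) (use assms in blast)
qed

text \<open>Hitting means convergence to a point of C at a finite time T. Once the lifetime is
  infinite, the path is continuous at T, so this limit is \<open>X T w\<close>, a point of
  S.\<close>

lemma stochastically_complete_avoids:
  assumes "stochastically_complete TYPE('w) S \<Delta>" and "C \<inter> S = {}"
  shows "almost_surely_avoids TYPE('w) S \<Delta> C"
  unfolding almost_surely_avoids_def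
proof (intro ballI allI impI)
  fix x F X \<zeta> and P :: "'w measure"
  assume x: "x \<in> S" and diff: "diffusion_process S (\<lambda>f p. \<Delta> f p / 2) x P F X \<zeta>"
  have "AE w in P. \<zeta> w = \<infinity>"
    using assms(1) x diff unfolding stochastically_complete_def by blast
  then show "AE w in P. \<not> hits C (\<lambda>t. X t w) (\<zeta> w)"
    using AE_space
  proof eventually_elim
    case (elim w)
    have XS: "X t w \<in> S" if "0 \<le> t" for t
      using diff elim that unfolding diffusion_process_def by simp
    have cont: "continuous_on {0..} (\<lambda>t. X t w)"
    proof -
      have "continuous_on {t. 0 \<le> t \<and> ereal t < \<zeta> w} (\<lambda>t. X t w)"
        using diff elim(2) unfolding diffusion_process_def by blast
      moreover have "{t. 0 \<le> t \<and> ereal t < \<zeta> w} = {0..}" using elim(1) by auto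
      ultimately show ?thesis by simp
    qed
    show ?case
    proof
      assume "hits C (\<lambda>t. X t w) (\<zeta> w)"
      then obtain T c where T: "T > 0" "c \<in> C" and lim: "((\<lambda>t. X t w) \<longlongrightarrow> c) (at_left T)"
        unfolding hits_def by blast
      have "continuous_on {0<..} (\<lambda>t. X t w)" by (rule continuous_on_subset[OF cont]) auto
      then have "isCont (\<lambda>t. X t w) T" using T by (simp add: continuous_on_eq_continuous_at)
      then have "((\<lambda>t. X t w) \<longlongrightarrow> X T w) (at_left T)"
        unfolding isCont_def by (rule filterlim_mono[OF _ order_refl at_le]) simp
      then have "c = X T w" using tendsto_unique[OF _ lim] by simp
      with T XS[of T] assms(2) show False by auto
    qed
  qed
qed

section \<open>Smooth functions\<close>

lemma Ck_on_cong:
  assumes "open U" "\<And>x. x \<in> U \<Longrightarrow> f x = g x"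
  shows "Ck_on k f U \<longleftrightarrow> Ck_on k g U"
  using assms(2)
proof (induction k arbitrary: f g)
  case 0
  then show ?case by (auto intro: continuous_on_cong)
next
  case (Suc k)
  \<comment> \<open>\<open>frechet_derivative\<close> is chosen from the predicate
    \<open>has_derivative\<close>, so equivalence of these predicates gives equal derivatives even
    at points where none exists.\<close>
  have der: "(f has_derivative D) (at x) \<longleftrightarrow> (g has_derivative D) (at x)" if "x \<in> U" for x D
    using has_derivative_transform_within_open[OF _ assms(1) that, of f D UNIV g]
      has_derivative_transform_within_open[OF _ assms(1) that, of g D UNIV f] Suc.prems by auto
  then have "f differentiable (at x) \<longleftrightarrow> g differentiable (at x)"
    "frechet_derivative f (at x) = frechet_derivative g (at x)" if "x \<in> U" for x
    using that by (simp_all add: differentiable_def frechet_derivative_def)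
  note eq = this
  have "Ck_on k (\<lambda>x. frechet_derivative f (at x) v) U \<longleftrightarrow>
      Ck_on k (\<lambda>x. frechet_derivative g (at x) v) U" for v
    by (rule Suc.IH) (simp add: eq(2))
  then show ?case using eq(1) by simp
qed

lemma Ck_on_const: "Ck_on k (\<lambda>x. c) U"
  by (induction k arbitrary: c) auto

lemma Ck_on_Suc_iff:
  assumes U: "open U" and D: "\<And>x. x \<in> U \<Longrightarrow> (f has_derivative D x) (at x)"
  shows "Ck_on (Suc k) f U \<longleftrightarrow> (\<forall>v. Ck_on k (\<lambda>x. D x v) U)"
proof -
  have "f differentiable (at x)" if "x \<in> U" for x using D[OF that] by (auto simp: differentiable_def)
  moreover have "frechet_derivative f (at x) = D x" if "x \<in> U" for x
    using frechet_derivative_at[OF D[OF that]] by simp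
  then have "Ck_on k (\<lambda>x. frechet_derivative f (at x) v) U \<longleftrightarrow> Ck_on k (\<lambda>x. D x v) U" for v
    by (intro Ck_on_cong[OF U]) simp
  ultimately show ?thesis by simp
qed

lemma Ck_on_SucD:
  "Ck_on (Suc k) f U \<Longrightarrow> x \<in> U \<Longrightarrow> (f has_derivative frechet_derivative f (at x)) (at x)"
  by (simp add: frechet_derivative_works)

lemma Ck_on_Suc_imp: "Ck_on (Suc k) f U \<Longrightarrow> Ck_on k f U"
proof (induction k arbitrary: f)
  case 0
  then show ?case
    by (auto intro!: continuous_at_imp_continuous_on differentiable_imp_continuous_within)
next
  case (Suc k)
  then show ?case by (metis Ck_on.simps(2))
qed

lemma Ck_on_add:
  assumes U: "open U" shows "Ck_on k f U \<Longrightarrow> Ck_on k g U \<Longrightarrow> Ck_on k (\<lambda>x. f x + g x) U"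
proof (induction k arbitrary: f g)
  case 0
  then show ?case by (auto intro: continuous_intros)
next
  case (Suc k)
  have "Ck_on (Suc k) (\<lambda>x. f x + g x) U \<longleftrightarrow>
      (\<forall>v. Ck_on k (\<lambda>x. frechet_derivative f (at x) v + frechet_derivative g (at x) v) U)"
    by (rule Ck_on_Suc_iff[OF U]) (intro has_derivative_add Ck_on_SucD[OF Suc.prems(1)] Ck_on_SucD[OF Suc.prems(2)])
  then show ?case using Suc by (metis Ck_on.simps(2))
qed

lemma Ck_on_mult:
  assumes U: "open U" shows "Ck_on k f U \<Longrightarrow> Ck_on k g U \<Longrightarrow> Ck_on k (\<lambda>x. f x * g x) U"
proof (induction k arbitrary: f g)
  case 0
  then show ?case by (auto intro: continuous_intros)
next
  case (Suc k)
  have "Ck_on (Suc k) (\<lambda>x. f x * g x) U \<longleftrightarrow>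
      (\<forall>v. Ck_on k (\<lambda>x. f x * frechet_derivative g (at x) v + frechet_derivative f (at x) v * g x) U)"
    by (rule Ck_on_Suc_iff[OF U]) (intro has_derivative_mult Ck_on_SucD[OF Suc.prems(1)] Ck_on_SucD[OF Suc.prems(2)])
  moreover have "Ck_on k (\<lambda>x. f x * frechet_derivative g (at x) v + frechet_derivative f (at x) v * g x) U" for v
    using Suc.prems Ck_on_Suc_imp[OF Suc.prems(1)] Ck_on_Suc_imp[OF Suc.prems(2)]
    by (intro Ck_on_add[OF U] Suc.IH) auto
  ultimately show ?case by blast
qed

lemma Ck_on_linear:
  fixes f :: "'a::euclidean_space \<Rightarrow> real"
  assumes U: "open U" and f: "bounded_linear f"
  shows "Ck_on k f U"
proof (cases k)
  case 0
  then show ?thesis using f by (simp add: linear_continuous_on)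
next
  case (Suc l)
  have "Ck_on (Suc l) f U \<longleftrightarrow> (\<forall>v. Ck_on l (\<lambda>x. f v) U)"
    by (rule Ck_on_Suc_iff[OF U]) (rule bounded_linear_imp_has_derivative[OF f])
  then show ?thesis using Suc Ck_on_const by blast
qed

text \<open>The witness D lists all derivatives at once, which lets the induction in
  \<open>Ck_on_compose_smooth\<close> pass from D l to its successor.\<close>

definition smooth_real :: "(real \<Rightarrow> real) \<Rightarrow> real set \<Rightarrow> bool" where
  "smooth_real f I \<longleftrightarrow> (\<exists>D. (\<forall>x\<in>I. D 0 x = f x) \<and>
     (\<forall>k. \<forall>x\<in>I. (D k has_real_derivative D (Suc k) x) (at x)))"

lemma Ck_on_compose_smooth:
  assumes U: "open U" and f: "smooth_real f I" and g: "\<And>k. Ck_on k g U" and sub: "g ` U \<subseteq> I"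
  shows "Ck_on k (\<lambda>x. f (g x)) U"
proof -
  obtain D where D0: "\<And>x. x \<in> I \<Longrightarrow> D 0 x = f x"
    and D: "\<And>k x. x \<in> I \<Longrightarrow> (D k has_real_derivative D (Suc k) x) (at x)"
    using f unfolding smooth_real_def by blast
  \<comment> \<open>Stated for all l, as the derivative of \<open>D l\<close> after g contains
    \<open>D (Suc l)\<close>.\<close>
  have "Ck_on k (\<lambda>x. D l (g x)) U" for l
  proof (induction k arbitrary: l)
    case 0
    have "isCont (\<lambda>x. D l (g x)) x" if "x \<in> U" for x
    proof (rule isCont_o2[where f = g and g = "D l"])
      show "isCont g x" using g[of 0] U that by (simp add: continuous_on_eq_continuous_at)
      show "isCont (D l) (g x)" using D[of "g x" l] sub that by (auto intro: DERIV_isCont)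
    qed
    then show ?case by (simp add: continuous_at_imp_continuous_on)
  next
    case (Suc k)
    have "Ck_on (Suc k) (\<lambda>x. D l (g x)) U \<longleftrightarrow>
        (\<forall>v. Ck_on k (\<lambda>x. frechet_derivative g (at x) v * D (Suc l) (g x)) U)"
    proof (rule Ck_on_Suc_iff[OF U, where f = "\<lambda>x. D l (g x)"
          and D = "\<lambda>x v. frechet_derivative g (at x) v * D (Suc l) (g x)"])
      fix x assume x: "x \<in> U"
      have "(g has_derivative frechet_derivative g (at x)) (at x)"
        by (rule Ck_on_SucD[OF g[of "Suc 0"] x])
      moreover have "(\<lambda>h. h * D (Suc l) (g x)) = (*) (D (Suc l) (g x))" by (simp add: fun_eq_iff)
      then have "(D l has_derivative (\<lambda>h. h * D (Suc l) (g x))) (at (g x))"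
        using D[of "g x" l] sub x unfolding has_field_derivative_def by (simp add: image_subset_iff)
      ultimately show "((\<lambda>x. D l (g x)) has_derivative
          (\<lambda>v. frechet_derivative g (at x) v * D (Suc l) (g x))) (at x)"
        by (rule has_derivative_compose)
    qed
    moreover have "Ck_on k (\<lambda>x. frechet_derivative g (at x) v) U" for v
      using g[of "Suc k"] by simp
    ultimately show ?case using Ck_on_mult[OF U _ Suc.IH] by blast
  qed
  from this[of 0] have "Ck_on k (\<lambda>x. D 0 (g x)) U" .
  moreover have "Ck_on k (\<lambda>x. D 0 (g x)) U \<longleftrightarrow> Ck_on k (\<lambda>x. f (g x)) U"
    by (rule Ck_on_cong[OF U]) (use D0 sub in auto)
  ultimately show ?thesis by simp
qed

section \<open>The logarithm, functions flat at 0, and a cutoff built from them\<close>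

lemma smooth_real_ln: "smooth_real ln {0<..}"
  unfolding smooth_real_def
proof (intro exI[of _ "\<lambda>k x. case k of 0 \<Rightarrow> ln x | Suc l \<Rightarrow> (- 1) ^ l * fact l / x ^ Suc l"] conjI allI ballI)
  fix k and x :: real assume "x \<in> {0<..}"
  then have x: "x > 0" by simp
  show "((\<lambda>x. case k of 0 \<Rightarrow> ln x | Suc l \<Rightarrow> (- 1) ^ l * fact l / x ^ Suc l) has_real_derivative
      (case Suc k of 0 \<Rightarrow> ln x | Suc l \<Rightarrow> (- 1) ^ l * fact l / x ^ Suc l)) (at x)"
  proof (cases k)
    case 0
    then show ?thesis using x by (auto intro!: derivative_eq_intros)
  next
    case (Suc l)
    have pow: "((\<lambda>x. x ^ Suc l) has_real_derivative real (Suc l) * x ^ l) (at x)"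
      using DERIV_pow[of "Suc l" x] by simp
    have "((\<lambda>x. (- 1) ^ l * fact l / x ^ Suc l) has_real_derivative
        - ((- 1) ^ l * fact l * (real (Suc l) * x ^ l)) / (x ^ Suc l * x ^ Suc l)) (at x)"
      by (rule DERIV_cong[OF DERIV_divide[OF DERIV_const pow]]) (use x in auto)
    also have "- ((- 1) ^ l * fact l * (real (Suc l) * x ^ l)) / (x ^ Suc l * x ^ Suc l) =
        (- 1) ^ Suc l * fact (Suc l) / x ^ Suc (Suc l)"
      using x by (cases l) (simp_all add: field_simps)
    finally show ?thesis using Suc by simp
  qed
qed simp

text \<open>With x = 1 / y this is p(x) exp(- x) on y > 0. The family is closed under
  differentiation, p becoming x^2 (p - p'), so smoothness at 0 comes down to one limit for all
  p.\<close>

definition flat_exp :: "real poly \<Rightarrow> real \<Rightarrow> real" where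
  "flat_exp p y = (if y > 0 then poly p (1 / y) * exp (- 1 / y) else 0)"

lemma tendsto_poly_times_exp_minus:
  "((\<lambda>x. poly p x * exp (- x)) \<longlongrightarrow> (0::real)) at_top"
proof -
  have "((\<lambda>x. \<Sum>i\<le>degree p. coeff p i * (x ^ i / exp x)) \<longlongrightarrow> (\<Sum>i\<le>degree p. coeff p i * 0)) at_top"
    by (intro tendsto_sum tendsto_mult tendsto_const tendsto_power_div_exp_0)
  also have "(\<lambda>x. \<Sum>i\<le>degree p. coeff p i * (x ^ i / exp x)) = (\<lambda>x. poly p x * exp (- x))"
    by (simp add: poly_altdef sum_distrib_right exp_minus divide_inverse mult.assoc)
  finally show ?thesis by simp
qed

lemma flat_exp_has_derivative:
  "(flat_exp p has_real_derivative flat_exp ([:0, 0, 1:] * (p - pderiv p)) y) (at y)"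
proof -
  let ?q = "[:0, 0, 1:] * (p - pderiv p)"
  consider "y > 0" | "y < 0" | "y = 0" by linarith
  then show ?thesis
  proof cases
    case 1
    have "((\<lambda>y. poly p (1 / y) * exp (- 1 / y)) has_real_derivative flat_exp ?q y) (at y)"
      using 1 by (auto intro!: derivative_eq_intros poly_DERIV[THEN DERIV_chain2]
          simp: flat_exp_def field_simps power2_eq_square)
    then show ?thesis
      by (rule has_field_derivative_transform_within_open[of _ _ _ "{0<..}"]) (use 1 in \<open>auto simp: flat_exp_def\<close>)
  next
    case 2
    have "((\<lambda>y. 0) has_real_derivative flat_exp ?q y) (at y)" using 2 by (simp add: flat_exp_def)
    then show ?thesis
      by (rule has_field_derivative_transform_within_open[of _ _ _ "{..<0}"]) (use 2 in \<open>auto simp: flat_exp_def\<close>)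
  next
    case 3
    \<comment> \<open>From the right, the difference quotient at 0 is again of the form q(1 / y)
      exp(- 1 / y), now with q = x p.\<close>
    have "((\<lambda>y. flat_exp p y / y) \<longlongrightarrow> 0) (at_right 0)"
    proof -
      have "((\<lambda>y. poly (pCons 0 p) (inverse y) * exp (- inverse y)) \<longlongrightarrow> 0) (at_right 0)"
        by (rule filterlim_compose[OF tendsto_poly_times_exp_minus filterlim_inverse_at_top_right])
      moreover have "eventually (\<lambda>y. poly (pCons 0 p) (inverse y) * exp (- inverse y) = flat_exp p y / y) (at_right 0)"
        unfolding eventually_at_right_field
        by (intro exI[of _ 1]) (simp add: flat_exp_def field_simps)
      ultimately show ?thesis by (rule Lim_transform_eventually)
    qed
    moreover have "((\<lambda>y. flat_exp p y / y) \<longlongrightarrow> 0) (at_left 0)"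
      by (rule Lim_transform_eventually[of "\<lambda>_. 0"])
        (auto simp: eventually_at_left_field flat_exp_def intro!: exI[of _ "- 1"])
    ultimately have "((\<lambda>y. flat_exp p y / y) \<longlongrightarrow> 0) (at 0)"
      by (simp add: filterlim_split_at)
    then show ?thesis using 3 by (simp add: has_field_derivative_iff flat_exp_def)
  qed
qed

lemma smooth_real_flat_exp: "smooth_real (flat_exp p) UNIV"
proof -
  define Q where "Q = (\<lambda>p :: real poly. [:0, 0, 1:] * (p - pderiv p))"
  have "(flat_exp p has_real_derivative flat_exp (Q p) y) (at y)" for p y
    unfolding Q_def by (rule flat_exp_has_derivative)
  then show ?thesis unfolding smooth_real_def
    by (intro exI[of _ "\<lambda>k. flat_exp ((Q ^^ k) p)"]) simp
qed

text \<open>The convexity of the cutoff on \<open>[0, \<infinity>)\<close> makes a one-sided bound on the generator suffice.\<close>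

lemma convex_cutoff:
  obtains \<eta> \<eta>1 \<eta>2 :: "real \<Rightarrow> real" and C where
    "smooth_real \<eta> UNIV" "\<And>s. (\<eta> has_real_derivative \<eta>1 s) (at s)" "\<And>s. (\<eta>1 has_real_derivative \<eta>2 s) (at s)"
    "\<eta> 0 = 1" "\<And>s. 0 \<le> s \<Longrightarrow> \<eta> s \<le> 1" "\<And>s. 1 \<le> s \<Longrightarrow> \<eta> s = 0"
    "\<And>s. - C \<le> \<eta>1 s" "\<And>s. \<eta>1 s \<le> 0" "\<And>s. 0 \<le> s \<Longrightarrow> 0 \<le> \<eta>2 s" "C > 0"
proof
  \<comment> \<open>With x = 1 / y > 0 the second derivative of exp(- 1 / y) is x^3 (x - 2) exp(-
    x), which is nonnegative exactly for y \<le> 1/2. The substitution y = (1 - s) / 2 sends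
    [0, 1) to (0, 1/2], and the factor exp 2 normalises the value at s = 0.\<close>
  let ?y = "\<lambda>s::real. (1 - s) / 2"
  let ?\<eta> = "\<lambda>s. exp 2 * flat_exp 1 (?y s)"
  let ?\<eta>1 = "\<lambda>s. - (exp 2 / 2) * flat_exp [:0, 0, 1:] (?y s)"
  let ?\<eta>2 = "\<lambda>s. exp 2 / 4 * flat_exp [:0, 0, 0, - 2, 1:] (?y s)"
  show "smooth_real ?\<eta> UNIV"
  proof -
    obtain D where D: "\<And>x. D 0 x = flat_exp 1 x" "\<And>k x. (D k has_real_derivative D (Suc k) x) (at x)"
      using smooth_real_flat_exp[of 1] unfolding smooth_real_def by auto
    show ?thesis unfolding smooth_real_def
    proof (intro exI[of _ "\<lambda>k s. exp 2 * (- 1 / 2) ^ k * D k (?y s)"] conjI allI ballI)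
      fix k s
      show "((\<lambda>s. exp 2 * (- 1 / 2) ^ k * D k (?y s)) has_real_derivative
          exp 2 * (- 1 / 2) ^ Suc k * D (Suc k) (?y s)) (at s)"
        by (auto intro!: derivative_eq_intros D(2)[THEN DERIV_chain2])
    qed (simp add: D)
  qed
  show "(?\<eta> has_real_derivative ?\<eta>1 s) (at s)" for s
    using flat_exp_has_derivative[of 1]
    by (auto intro!: derivative_eq_intros flat_exp_has_derivative[THEN DERIV_chain2] simp: pderiv_1)
  show "(?\<eta>1 has_real_derivative ?\<eta>2 s) (at s)" for s
    by (auto intro!: derivative_eq_intros flat_exp_has_derivative[THEN DERIV_chain2] simp: pderiv_pCons)
  show "?\<eta> 0 = 1" by (simp add: flat_exp_def flip: exp_add)
  show "?\<eta> s \<le> 1" if "0 \<le> s" for s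
  proof (cases "s < 1")
    case True
    then have "2 + - 1 / ?y s \<le> 0" using that by (simp add: field_simps)
    then have "exp (2 + - 1 / ?y s) \<le> 1" by (simp only: exp_le_one_iff)
    then have "exp 2 * exp (- 1 / ?y s) \<le> 1" by (simp only: exp_add)
    then show ?thesis using True by (simp add: flat_exp_def)
  qed (simp add: flat_exp_def)
  show "?\<eta> s = 0" if "1 \<le> s" for s using that by (simp add: flat_exp_def)
  show "?\<eta>1 s \<le> 0" for s by (simp add: flat_exp_def)
  show "- exp 2 \<le> ?\<eta>1 s" for s
  proof (cases "s < 1")
    case True
    let ?x = "1 / ?y s"
    have x: "0 \<le> ?x" using True by simp
    \<comment> \<open>The quadratic Taylor bound gives x^2 exp(- x) \<le> 2, which is the origin of
      C = exp 2.\<close>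
    have "?x\<^sup>2 / 2 \<le> exp ?x" using exp_lower_Taylor_quadratic[OF x] x by linarith
    then have "?x\<^sup>2 / 2 * exp (- ?x) \<le> exp ?x * exp (- ?x)" by (intro mult_right_mono) auto
    then have "?x\<^sup>2 * exp (- ?x) \<le> 2" by (simp only: exp_minus_inverse)
    then have "flat_exp [:0, 0, 1:] (?y s) \<le> 2"
      using True by (simp add: flat_exp_def power2_eq_square)
    then have "exp 2 * flat_exp [:0, 0, 1:] (?y s) \<le> exp 2 * 2" by (intro mult_left_mono) auto
    then show ?thesis by simp
  qed (simp add: flat_exp_def)
  show "0 \<le> ?\<eta>2 s" if "0 \<le> s" for s
  proof (cases "s < 1")
    case True
    let ?x = "1 / ?y s"
    have "2 \<le> ?x" using True that by (simp add: field_simps)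
    then have "0 \<le> ?x * (?x * (?x * (- 2 + ?x)))"
      using True by (intro mult_nonneg_nonneg) auto
    then have "0 \<le> poly [:0, 0, 0, - 2, 1:] ?x" by simp
    then show ?thesis unfolding flat_exp_def by (simp del: poly_pCons)
  qed (simp add: flat_exp_def)
  show "exp 2 > (0::real)" by simp
qed

section \<open>Tangent spaces and derivatives along them\<close>

lemma tangent_space_Int_open:
  assumes U: "open U" and p: "p \<in> U"
  shows "tangent_space (S \<inter> U) p = tangent_space S p"
proof
  show "tangent_space (S \<inter> U) p \<subseteq> tangent_space S p"
    unfolding tangent_space_def by blast
  show "tangent_space S p \<subseteq> tangent_space (S \<inter> U) p"
  proof
    fix v assume "v \<in> tangent_space S p"
    then obtain \<gamma> e where e: "e > 0" and S: "\<And>t. \<bar>t\<bar> < e \<Longrightarrow> \<gamma> t \<in> S" and 0: "\<gamma> 0 = p"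
      and d: "(\<gamma> has_vector_derivative v) (at (0::real))"
      unfolding tangent_space_def by blast
    have "isCont \<gamma> 0" using d by (rule has_vector_derivative_continuous)
    then have "\<forall>\<^sub>F t in at 0. \<gamma> t \<in> U"
      using topological_tendstoD[OF _ U] p 0 by (simp add: isCont_def)
    then obtain e' where e': "e' > 0" "\<And>t. t \<noteq> 0 \<Longrightarrow> \<bar>t\<bar> < e' \<Longrightarrow> \<gamma> t \<in> U"
      unfolding eventually_at by (auto simp: dist_real_def)
    have "\<gamma> t \<in> S \<inter> U" if "\<bar>t\<bar> < min e e'" for t
      using that S e' p 0 by (cases "t = 0") auto
    then show "v \<in> tangent_space (S \<inter> U) p"
      unfolding tangent_space_def using 0 d e e'(1) by (intro CollectI exI[of _ \<gamma>] exI[of _ "min e e'"]) auto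
  qed
qed

lemma has_derivative_along_tangent:
  assumes f: "(f has_derivative D) (at p within S)" and e: "e > 0"
    and S: "\<And>t. \<bar>t\<bar> < e \<Longrightarrow> \<gamma> t \<in> S" and 0: "\<gamma> 0 = p"
    and d: "(\<gamma> has_vector_derivative v) (at (0::real))"
  shows "((\<lambda>t. f (\<gamma> t)) has_vector_derivative D v) (at 0)"
proof -
  have "(\<gamma> has_derivative (\<lambda>h. h *\<^sub>R v)) (at 0 within {- e<..<e})"
    using d unfolding has_vector_derivative_def by (rule has_derivative_at_withinI)
  moreover have "(f has_derivative D) (at (\<gamma> 0) within \<gamma> ` {- e<..<e})"
    unfolding 0 by (rule has_derivative_subset[OF f]) (use S in auto)
  ultimately have "((\<lambda>t. f (\<gamma> t)) has_derivative (\<lambda>h. D (h *\<^sub>R v))) (at 0 within {- e<..<e})"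
    by (rule has_derivative_in_compose)
  then show ?thesis
    unfolding has_vector_derivative_def linear_scale[OF has_derivative_linear[OF f]]
    using e at_within_open[of "0 :: real" "{- e<..<e}"] by simp
qed

text \<open>Along a curve in S every derivative of f within S computes the velocity of f after the
  curve, which is unique. So on tangent vectors the derivative picked by
  \<open>frechet_derivative\<close> may be traded for any explicit one.\<close>

lemma deriv_along_eq:
  assumes f: "(f has_derivative D) (at p within S)" and v: "v \<in> tangent_space S p"
  shows "deriv_along S p v f = D v"
proof -
  obtain \<gamma> e where *: "e > 0" "\<And>t. \<bar>t\<bar> < e \<Longrightarrow> \<gamma> t \<in> S" "\<gamma> 0 = p"
    "(\<gamma> has_vector_derivative v) (at (0::real))"
    using v unfolding tangent_space_def by blast
  have f': "(f has_derivative frechet_derivative f (at p within S)) (at p within S)"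
    using f frechet_derivative_works differentiable_def by blast
  show ?thesis unfolding deriv_along_def
    by (rule vector_derivative_unique_at[OF has_derivative_along_tangent[OF f' *]
          has_derivative_along_tangent[OF f *]])
qed

section \<open>Alternating forms on \<open>\<complex>\<^sup>n \<times> \<complex>\<close>\<close>

text \<open>Freezing slot 1 rather than slot 0 keeps the position vector in front. The lemma is
  applied with c = (0, \<i>), the direction normal to \<open>real_slice\<close>.\<close>

lemma alternating_form_insert_1:
  assumes alt: "alternating_form (Suc m) T \<beta>" and m: "m > 0" and c: "c \<in> T"
  shows "alternating_form m T (\<lambda>w. \<beta> (case_nat (w 0) (case_nat c (\<lambda>i. w (Suc i)))))"
proof -
  define I where "I w = case_nat (w 0) (case_nat c (\<lambda>i. w (Suc i)))" for w :: "nat \<Rightarrow> 'a"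
  define s where "s i = (if i = 0 then 0 else Suc i)" for i :: nat
  have upd: "I (w(i := x)) = (I w)(s i := x)" for w i x
    by (auto simp: I_def s_def fun_eq_iff split: nat.splits)
  have T: "I w j \<in> T" if "\<forall>j<m. w j \<in> T" "j < Suc m" for w j
    using that c m by (auto simp: I_def split: nat.splits)
  have s: "s i < Suc m" if "i < m" for i using that by (auto simp: s_def)
  have Is: "I w (s i) = w i" for w i by (auto simp: I_def s_def split: nat.splits)
  have "alternating_form m T (\<lambda>w. \<beta> (I w))"
    unfolding alternating_form_def
  proof (intro conjI allI impI; (elim conjE)?)
    show "\<beta> (I v) = \<beta> (I w)" if "\<forall>i<m. v i = w i" for v w
      by (rule alternating_form_cong[OF alt]) (use that m in \<open>auto simp: I_def split: nat.splits\<close>)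
    show "\<beta> (I (v(i := a *\<^sub>R u + b *\<^sub>R w))) = a * \<beta> (I (v(i := u))) + b * \<beta> (I (v(i := w)))"
      if "i < m" "\<forall>j<m. v j \<in> T" "u \<in> T" "w \<in> T" for v i a b u w
      unfolding upd using that T s by (intro alternating_form_lin[OF alt]) auto
    show "\<beta> (I v) = 0" if "i < j" "j < m" "\<forall>l<m. v l \<in> T" "v i = v j" for v i j
    proof (rule alternating_form_eq_0[OF alt, of "s i" "s j"])
      show "s i \<noteq> s j" using that by (auto simp: s_def)
    qed (use that T s in \<open>auto simp: Is\<close>)
  qed
  then show ?thesis unfolding I_def .
qed

text \<open>The complex structure. It turns the sum of the area forms into an inner product, so that
  horizontality becomes perpendicularity to \<i> z.\<close>

definition cvec_i :: "complex ^ 'n::finite \<Rightarrow> complex ^ 'n" where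
  "cvec_i z = (\<chi> m. \<i> * z $ m)"

lemma inner_cvec_i: "cvec_i z \<bullet> w = (\<Sum>m\<in>UNIV. area_form (z $ m) (w $ m))"
  by (simp add: cvec_i_def inner_vec_def inner_complex_def area_form_def)

lemma cvec_i_skew: "cvec_i z \<bullet> w = - (cvec_i w \<bullet> z)"
  by (simp add: inner_cvec_i area_form_def mult.commute flip: sum_negf)

lemma cvec_i_self [simp]: "cvec_i z \<bullet> z = 0" "z \<bullet> cvec_i z = 0"
  using cvec_i_skew[of z z] by (simp_all add: inner_commute)

lemma cvec_i_inner_cvec_i [simp]: "cvec_i z \<bullet> cvec_i w = z \<bullet> w"
  by (simp add: cvec_i_def inner_vec_def inner_complex_def add.commute)

lemma cvec_i_add: "cvec_i (z + w) = cvec_i z + cvec_i w"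
  and cvec_i_scaleR: "cvec_i (c *\<^sub>R z) = c *\<^sub>R cvec_i z"
  by (simp_all add: cvec_i_def vec_eq_iff algebra_simps)

lemma cvec_i_axis: "cvec_i (axis m 1) = axis m \<i>" "cvec_i (axis m \<i>) = - axis m 1"
  by (auto simp: cvec_i_def vec_eq_iff axis_def)

lemma cvec_i_0 [simp]: "cvec_i 0 = 0"
  by (simp add: cvec_i_def vec_eq_iff)

text \<open>Two weights are kept because the Heisenberg contact form has a = 1/2 and b = 1; in the
  other two models a = b.\<close>

definition symplectic :: "real \<Rightarrow> real \<Rightarrow> (complex ^ 'n::finite) \<times> complex \<Rightarrow> (complex ^ 'n) \<times> complex \<Rightarrow> real"
  where "symplectic a b x y = a * (cvec_i (fst x) \<bullet> fst y) + b * area_form (snd x) (snd y)"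

lemma bilinear_symplectic: "bilinear (symplectic a b)"
  unfolding bilinear_def
  by (auto intro!: linearI simp: symplectic_def cvec_i_add cvec_i_scaleR inner_simps area_form_def algebra_simps)

lemma symplectic_skew: "symplectic a b x y = - symplectic a b y x"
  using cvec_i_skew[of "fst x" "fst y"] by (simp add: symplectic_def area_form_def algebra_simps)

text \<open>The linear space of dimension 2n + 1 that contains the positions
  \<open>off + emb p\<close> of all points of S.\<close>

definition real_slice :: "((complex ^ 'n::finite) \<times> complex) set" where
  "real_slice = {w. Im (snd w) = 0}"

lemma subspace_real_slice: "subspace real_slice"
  by (simp add: real_slice_def subspace_def)

section \<open>An orthonormal frame of the slice adapted to the symplectic form, and the slice
  volume\<close>

definition enum_index :: "nat \<Rightarrow> 'n::finite" where
  "enum_index = (SOME f. bij_betw f {..<CARD('n)} UNIV)"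

lemma bij_betw_enum_index: "bij_betw (enum_index :: nat \<Rightarrow> 'n::finite) {..<CARD('n)} UNIV"
proof -
  have "\<exists>f :: nat \<Rightarrow> 'n. bij_betw f {..<CARD('n)} UNIV"
    using ex_bij_betw_nat_finite[of "UNIV :: 'n set"] by (simp add: lessThan_atLeast0)
  then show ?thesis unfolding enum_index_def by (rule someI_ex)
qed

text \<open>The first 2n + 1 members form an orthonormal basis of \<open>real_slice\<close>; each
  pair (2j + 1, 2j + 2) spans one complex axis, in the numbering of \<open>darboux\<close>.\<close>

definition darboux_frame :: "nat \<Rightarrow> (complex ^ 'n::finite) \<times> complex" where
  "darboux_frame i = (if i = 0 then (0, 1)
     else if odd i then (axis (enum_index (i div 2)) 1, 0) else (axis (enum_index (i div 2 - 1)) \<i>, 0))"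

lemma darboux_frame_simps:
  "darboux_frame 0 = (0, 1)"
  "darboux_frame (2 * j + 1) = (axis (enum_index j) 1, 0)"
  "darboux_frame (2 * j + 2) = (axis (enum_index j) \<i>, 0)"
  by (simp_all add: darboux_frame_def)

lemma darboux_frame_in: "darboux_frame i \<in> real_slice"
  by (simp add: darboux_frame_def real_slice_def)

lemma sum_odd_even_split:
  fixes g :: "nat \<Rightarrow> 'b::comm_monoid_add"
  shows "(\<Sum>i<1 + 2 * n. g i) = g 0 + (\<Sum>j<n. g (2 * j + 1) + g (2 * j + 2))"
  by (induction n) (simp_all add: add_ac)

lemma darboux_frame_expansion:
  fixes w :: "(complex ^ 'n::finite) \<times> complex"
  assumes "w \<in> real_slice"
  shows "w = (\<Sum>i<1 + 2 * CARD('n). (w \<bullet> darboux_frame i) *\<^sub>R darboux_frame i)"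
proof -
  let ?g = "\<lambda>m. (Re (fst w $ m) *\<^sub>R (axis m 1 :: complex ^ 'n) + Im (fst w $ m) *\<^sub>R axis m \<i>, 0 :: complex)"
  have "(\<Sum>i<1 + 2 * CARD('n). (w \<bullet> darboux_frame i) *\<^sub>R darboux_frame i) =
      (0, of_real (Re (snd w))) + (\<Sum>j<CARD('n). ?g (enum_index j))"
    unfolding sum_odd_even_split darboux_frame_simps
    by (intro arg_cong2[where f = "(+)"] sum.cong)
      (auto simp: inner_prod_def inner_axis inner_complex_def scaleR_conv_of_real)
  also have "(\<Sum>j<CARD('n). ?g (enum_index j)) = (\<Sum>m\<in>UNIV. ?g m)"
    by (rule sum.reindex_bij_betw[OF bij_betw_enum_index])
  also have "\<dots> = (fst w, 0)"
  proof -
    have "(\<Sum>m\<in>UNIV. Re (fst w $ m) *\<^sub>R (axis m 1 :: complex ^ 'n) + Im (fst w $ m) *\<^sub>R axis m \<i>) = fst w"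
    proof (rule vec_eq_iff[THEN iffD2, rule_format])
      fix k
      have "(\<Sum>m\<in>UNIV. Re (fst w $ m) *\<^sub>R (axis m 1 :: complex ^ 'n) + Im (fst w $ m) *\<^sub>R axis m \<i>) $ k =
          (\<Sum>m\<in>UNIV. if m = k then Complex (Re (fst w $ m)) (Im (fst w $ m)) else 0)"
        unfolding sum_component by (rule sum.cong) (auto simp: axis_def complex_eq_iff)
      then show "(\<Sum>m\<in>UNIV. Re (fst w $ m) *\<^sub>R (axis m 1 :: complex ^ 'n) + Im (fst w $ m) *\<^sub>R axis m \<i>) $ k = fst w $ k"
        by simp
    qed
    then show ?thesis by (simp add: prod_eq_iff fst_sum snd_sum)
  qed
  also have "(0, of_real (Re (snd w))) + (fst w, 0) = w"
    using assms by (auto simp: prod_eq_iff complex_eq_iff real_slice_def)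
  finally show ?thesis by simp
qed

lemma symplectic_darboux_frame:
  fixes a b :: real
  assumes "i \<in> {1..2 * CARD('n::finite)}" "k \<in> {1..2 * CARD('n)}"
  shows "symplectic a b (darboux_frame i :: (complex ^ 'n) \<times> complex) (darboux_frame k) = a * darboux i k"
proof -
  have inj: "enum_index j = (enum_index l :: 'n) \<longleftrightarrow> j = l" if "j < CARD('n)" "l < CARD('n)" for j l
    using bij_betw_enum_index[where 'n = 'n] that by (auto simp: bij_betw_def inj_on_def)
  have cases: "\<exists>j<CARD('n). i = 2 * j + 1 \<or> i = 2 * j + 2" if "i \<in> {1..2 * CARD('n)}" for i
    using that by (intro exI[of _ "(i - 1) div 2"]) auto
  obtain j l where j: "j < CARD('n)" "i = 2 * j + 1 \<or> i = 2 * j + 2"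
    and l: "l < CARD('n)" "k = 2 * l + 1 \<or> k = 2 * l + 2"
    using cases assms by meson
  have neq: "2 * j + 1 \<noteq> 2 * l + 2" "2 * j + 2 \<noteq> 2 * l + 1" "2 * j + 1 \<noteq> 2 * l + 1 + 1"
    "2 * l + 1 \<noteq> 2 * j + 1 + 1" by presburger+
  show ?thesis
    using j(2) l(2) inj[OF j(1) l(1)] neq
    by (elim disjE; simp only: symplectic_def darboux_frame_simps cvec_i_axis)
      (auto simp: cvec_i_axis darboux_def inner_axis_axis area_form_def inner_complex_def)
qed

text \<open>Inserting (0, \<i>) cuts the form of degree 2n + 2 down to a volume form on
  \<open>real_slice\<close>. The position x stays a separate argument because it is differentiated
  as well.\<close>

definition slice_volume ::
    "real \<Rightarrow> real \<Rightarrow> (complex ^ 'n::finite) \<times> complex \<Rightarrow> (nat \<Rightarrow> (complex ^ 'n) \<times> complex) \<Rightarrow> real" where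
  "slice_volume a b x w = liouville_form (symplectic a b) CARD('n) x (case_nat (0, \<i>) w)"

lemma alternating_form_slice_volume:
  "alternating_form (1 + 2 * CARD('n)) UNIV
     (\<lambda>w :: nat \<Rightarrow> (complex ^ 'n::finite) \<times> complex. slice_volume a b (w 0) (\<lambda>i. w (Suc i)))"
proof -
  have "alternating_form (Suc (1 + 2 * CARD('n))) UNIV
      (\<lambda>w :: nat \<Rightarrow> (complex ^ 'n) \<times> complex. liouville_form (symplectic a b) CARD('n) (w 0) (\<lambda>i. w (Suc i)))"
    using alternating_form_liouville_Suc[OF bilinear_symplectic symplectic_skew, of "CARD('n)"] by simp
  from alternating_form_insert_1[OF this, of "(0, \<i>)"] show ?thesis by (simp add: slice_volume_def)
qed

lemma slice_volume_darboux_frame: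
  assumes "a > 0" "b > 0"
  shows "slice_volume a b (darboux_frame 0 :: (complex ^ 'n::finite) \<times> complex) (\<lambda>i. darboux_frame (Suc i)) > 0"
  unfolding slice_volume_def
proof (rule liouville_form_pos[where a = a])
  let ?w = "case_nat (0, \<i>) (\<lambda>i. darboux_frame (Suc i)) :: nat \<Rightarrow> (complex ^ 'n) \<times> complex"
  have w: "?w i = darboux_frame i" if "i \<in> {1..2 * CARD('n)}" for i
    using that by (cases i) auto
  show "symplectic a b (darboux_frame 0) (?w 0) > 0"
    using assms by (simp add: symplectic_def darboux_frame_simps area_form_def)
  show "symplectic a b (darboux_frame 0) (?w i) = 0" if "i \<in> {1..2 * CARD('n)}" for i
    unfolding w[OF that] using that
    by (auto simp: symplectic_def darboux_frame_def area_form_def inner_axis cvec_i_def)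
  show "symplectic a b (?w i) (?w k) = a * darboux i k"
    if "i \<in> {1..2 * CARD('n)}" "k \<in> {1..2 * CARD('n)}" for i k
    unfolding w[OF that(1)] w[OF that(2)] by (rule symplectic_darboux_frame[OF that])
qed (use assms in auto)

text \<open>Together with x these are 2n + 2 arguments from a space spanned by 2n + 1 vectors, so an
  alternating form of that degree has no room.\<close>

lemma liouville_form_real_slice:
  fixes w :: "nat \<Rightarrow> (complex ^ 'n::finite) \<times> complex"
  assumes x: "x \<in> real_slice" and w: "\<And>i. i < 1 + 2 * CARD('n) \<Longrightarrow> w i \<in> real_slice"
  shows "liouville_form (symplectic a b) CARD('n) x w = 0"
proof -
  let ?m = "2 + 2 * CARD('n)"
  let ?\<beta> = "\<lambda>w :: nat \<Rightarrow> (complex ^ 'n) \<times> complex. liouville_form (symplectic a b) CARD('n) (w 0) (\<lambda>i. w (Suc i))"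
  have alt: "alternating_form ?m real_slice ?\<beta>"
    by (rule alternating_form_mono[OF alternating_form_liouville_Suc[OF bilinear_symplectic symplectic_skew]]) simp
  \<comment> \<open>The frame is padded with a second copy of \<open>darboux_frame 0\<close> to
    reach 2n + 2 members; the repetition makes the form vanish on it.\<close>
  let ?e = "\<lambda>i. if i < 1 + 2 * CARD('n) then darboux_frame i else (darboux_frame 0 :: (complex ^ 'n) \<times> complex)"
  have "?\<beta> (case_nat x w) = 0"
  proof (rule alternating_form_vanishes[OF alt subspace_real_slice, of ?e])
    show "?e i \<in> real_slice" for i by (simp add: darboux_frame_in)
    show "\<exists>c. v = (\<Sum>i<?m. c i *\<^sub>R ?e i)" if v: "v \<in> real_slice" for v :: "(complex ^ 'n) \<times> complex"
    proof (intro exI[of _ "\<lambda>i. if i < 1 + 2 * CARD('n) then v \<bullet> darboux_frame i else 0"])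
      have "(\<Sum>i<?m. (if i < 1 + 2 * CARD('n) then v \<bullet> darboux_frame i else 0) *\<^sub>R ?e i) =
          (\<Sum>i<1 + 2 * CARD('n). (v \<bullet> darboux_frame i) *\<^sub>R darboux_frame i)"
        by (rule sum.mono_neutral_cong_right) auto
      then show "v = (\<Sum>i<?m. (if i < 1 + 2 * CARD('n) then v \<bullet> darboux_frame i else 0) *\<^sub>R ?e i)"
        using darboux_frame_expansion[OF v] by simp
    qed
    show "?\<beta> ?e = 0"
      by (rule alternating_form_eq_0[OF alt, of 0 "1 + 2 * CARD('n)"]) (auto simp: darboux_frame_in)
    show "case_nat x w i \<in> real_slice" if "i < ?m" for i
      using that x w by (cases i) auto
  qed
  then show ?thesis by simp
qed

lemma bounded_bilinear_symplectic: "bounded_bilinear (symplectic a b)"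
  using bilinear_symplectic by (simp add: bilinear_conv_bounded_bilinear)

lemma continuous_on_slice_volume:
  fixes f :: "'b::topological_space \<Rightarrow> (complex ^ 'n::finite) \<times> complex"
  assumes f: "continuous_on A f" and g: "\<And>i. continuous_on A (\<lambda>x. g x i)"
  shows "continuous_on A (\<lambda>x. slice_volume a b (f x) (g x))"
proof -
  have slots: "continuous_on A (\<lambda>x. case_nat (0, \<i>) (g x) i)" for i
    using g by (cases i) auto
  show ?thesis
    unfolding slice_volume_def liouville_form_def alternation_def
    by (intro continuous_intros bounded_bilinear.continuous_on[OF bounded_bilinear_symplectic] f slots)
qed

lemma slice_volume_linear: "bounded_linear (\<lambda>x. slice_volume a b x w)"
  using liouville_form_linear[OF bilinear_symplectic]
  by (simp add: slice_volume_def linear_conv_bounded_linear)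

text \<open>The sum is the trace of the rank one map that sends w to \<zeta>(w) y, taken in the
  orthonormal Darboux frame.\<close>

lemma trace_rank_one:
  fixes y :: "(complex ^ 'n::finite) \<times> complex"
  assumes "linear \<zeta>" "y \<in> real_slice"
  shows "(\<Sum>i<1 + 2 * CARD('n). \<zeta> (darboux_frame i) * (y \<bullet> darboux_frame i)) = \<zeta> y"
proof -
  have "\<zeta> y = \<zeta> (\<Sum>i<1 + 2 * CARD('n). (y \<bullet> darboux_frame i) *\<^sub>R darboux_frame i)"
    using darboux_frame_expansion[OF assms(2)] by simp
  also have "\<dots> = (\<Sum>i<1 + 2 * CARD('n). (y \<bullet> darboux_frame i) *\<^sub>R \<zeta> (darboux_frame i))"
    by (simp only: linear_sum[OF assms(1)] linear_scale[OF assms(1)])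
  finally show ?thesis by (simp add: mult.commute)
qed

lemma darboux_frame_unit: "darboux_frame i \<bullet> darboux_frame i = 1"
  by (simp add: darboux_frame_def inner_axis_axis)

section \<open>The model hypersurfaces\<close>

text \<open>All three models are handled at once by placing the hypersurface in \<open>\<complex>\<^sup>n \<times> \<real>\<close> as
  \<open>\<epsilon> |z|\<^sup>2 + u\<^sup>2 = 1\<close>, with \<open>\<epsilon> = 0\<close> (and \<open>u = 1\<close>) for the Heisenberg group, \<open>\<epsilon> = 1\<close> for the sphere
  and \<open>\<epsilon> = - 1\<close> for the anti-de Sitter space. The point \<open>p\<close> corresponds to \<open>off + emb p\<close>.\<close>

locale model_hypersurface =
  fixes M :: "'a::euclidean_space contact_space" and S :: "'a set"
    and emb :: "'a \<Rightarrow> (complex ^ 'n::finite) \<times> complex" and prj :: "(complex ^ 'n) \<times> complex \<Rightarrow> 'a"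
    and off :: "(complex ^ 'n) \<times> complex" and \<epsilon> \<kappa> a b :: real
  assumes chalf: "chalf M = CARD('n)"
    and emb: "bounded_linear emb" and prj: "bounded_linear prj"
    and prj_emb: "prj (emb v) = v"
    and emb_prj: "\<epsilon> \<noteq> 0 \<or> Re (snd w) = 0 \<Longrightarrow> emb (prj w) = w"
    and eps: "\<epsilon> = 0 \<or> \<epsilon> = 1 \<or> \<epsilon> = - 1"
    and pos: "\<kappa> > 0" "a > 0" "b > 0" and ab: "\<epsilon> = 0 \<or> a = b"
    and cform: "cform M p v = symplectic a b (off + emb p) (emb v)"
    and cmetric: "cmetric M p v v' = (fst (emb v) \<bullet> fst (emb v') + \<epsilon> * (snd (emb v) \<bullet> snd (emb v'))) / \<kappa>"
    and closed_S: "closed S"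
    and S_slice: "p \<in> S \<Longrightarrow> off + emb p \<in> real_slice"
    and S_quadric: "p \<in> S \<Longrightarrow>
      \<epsilon> * (fst (off + emb p) \<bullet> fst (off + emb p)) + (Re (snd (off + emb p)))\<^sup>2 = 1"
    and tangent_S: "p \<in> S \<Longrightarrow> tangent_space S p = {v. emb v \<in> real_slice \<and>
      \<epsilon> * (fst (off + emb p) \<bullet> fst (emb v)) + Re (snd (off + emb p)) * Re (snd (emb v)) = 0}"
    and tangent_M: "p \<in> S \<Longrightarrow> tangent_space (cmanifold M) p = {v.
      \<epsilon> * (fst (off + emb p) \<bullet> fst (emb v)) + Re (snd (off + emb p)) * Re (snd (emb v)) = 0}"
begin

section \<open>Position, defining function and characteristic points\<close>

definition pt :: "'a \<Rightarrow> (complex ^ 'n) \<times> complex" where "pt p = off + emb p"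
definition zc :: "'a \<Rightarrow> complex ^ 'n" where "zc p = fst (pt p)"
definition uc :: "'a \<Rightarrow> real" where "uc p = Re (snd (pt p))"
definition rho :: "'a \<Rightarrow> real" where "rho p = zc p \<bullet> zc p"
text \<open>Half the differential of \<epsilon> |z|^2 + u^2 at p; the factor is chosen so that the
  position vector of a point of S gets the value 1.\<close>

definition conormal :: "'a \<Rightarrow> (complex ^ 'n) \<times> complex \<Rightarrow> real" where
  "conormal p w = \<epsilon> * (zc p \<bullet> fst w) + uc p * Re (snd w)"

lemma pt_slice: "p \<in> S \<Longrightarrow> pt p \<in> real_slice" and Im_pt: "p \<in> S \<Longrightarrow> Im (snd (pt p)) = 0"
  using S_slice[of p] by (auto simp: pt_def real_slice_def)

lemma quadric: "p \<in> S \<Longrightarrow> \<epsilon> * rho p + (uc p)\<^sup>2 = 1"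
  using S_quadric by (simp add: rho_def zc_def uc_def pt_def)

lemma eps_cube: "\<epsilon> * \<epsilon> * \<epsilon> = \<epsilon>" using eps by auto

lemma tangent_S': "p \<in> S \<Longrightarrow> tangent_space S p = {v. emb v \<in> real_slice \<and> conormal p (emb v) = 0}"
  using tangent_S by (simp add: conormal_def zc_def uc_def pt_def)

lemma tangent_M': "p \<in> S \<Longrightarrow> tangent_space (cmanifold M) p = {v. conormal p (emb v) = 0}"
  using tangent_M by (simp add: conormal_def zc_def uc_def pt_def)

lemma conormal_linear: "linear (conormal p)"
  by (rule linearI) (simp_all add: conormal_def inner_simps algebra_simps)

lemma conormal_pt: "p \<in> S \<Longrightarrow> conormal p (pt p) = 1"
  using quadric[of p] by (simp add: conormal_def rho_def zc_def uc_def power2_eq_square)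

text \<open>In the Heisenberg model \<open>emb\<close> reaches only vectors with imaginary last
  coordinate; there \<epsilon> = 0 and u^2 = 1, and the conormal condition says exactly
  this.\<close>

lemma emb_prj_tangent:
  assumes p: "p \<in> S" and w: "conormal p w = 0"
  shows "emb (prj w) = w"
proof (rule emb_prj)
  show "\<epsilon> \<noteq> 0 \<or> Re (snd w) = 0"
    using quadric[OF p] w by (auto simp: conormal_def)
qed

lemma prj_tangent:
  assumes p: "p \<in> S" and w: "w \<in> real_slice" "conormal p w = 0"
  shows "prj w \<in> tangent_space S p"
  using emb_prj_tangent[OF p w(2)] w tangent_S'[OF p] by simp

lemma cform_S:
  "p \<in> S \<Longrightarrow> cform M p v = a * (cvec_i (zc p) \<bullet> fst (emb v)) + b * uc p * Im (snd (emb v))"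
  using Im_pt[of p] by (simp add: cform symplectic_def area_form_def zc_def uc_def pt_def)

lemma horizontal_space_eq:
  assumes p: "p \<in> S"
  shows "horizontal_space M S p =
    {v. emb v \<in> real_slice \<and> conormal p (emb v) = 0 \<and> cvec_i (zc p) \<bullet> fst (emb v) = 0}"
  using p pos unfolding horizontal_space_def contact_plane_def
  by (auto simp: tangent_S' tangent_M' cform_S real_slice_def)

lemma characteristic_set_eq: "characteristic_set M S = {p \<in> S. zc p = 0}"
proof -
  have "tangent_space S p = contact_plane M p \<longleftrightarrow> zc p = 0" if p: "p \<in> S" for p
  proof
    assume eq: "tangent_space S p = contact_plane M p"
    \<comment> \<open>The vector (\<i> z, 0) is always tangent to S, and the contact form takes the
      value a |z|^2 on it.\<close>
    let ?w = "(cvec_i (zc p), 0) :: (complex ^ 'n) \<times> complex"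
    have w: "?w \<in> real_slice" "conormal p ?w = 0" by (auto simp: real_slice_def conormal_def)
    have "prj ?w \<in> contact_plane M p" using prj_tangent[OF p w] eq by simp
    then have "a * (zc p \<bullet> zc p) = 0"
      by (simp add: contact_plane_def cform_S[OF p] emb_prj_tangent[OF p w(2)])
    then show "zc p = 0" using pos by simp
  next
    assume z: "zc p = 0"
    have "uc p \<noteq> 0" using quadric[OF p] z by (auto simp: rho_def)
    then show "tangent_space S p = contact_plane M p"
      using pos z unfolding contact_plane_def
      by (auto simp: tangent_S'[OF p] tangent_M'[OF p] cform_S[OF p] real_slice_def conormal_def)
  qed
  then show ?thesis unfolding characteristic_set_def by auto
qed

lemma regular_part_eq: "regular_part M S = S \<inter> {p. zc p \<noteq> 0}"
  unfolding regular_part_def characteristic_set_eq by auto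

lemma continuous_pt: "continuous_on UNIV pt"
  unfolding pt_def by (intro continuous_intros linear_continuous_on[OF emb])

lemma open_regular: "open {p. zc p \<noteq> 0}"
proof -
  have "continuous_on UNIV zc"
    unfolding zc_def by (intro continuous_intros continuous_pt)
  then show ?thesis by (intro open_Collect_neq continuous_intros)
qed

lemma tangent_regular: "p \<in> regular_part M S \<Longrightarrow> tangent_space (regular_part M S) p = tangent_space S p"
  unfolding regular_part_eq by (rule tangent_space_Int_open[OF open_regular]) simp

lemma regularD: "p \<in> regular_part M S \<Longrightarrow> p \<in> S" "p \<in> regular_part M S \<Longrightarrow> zc p \<noteq> 0"
  "p \<in> regular_part M S \<Longrightarrow> rho p > 0"
  unfolding regular_part_eq by (auto simp: rho_def)

text \<open>Testing against (y, 0) with y orthogonal to z and \<i> z leaves d z + c \<i> z in the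
  first component; testing against the horizontal vector (u z, - \<epsilon> \<rho>) then removes d
  and the real part of the last one. This gives uniqueness both of the normal, up to sign, and of
  the gradient.\<close>

lemma horizontal_perp:
  assumes p: "p \<in> regular_part M S" and w: "conormal p w = 0"
    and perp: "\<And>Y. Y \<in> horizontal_space M S p \<Longrightarrow>
      fst w \<bullet> fst (emb Y) + \<epsilon> * (snd w \<bullet> snd (emb Y)) = 0"
  obtains c where "fst w = c *\<^sub>R cvec_i (zc p)" "Re (snd w) = 0"
proof -
  note p' = regularD[OF p]
  let ?z = "zc p"
  have hor: "prj y \<in> horizontal_space M S p \<and> emb (prj y) = y"
    if "y \<in> real_slice" "conormal p y = 0" "cvec_i ?z \<bullet> fst y = 0" for y
    using that emb_prj_tangent[OF p'(1) that(2)] horizontal_space_eq[OF p'(1)] by simp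
  define d c where "d = (fst w \<bullet> ?z) / rho p" and "c = (fst w \<bullet> cvec_i ?z) / rho p"
  define y where "y = fst w - d *\<^sub>R ?z - c *\<^sub>R cvec_i ?z"
  have yz: "y \<bullet> ?z = 0" "y \<bullet> cvec_i ?z = 0"
    using p'(3) by (simp_all add: y_def d_def c_def inner_simps rho_def)
  have "(y, 0) \<in> real_slice" "conormal p (y, 0) = 0" "cvec_i ?z \<bullet> fst (y, 0 :: complex) = 0"
    using yz by (simp_all add: real_slice_def conormal_def inner_commute)
  from hor[OF this] perp[of "prj (y, 0)"] have "fst w \<bullet> y = 0" by simp
  moreover have "y \<bullet> y = fst w \<bullet> y - d * (y \<bullet> ?z) - c * (y \<bullet> cvec_i ?z)"
    by (subst (2) y_def) (simp add: inner_simps inner_commute)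
  ultimately have "y = 0" using yz by simp
  then have fw: "fst w = d *\<^sub>R ?z + c *\<^sub>R cvec_i ?z" by (simp add: y_def algebra_simps)
  let ?y = "(uc p *\<^sub>R ?z, of_real (- \<epsilon> * rho p)) :: (complex ^ 'n) \<times> complex"
  have "?y \<in> real_slice" "conormal p ?y = 0" "cvec_i ?z \<bullet> fst ?y = 0"
    by (simp_all add: real_slice_def conormal_def rho_def inner_simps)
  from hor[OF this] perp[of "prj ?y"]
  have "fst w \<bullet> (uc p *\<^sub>R ?z) + \<epsilon> * (snd w \<bullet> of_real (- \<epsilon> * rho p)) = 0" by simp
  then have "d * rho p * uc p - \<epsilon> * \<epsilon> * rho p * Re (snd w) = 0"
    by (simp add: fw inner_simps rho_def inner_complex_def mult_ac)
  then have 1: "d * uc p = \<epsilon> * \<epsilon> * Re (snd w)" using p'(3) by (simp add: field_simps)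
  have 2: "\<epsilon> * d * rho p + uc p * Re (snd w) = 0"
    using w by (simp add: conormal_def fw inner_simps rho_def)
  have q: "\<epsilon> * rho p + (uc p)\<^sup>2 = 1" by (rule quadric[OF p'(1)])
  \<comment> \<open>Facts 1 and 2 are a linear system for d and \<open>Re (snd w)\<close> whose
    determinant is u^2 + \<epsilon>^3 \<rho> = 1, as \<epsilon>^3 = \<epsilon>. Solving it by hand
    treats the three values of \<epsilon> at once.\<close>
  have "Re (snd w) = Re (snd w) * (\<epsilon> * rho p + (uc p)\<^sup>2)" by (simp add: q)
  also have "\<dots> = uc p * (\<epsilon> * d * rho p + uc p * Re (snd w)) - \<epsilon> * rho p * (d * uc p - \<epsilon> * \<epsilon> * Re (snd w))
      + \<epsilon> * rho p * Re (snd w) * (1 - \<epsilon> * \<epsilon>)"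
    by (simp add: algebra_simps power2_eq_square)
  also have "\<dots> = rho p * Re (snd w) * (\<epsilon> - \<epsilon> * \<epsilon> * \<epsilon>)" using 1 2 by (simp add: algebra_simps)
  finally have re: "Re (snd w) = 0" using eps_cube by simp
  have "d = d * (\<epsilon> * rho p + (uc p)\<^sup>2)" by (simp add: q)
  also have "\<dots> = \<epsilon> * d * rho p + uc p * (d * uc p)"
    by (simp add: algebra_simps power2_eq_square)
  also have "\<dots> = (\<epsilon> * d * rho p + uc p * Re (snd w)) + uc p * (\<epsilon> * \<epsilon> * Re (snd w))"
    unfolding 1 re by simp
  finally have "d = 0" unfolding 2 unfolding re by simp
  with fw re show thesis by (intro that[of c]) auto
qed

text \<open>On s (\<i> z, 0) + t (0, \<i>) the contact form is a \<rho> s + b u t, which gives the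
  direction s = - b u, t = a \<rho>. Its squared length before division by \<kappa> is b^2 \<rho>,
  see \<open>normal_coefficients\<close>; this explains the scalar factor.\<close>

definition unit_normal :: "'a \<Rightarrow> 'a" where
  "unit_normal p = prj ((sqrt \<kappa> / (b * norm (zc p))) *\<^sub>R
     (- (b * uc p) *\<^sub>R cvec_i (zc p), Complex 0 (a * rho p)))"

lemma emb_unit_normal:
  "p \<in> S \<Longrightarrow> emb (unit_normal p) = (sqrt \<kappa> / (b * norm (zc p))) *\<^sub>R
     (- (b * uc p) *\<^sub>R cvec_i (zc p), Complex 0 (a * rho p))"
  unfolding unit_normal_def
  by (rule emb_prj_tangent[of p]) (simp_all add: conormal_def)

text \<open>Everything that \<open>subriem_normal\<close> demands apart from orientation, which
  leaves a sign open.\<close>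

definition normal_candidate :: "'a \<Rightarrow> 'a \<Rightarrow> bool" where
  "normal_candidate p N \<longleftrightarrow> N \<in> tangent_space (cmanifold M) p \<and> cform M p N = 0 \<and> cmetric M p N N = 1 \<and>
     (\<forall>Y\<in>horizontal_space M S p. cmetric M p N Y = 0)"

lemma normal_coefficients:
  assumes p: "p \<in> regular_part M S"
  shows "(b * uc p)\<^sup>2 * rho p + \<epsilon> * (a * rho p)\<^sup>2 = b\<^sup>2 * rho p"
proof -
  have "(b * uc p)\<^sup>2 * rho p + \<epsilon> * (a * rho p)\<^sup>2 = rho p * (b\<^sup>2 * (\<epsilon> * rho p + (uc p)\<^sup>2) + \<epsilon> * rho p * (a\<^sup>2 - b\<^sup>2))"
    by (simp add: algebra_simps power2_eq_square)
  then show ?thesis using quadric[OF regularD(1)[OF p]] ab by auto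
qed

lemma normal_candidate_iff:
  assumes p: "p \<in> regular_part M S"
  shows "normal_candidate p N \<longleftrightarrow> N = unit_normal p \<or> N = - unit_normal p"
proof -
  note p' = regularD[OF p]
  let ?z = "zc p" and ?l = "sqrt \<kappa> / (b * norm (zc p))"
  have nz: "norm ?z \<noteq> 0" using p'(2) by simp
  have n2: "(norm ?z)\<^sup>2 = rho p" by (simp add: rho_def power2_norm_eq_inner)
  have l2: "?l\<^sup>2 = \<kappa> / (b\<^sup>2 * rho p)" using pos by (simp add: power_divide power_mult_distrib n2)
  have lpos: "?l > 0" using pos p'(2) by simp
  note e = emb_unit_normal[OF p'(1)]
  have em: "emb (- N) = - emb N" for N using emb by (simp add: linear_neg bounded_linear.linear)
  have cand: "normal_candidate p (unit_normal p)"
    unfolding normal_candidate_def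
  proof (intro conjI ballI)
    show "unit_normal p \<in> tangent_space (cmanifold M) p"
      by (simp add: tangent_M'[OF p'(1)] e conormal_def)
    show "cform M p (unit_normal p) = 0"
      by (simp add: cform_S[OF p'(1)] e inner_simps rho_def algebra_simps)
    define l where "l = ?l"
    have "cmetric M p (unit_normal p) (unit_normal p) =
        ?l\<^sup>2 * ((b * uc p)\<^sup>2 * rho p + \<epsilon> * (a * rho p)\<^sup>2) / \<kappa>"
      unfolding cmetric e l_def[symmetric]
      by (simp add: rho_def inner_complex_def power2_eq_square algebra_simps)
    also have "\<dots> = 1"
      unfolding normal_coefficients[OF p] l2 using pos p'(3) by simp
    finally show "cmetric M p (unit_normal p) (unit_normal p) = 1" .
    show "cmetric M p (unit_normal p) Y = 0" if "Y \<in> horizontal_space M S p" for Y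
      using that unfolding horizontal_space_eq[OF p'(1)]
      by (simp add: cmetric e real_slice_def inner_complex_def)
  qed
  moreover have "normal_candidate p (- unit_normal p)"
  proof -
    have "cmetric M p (- v) w = - cmetric M p v w" "cmetric M p v (- w) = - cmetric M p v w" for v w
      using pos by (simp_all add: cmetric em field_simps)
    moreover have "cform M p (- v) = - cform M p v" for v by (simp add: cform_S[OF p'(1)] em)
    ultimately show ?thesis
      using cand unfolding normal_candidate_def
      by (simp add: tangent_M'[OF p'(1)] em linear_neg[OF conormal_linear])
  qed
  moreover have "N = unit_normal p \<or> N = - unit_normal p" if N: "normal_candidate p N"
  proof -
    let ?w = "emb N"
    have w0: "conormal p ?w = 0" using N by (simp add: normal_candidate_def tangent_M'[OF p'(1)])
    have "fst ?w \<bullet> fst (emb Y) + \<epsilon> * (snd ?w \<bullet> snd (emb Y)) = 0" if "Y \<in> horizontal_space M S p" for Y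
      using N that pos by (auto simp: normal_candidate_def cmetric)
    from horizontal_perp[OF p w0 this] obtain c where c: "fst ?w = c *\<^sub>R cvec_i ?z" "Re (snd ?w) = 0" .
    define d where "d = Im (snd ?w)"
    have snd: "snd ?w = Complex 0 d" using c(2) by (simp add: complex_eq_iff d_def)
    have 1: "a * c * rho p + b * uc p * d = 0"
      using N by (simp add: normal_candidate_def cform_S[OF p'(1)] c snd inner_simps rho_def algebra_simps)
    have 2: "c\<^sup>2 * rho p + \<epsilon> * d\<^sup>2 = \<kappa>"
      using N pos by (simp add: normal_candidate_def cmetric c snd inner_simps rho_def
          inner_complex_def power2_eq_square field_simps)
    \<comment> \<open>The vanishing of the contact form makes (c, d) a multiple of the coefficients
      of \<open>unit_normal\<close>. The factor t is read off from d, because a \<rho> is nonzero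
      whereas u may vanish on the sphere.\<close>
    define t where "t = d / (a * rho p)"
    have d: "d = t * (a * rho p)" using pos p'(3) by (simp add: t_def)
    have "(a * rho p) * c = (a * rho p) * (- t * b * uc p)" using 1 by (simp add: d algebra_simps)
    then have cc: "c = - t * b * uc p"
      by (rule mult_left_cancel[THEN iffD1, rotated]) (use pos p'(3) in simp)
    have "t\<^sup>2 * ((b * uc p)\<^sup>2 * rho p + \<epsilon> * (a * rho p)\<^sup>2) = \<kappa>"
      using 2 unfolding cc d by (simp add: algebra_simps power2_eq_square)
    then have "t\<^sup>2 = ?l\<^sup>2" unfolding normal_coefficients[OF p] l2 using pos p'(3) by (simp add: field_simps)
    then have t: "t = ?l \<or> t = - ?l" by (simp add: power2_eq_iff)
    have w: "?w = t *\<^sub>R (- (b * uc p) *\<^sub>R cvec_i ?z, Complex 0 (a * rho p))"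
      by (simp add: prod_eq_iff c cc snd d complex_eq_iff)
    have "emb N = emb (unit_normal p) \<or> emb N = emb (- unit_normal p)"
      using t unfolding w em e by auto
    then show ?thesis by (metis prj_emb)
  qed
  ultimately show ?thesis by auto
qed

text \<open>The contact form is B(off + emb p, emb v), affine in p, so its exterior derivative is
  the constant form 2 B. The n factors 2 cancel the (1/2)^n of the wedge power.\<close>

lemma contact_volume_eq:
  "contact_volume M p w = liouville_form (symplectic a b) CARD('n) (pt p) (\<lambda>i. emb (w i))"
proof -
  let ?B = "symplectic a b :: (complex ^ 'n) \<times> complex \<Rightarrow> _"
  define \<omega> where "\<omega> = (\<lambda>p (v :: nat \<Rightarrow> 'a). cform M p (v 0))"
  have der: "((\<lambda>q. ?B (off + emb q) x) has_derivative (\<lambda>v. ?B (emb v) x)) (at p)" for p x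
  proof -
    have "linear (\<lambda>v. ?B (emb v) x)"
      using emb by (auto intro!: linearI simp: bilinear_ladd[OF bilinear_symplectic]
          bilinear_lmul[OF bilinear_symplectic] linear_add linear_scale bounded_linear.linear)
    then have "((\<lambda>q. ?B off x + ?B (emb q) x) has_derivative (\<lambda>v. 0 + ?B (emb v) x)) (at p)"
      by (intro has_derivative_add has_derivative_const bounded_linear_imp_has_derivative)
        (simp add: linear_conv_bounded_linear)
    then show ?thesis by (simp add: bilinear_ladd[OF bilinear_symplectic])
  qed
  have ext: "ext_deriv 1 \<omega> p v = 2 * ?B (emb (v 0)) (emb (v 1))" for p v
    using symplectic_skew[of a b "emb (v 1)" "emb (v 0)"]
    by (simp add: ext_deriv_def \<omega>_def cform frechet_derivative_at[OF der, symmetric])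
  have "contact_volume M p w = wedge 1 (2 * CARD('n)) \<omega> (wedge_power 2 (ext_deriv 1 \<omega>) CARD('n)) p w"
    by (simp add: contact_volume_def chalf \<omega>_def Let_def)
  also have "wedge_power 2 (ext_deriv 1 \<omega>) CARD('n) = (\<lambda>p v. (1 / fact 2) ^ CARD('n) *
      alternation (2 * CARD('n)) (\<lambda>v. \<Prod>j<CARD('n). ext_deriv 1 \<omega> p (\<lambda>i. v (2 * j + i))) v)"
  proof (rule wedge_power_alternation)
    fix p and v w :: "nat \<Rightarrow> 'a" assume "\<And>i. i < 2 \<Longrightarrow> v i = w i"
    then have "v 0 = w 0" "v 1 = w 1" by auto
    then show "ext_deriv 1 \<omega> p v = ext_deriv 1 \<omega> p w" by (simp only: ext)
  qed
  also have "wedge 1 (2 * CARD('n)) \<omega> \<dots> p w = (1 / fact 2) ^ CARD('n) / fact 1 *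
      alternation (1 + 2 * CARD('n)) (\<lambda>v. \<omega> p v * (\<Prod>j<CARD('n). ext_deriv 1 \<omega> p (\<lambda>i. v (1 + (2 * j + i))))) w"
    by (rule wedge_alternation) (simp add: \<omega>_def)
  also have "\<dots> = liouville_form ?B CARD('n) (pt p) (\<lambda>i. emb (w i))"
  proof -
    have half: "(1 / 2) ^ CARD('n) * (\<Prod>j<CARD('n). 2 * h j) = (\<Prod>j<CARD('n). h j)" for h :: "nat \<Rightarrow> real"
      by (simp add: prod.distrib power_divide)
    then show ?thesis
      unfolding liouville_form_def alternation_def
      by (simp only: ext)
        (simp add: \<omega>_def cform pt_def sum_distrib_left mult.left_commute[of "(1 / 2) ^ CARD('n)"] half)
  qed
  finally show ?thesis .
qed

definition frame_volume :: "'a \<Rightarrow> (nat \<Rightarrow> 'a) \<Rightarrow> real" where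
  "frame_volume p v = slice_volume a b (pt p) (\<lambda>i. emb (v i))"

text \<open>Only the component of the normal along (0, \<i>) counts: the rest lies in
  \<open>real_slice\<close> together with the position and v, where the form vanishes. Hence \<mu>
  is, up to sign, a constant times |z| times the slice volume.\<close>

lemma contact_volume_normal:
  assumes p: "p \<in> S" and v: "\<And>i. i < 2 * CARD('n) \<Longrightarrow> emb (v i) \<in> real_slice"
  shows "contact_volume M p (case_nat (unit_normal p) v) =
    sqrt \<kappa> * a / b * norm (zc p) * frame_volume p v"
proof -
  let ?B = "symplectic a b :: (complex ^ 'n) \<times> complex \<Rightarrow> _"
  let ?l = "sqrt \<kappa> / (b * norm (zc p))"
  let ?h = "(- (b * uc p) *\<^sub>R cvec_i (zc p), 0) :: (complex ^ 'n) \<times> complex"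
  let ?w = "case_nat (0, \<i>) (\<lambda>i. emb (v i)) :: nat \<Rightarrow> (complex ^ 'n) \<times> complex"
  note alt = alternating_form_liouville[OF bilinear_symplectic, of "CARD('n)" a b "pt p"]
  have "emb (unit_normal p) = ?l *\<^sub>R ?h + (?l * a * rho p) *\<^sub>R (0, \<i>)"
    unfolding emb_unit_normal[OF p] by (simp add: prod_eq_iff complex_eq_iff)
  then have "(\<lambda>i. emb (case_nat (unit_normal p) v i)) = ?w(0 := ?l *\<^sub>R ?h + (?l * a * rho p) *\<^sub>R (0, \<i>))"
    by (auto simp: fun_eq_iff split: nat.splits)
  then have "contact_volume M p (case_nat (unit_normal p) v) =
      ?l * liouville_form ?B CARD('n) (pt p) (?w(0 := ?h)) +
      ?l * a * rho p * liouville_form ?B CARD('n) (pt p) (?w(0 := (0, \<i>)))"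
    unfolding contact_volume_eq by (subst alternating_form_lin[OF alt, symmetric]) auto
  also have "liouville_form ?B CARD('n) (pt p) (?w(0 := ?h)) = 0"
  proof (rule liouville_form_real_slice[OF pt_slice[OF p]])
    show "(?w(0 := ?h)) i \<in> real_slice" if "i < 1 + 2 * CARD('n)" for i
      using that v by (cases i) (auto simp: real_slice_def)
  qed
  also have "?w(0 := (0, \<i>)) = ?w" by (auto simp: fun_eq_iff split: nat.splits)
  also have "?l * 0 + ?l * a * rho p * liouville_form ?B CARD('n) (pt p) ?w =
      sqrt \<kappa> * a / b * norm (zc p) * frame_volume p v"
    by (simp add: frame_volume_def slice_volume_def rho_def flip: power2_norm_eq_inner)
      (simp add: power2_eq_square)
  finally show ?thesis .
qed

subsection \<open>Orientation and the normal field\<close>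

lemma alternating_form_frame_volume: "alternating_form (2 * CARD('n)) UNIV (frame_volume p)"
proof -
  note alt = alternating_form_slice_volume[where 'n = 'n and a = a and b = b]
  let ?\<beta> = "\<lambda>w :: nat \<Rightarrow> (complex ^ 'n) \<times> complex. slice_volume a b (w 0) (\<lambda>i. w (Suc i))"
  let ?I = "\<lambda>v. case_nat (pt p) (\<lambda>i. emb (v i))"
  have vol: "frame_volume p = (\<lambda>v. ?\<beta> (?I v))" by (rule ext) (simp add: frame_volume_def)
  have upd: "?I (v(i := x)) = (?I v)(Suc i := emb x)" for v i x
    by (auto simp: fun_eq_iff split: nat.splits)
  have lin: "emb (c *\<^sub>R u + d *\<^sub>R w) = c *\<^sub>R emb u + d *\<^sub>R emb w" for c d u w
    using emb by (simp add: linear_add linear_scale bounded_linear.linear)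
  show ?thesis
    unfolding alternating_form_def vol
  proof (intro conjI allI impI; (elim conjE)?)
    show "?\<beta> (?I v) = ?\<beta> (?I w)" if "\<forall>i<2 * CARD('n). v i = w i" for v w
      by (rule alternating_form_cong[OF alt]) (use that in \<open>auto split: nat.splits\<close>)
    show "?\<beta> (?I (v(i := c *\<^sub>R u + d *\<^sub>R w))) = c * ?\<beta> (?I (v(i := u))) + d * ?\<beta> (?I (v(i := w)))"
      if "i < 2 * CARD('n)" for v i c d u w
      unfolding upd lin using that by (intro alternating_form_lin[OF alt]) auto
    show "?\<beta> (?I v) = 0" if "i < j" "j < 2 * CARD('n)" "v i = v j" for v i j
      by (rule alternating_form_eq_0[OF alt, of "Suc i" "Suc j"]) (use that in auto)
  qed
qed

text \<open>The tangent space, seen through \<open>emb\<close>, has dimension at most 2n, being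
  orthogonal to two independent vectors, and together with the position it spans
  \<open>real_slice\<close>. If the volume vanished on a spanning frame, it would thus vanish on the
  Darboux frame too.\<close>

lemma tangent_frame:
  assumes p: "p \<in> S"
  obtains e where "\<And>i. e i \<in> tangent_space S p"
    "\<And>w. w \<in> tangent_space S p \<Longrightarrow> \<exists>c. w = (\<Sum>i<2 * CARD('n). c i *\<^sub>R e i)"
    "frame_volume p e \<noteq> 0"
proof -
  let ?n = "2 * CARD('n)"
  define T where "T = real_slice \<inter> {w. conormal p w = 0}"
  have T: "subspace T"
    unfolding T_def by (intro subspace_inter subspace_real_slice linear_subspace_kernel conormal_linear)
  define g where "g = (\<epsilon> *\<^sub>R zc p, complex_of_real (uc p))"
  have g: "conormal p w = g \<bullet> w" for w
    by (simp add: conormal_def g_def inner_prod_def inner_complex_def)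
  have "dim T \<le> ?n"
  proof -
    let ?A = "span {g, (0, \<i>)}"
    have "g \<noteq> 0" using conormal_pt[OF p] by (auto simp: g)
    moreover have "g \<bullet> (0, \<i>) = 0" by (simp add: g_def inner_prod_def inner_complex_def)
    moreover have "((0, \<i>) :: (complex ^ 'n) \<times> complex) \<noteq> 0" by (simp add: zero_prod_def)
    ultimately have "pairwise orthogonal {g, (0, \<i>)}" "0 \<notin> {g, (0, \<i>)}"
      by (auto simp: pairwise_def orthogonal_def inner_commute)
    then have "dim ?A = card {g, (0, \<i>)}"
      by (intro dim_span_eq_card_independent pairwise_orthogonal_independent)
    moreover have "g \<noteq> (0, \<i>)" unfolding g_def by (simp add: complex_eq_iff)
    ultimately have "dim ?A = 2" by simp
    moreover have "dim {y \<in> UNIV. \<forall>x \<in> ?A. orthogonal x y} + dim ?A =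
        dim (UNIV :: ((complex ^ 'n) \<times> complex) set)"
      by (rule dim_subspace_orthogonal_to_vectors) auto
    moreover have "T \<subseteq> {y \<in> UNIV. \<forall>x \<in> ?A. orthogonal x y}"
    proof
      fix y assume y: "y \<in> T"
      have "orthogonal y x" if "x \<in> ?A" for x
        using that
      proof (rule orthogonal_to_span)
        fix x assume "x \<in> {g, (0, \<i>)}"
        then show "orthogonal y x"
        proof -
          have "(0, \<i>) \<bullet> y = Im (snd y)" by (simp add: inner_prod_def inner_complex_def)
          then have "x \<bullet> y = 0" using y \<open>x \<in> {g, (0, \<i>)}\<close> by (auto simp: T_def g real_slice_def)
          then show ?thesis by (simp add: orthogonal_def inner_commute)
        qed
      qed
      then show "y \<in> {y \<in> UNIV. \<forall>x \<in> ?A. orthogonal x y}" by (simp add: orthogonal_commute)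
    qed
    then have "dim T \<le> dim {y \<in> UNIV. \<forall>x \<in> ?A. orthogonal x y}" by (rule dim_subset)
    ultimately show ?thesis by (simp add: dim_UNIV)
  qed
  obtain Bs where Bs: "Bs \<subseteq> T" "independent Bs" "T \<subseteq> span Bs" "card Bs = dim T"
    using basis_exists[of T] by blast
  have fin: "finite Bs" using Bs(2) by (rule independent_imp_finite)
  obtain h where h: "bij_betw h {0..<card Bs} Bs" using ex_bij_betw_nat_finite[OF fin] by blast
  \<comment> \<open>A basis of T, padded by zeros up to 2n entries; the nonvanishing volume shown
    below rules out that padding occurs.\<close>
  define e' where "e' i = (if i < card Bs then h i else 0)" for i
  have e'T: "e' i \<in> T" for i
    using h Bs(1) subspace_0[OF T] by (auto simp: e'_def bij_betw_def)
  have span: "\<exists>c. w = (\<Sum>i<?n. c i *\<^sub>R e' i)" if "w \<in> T" for w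
  proof -
    from that Bs(3) have "w \<in> range (\<lambda>u. \<Sum>v\<in>Bs. u v *\<^sub>R v)" using span_finite[OF fin] by blast
    then obtain u where "w = (\<Sum>v\<in>Bs. u v *\<^sub>R v)" by blast
    also have "\<dots> = (\<Sum>i\<in>{0..<card Bs}. u (h i) *\<^sub>R h i)"
      by (rule sum.reindex_bij_betw[OF h, symmetric])
    also have "\<dots> = (\<Sum>i<?n. u (h i) *\<^sub>R e' i)"
      using \<open>dim T \<le> ?n\<close> Bs(4) by (intro sum.mono_neutral_cong_left) (auto simp: e'_def)
    finally show ?thesis by (intro exI[of _ "\<lambda>i. u (h i)"])
  qed
  have emb_e: "emb (prj (e' i)) = e' i" for i
    using e'T[of i] by (intro emb_prj_tangent[OF p]) (simp add: T_def)
  show thesis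
  proof (rule that[of "\<lambda>i. prj (e' i)"])
    show "prj (e' i) \<in> tangent_space S p" for i
      using e'T[of i] by (intro prj_tangent[OF p]) (simp_all add: T_def)
    show "\<exists>c. w = (\<Sum>i<?n. c i *\<^sub>R prj (e' i))" if "w \<in> tangent_space S p" for w
    proof -
      have "emb w \<in> T" using that by (simp add: tangent_S'[OF p] T_def)
      then obtain c where "emb w = (\<Sum>i<?n. c i *\<^sub>R e' i)" using span by blast
      then have "prj (emb w) = (\<Sum>i<?n. c i *\<^sub>R prj (e' i))"
        using prj by (simp add: linear_sum linear_scale bounded_linear.linear)
      then show ?thesis by (auto simp: prj_emb)
    qed
    show "frame_volume p (\<lambda>i. prj (e' i)) \<noteq> 0"
    proof
      assume 0: "frame_volume p (\<lambda>i. prj (e' i)) = 0"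
      let ?\<beta> = "\<lambda>w :: nat \<Rightarrow> (complex ^ 'n) \<times> complex. slice_volume a b (w 0) (\<lambda>i. w (Suc i))"
      have "?\<beta> darboux_frame = 0"
      proof (rule alternating_form_vanishes[OF alternating_form_mono[OF alternating_form_slice_volume subset_UNIV]
            subspace_real_slice, of "case_nat (pt p) e'"])
        show "case_nat (pt p) e' i \<in> real_slice" for i
          using e'T pt_slice[OF p] by (auto simp: T_def split: nat.splits)
        show "?\<beta> (case_nat (pt p) e') = 0" using 0 by (simp add: frame_volume_def emb_e)
        show "\<exists>c. w = (\<Sum>i<1 + 2 * CARD('n). c i *\<^sub>R (case_nat (pt p) e' i))" if w: "w \<in> real_slice" for w
        proof -
          \<comment> \<open>As \<open>conormal p (pt p) = 1\<close>, this is the projection to T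
            along the position vector.\<close>
          have "w - conormal p w *\<^sub>R pt p \<in> T"
            using w pt_slice[OF p] conormal_pt[OF p]
            by (simp add: T_def linear_diff[OF conormal_linear] linear_scale[OF conormal_linear]
                subspace_diff[OF subspace_real_slice] subspace_mul[OF subspace_real_slice])
          then obtain c where "w - conormal p w *\<^sub>R pt p = (\<Sum>i<?n. c i *\<^sub>R e' i)" using span by blast
          then have "w = (\<Sum>i<Suc ?n. case_nat (conormal p w) c i *\<^sub>R (case_nat (pt p) e' i))"
            by (simp add: sum.lessThan_Suc_shift algebra_simps del: sum.lessThan_Suc)
          then show ?thesis by auto
        qed
      qed (simp add: darboux_frame_in)
      then show False using slice_volume_darboux_frame[OF pos(2,3), where 'n = 'n] by simp
    qed
  qed
qed

lemma subspace_tangent: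
  assumes p: "p \<in> S"
  shows "subspace (tangent_space S p)"
proof -
  have "tangent_space S p = emb -` (real_slice \<inter> {w. conormal p w = 0})"
    unfolding tangent_S'[OF p] by auto
  moreover have "subspace \<dots>"
    by (intro linear_subspace_vimage bounded_linear.linear[OF emb] subspace_inter subspace_real_slice
        linear_subspace_kernel conormal_linear)
  ultimately show ?thesis by simp
qed

lemma orientation_proportional:
  assumes p: "p \<in> S" and \<sigma>: "orientation_form (2 * CARD('n)) S \<sigma>"
  obtains k where "k \<noteq> 0"
    "\<And>Z. (\<And>i. i < 2 * CARD('n) \<Longrightarrow> Z i \<in> tangent_space S p) \<Longrightarrow> \<sigma> p Z = k * frame_volume p Z"
proof -
  let ?n = "2 * CARD('n)" and ?T = "tangent_space S p"
  have alt: "alternating_form ?n ?T (\<sigma> p)"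
    using bspec[OF conjunct1[OF \<sigma>[unfolded orientation_form_def]] p] unfolding alternating_form_def
    by (elim conjE) (intro conjI; assumption)
  obtain v where v: "\<forall>j<?n. v j \<in> ?T" "\<sigma> p v \<noteq> 0"
    using bspec[OF conjunct1[OF \<sigma>[unfolded orientation_form_def]] p] by (elim conjE exE)
  obtain e where e: "\<And>i. e i \<in> ?T" "\<And>w. w \<in> ?T \<Longrightarrow> \<exists>c. w = (\<Sum>i<?n. c i *\<^sub>R e i)" "frame_volume p e \<noteq> 0"
    using tangent_frame[OF p] by metis
  have pr: "frame_volume p e * \<sigma> p Z = \<sigma> p e * frame_volume p Z" if "\<And>i. i < ?n \<Longrightarrow> Z i \<in> ?T" for Z
    by (rule alternating_form_proportional[OF alt alternating_form_mono[OF alternating_form_frame_volume subset_UNIV]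
          subspace_tangent[OF p] e(1,2) that])
  show thesis
  proof (rule that[of "\<sigma> p e / frame_volume p e"])
    show "\<sigma> p e / frame_volume p e \<noteq> 0" using pr[of v] v e(3) by auto
    show "\<sigma> p Z = \<sigma> p e / frame_volume p e * frame_volume p Z"
      if "\<And>i. i < ?n \<Longrightarrow> Z i \<in> ?T" for Z
      using pr[OF that] e(3) by (simp add: field_simps)
  qed
qed

lemma contact_volume_scale:
  "contact_volume M p (case_nat (c *\<^sub>R N) v) = c * contact_volume M p (case_nat N v)"
proof -
  let ?f = "\<lambda>i. emb (case_nat N v i)"
  let ?L = "liouville_form (symplectic a b) CARD('n) (pt p)"
  have "(\<lambda>i. emb (case_nat (c *\<^sub>R N) v i)) = ?f(0 := c *\<^sub>R emb N)"
    using emb by (auto simp: fun_eq_iff linear_scale bounded_linear.linear split: nat.splits)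
  moreover have "?L (?f(0 := c *\<^sub>R emb N)) = c * ?L (?f(0 := emb N))"
    by (rule alternating_form_scale[OF alternating_form_liouville[OF bilinear_symplectic]]) auto
  moreover have "?f(0 := emb N) = ?f" by (rule fun_upd_idem) simp
  ultimately show ?thesis unfolding contact_volume_eq by simp
qed

text \<open>The orientation clause compares \<sigma> with the contact volume, and both are multiples
  of \<open>frame_volume\<close> on tangent frames; so the sign of the normal is the sign of the
  factor k.\<close>

lemma subriem_normal_eq:
  assumes p: "p \<in> regular_part M S" and k: "k \<noteq> 0"
    "\<And>Z. (\<And>i. i < 2 * CARD('n) \<Longrightarrow> Z i \<in> tangent_space S p) \<Longrightarrow> \<sigma> p Z = k * frame_volume p Z"
  shows "subriem_normal M S \<sigma> p = sgn k *\<^sub>R unit_normal p"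
proof -
  note p' = regularD[OF p]
  let ?n = "2 * CARD('n)" and ?T = "tangent_space S p"
  let ?K = "sqrt \<kappa> * a / b * norm (zc p)"
  let ?pos = "\<lambda>N. \<forall>Z. (\<forall>i<?n. Z i \<in> ?T) \<and> \<sigma> p Z > 0 \<longrightarrow> contact_volume M p (case_nat N Z) > 0"
  have K: "?K > 0" using pos p'(2) by simp
  have vol: "contact_volume M p (case_nat (s *\<^sub>R unit_normal p) Z) = s * (?K * frame_volume p Z)"
    if "\<And>i. i < ?n \<Longrightarrow> Z i \<in> ?T" for s Z
    unfolding contact_volume_scale
    by (subst contact_volume_normal[OF p'(1)]) (use that tangent_S'[OF p'(1)] in auto)
  \<comment> \<open>Without a positively oriented frame the orientation clause would be vacuous and
    admit both signs. One is made from any frame by flipping its first vector where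
    necessary.\<close>
  obtain Z0 where Z0: "\<And>i. i < ?n \<Longrightarrow> Z0 i \<in> ?T" "\<sigma> p Z0 > 0"
  proof -
    obtain e where e: "\<And>i. e i \<in> ?T" "frame_volume p e \<noteq> 0" using tangent_frame[OF p'(1)] by metis
    let ?e = "e(0 := sgn (k * frame_volume p e) *\<^sub>R e 0)"
    have "0 < ?n" by simp
    have "frame_volume p ?e = sgn (k * frame_volume p e) * frame_volume p (e(0 := e 0))"
      by (rule alternating_form_scale[OF alternating_form_frame_volume]) auto
    then have "k * frame_volume p ?e = sgn (k * frame_volume p e) * (k * frame_volume p e)" by simp
    also have "\<dots> > 0" using k(1) e(2) by (auto simp: sgn_if mult_less_0_iff zero_less_mult_iff split: if_splits)
    finally have "k * frame_volume p ?e > 0" .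
    moreover have T: "?e i \<in> ?T" for i
      using e(1) subspace_mul[OF subspace_tangent[OF p'(1)]] by simp
    ultimately show thesis using k(2)[of ?e] by (intro that[of ?e]) auto
  qed
  have good: "?pos (sgn k *\<^sub>R unit_normal p)"
  proof (intro allI impI, elim conjE)
    fix Z assume Z: "\<forall>i<?n. Z i \<in> ?T" and "\<sigma> p Z > 0"
    then have "k * frame_volume p Z > 0" using k(2)[of Z] by simp
    then have "sgn k * frame_volume p Z > 0" using k(1) by (auto simp: sgn_if zero_less_mult_iff)
    then have "?K * (sgn k * frame_volume p Z) > 0" using K by (rule mult_pos_pos[rotated])
    then show "contact_volume M p (case_nat (sgn k *\<^sub>R unit_normal p) Z) > 0"
      using Z by (subst vol) (auto simp: mult_ac)
  qed
  have bad: "\<not> ?pos ((- sgn k) *\<^sub>R unit_normal p)"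
  proof
    assume "?pos ((- sgn k) *\<^sub>R unit_normal p)"
    then have "contact_volume M p (case_nat ((- sgn k) *\<^sub>R unit_normal p) Z0) > 0" using Z0 by blast
    moreover have "contact_volume M p (case_nat (sgn k *\<^sub>R unit_normal p) Z0) > 0" using good Z0 by blast
    ultimately show False unfolding contact_volume_scale by linarith
  qed
  have sgn: "sgn k = 1 \<or> sgn k = - 1" using k(1) by (auto simp: sgn_if)
  have cand: "normal_candidate p N \<longleftrightarrow> N = sgn k *\<^sub>R unit_normal p \<or> N = (- sgn k) *\<^sub>R unit_normal p" for N
    using sgn unfolding normal_candidate_iff[OF p] by auto
  have "subriem_normal M S \<sigma> p = (THE N. normal_candidate p N \<and> ?pos N)"
    unfolding subriem_normal_def normal_candidate_def chalf by (simp only: conj_assoc)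
  also have "\<dots> = sgn k *\<^sub>R unit_normal p"
    using good bad cand by (intro the_equality) blast+
  finally show ?thesis .
qed

text \<open>The Lie derivative of \<mu> at p involves the normal at nearby points, so its sign has
  to be constant near p. Continuity of \<sigma> is given along continuous tangent frames only; the
  frame e at p is therefore extended to nearby points by projecting along the position
  vector.\<close>

lemma subriem_normal_locally:
  assumes p: "p \<in> regular_part M S" and \<sigma>: "orientation_form (2 * CARD('n)) S \<sigma>"
  obtains s U where "s = 1 \<or> s = - 1" "open U" "p \<in> U"
    "\<And>q. q \<in> regular_part M S \<Longrightarrow> q \<in> U \<Longrightarrow> subriem_normal M S \<sigma> q = s *\<^sub>R unit_normal q"
proof -
  note p' = regularD[OF p]
  let ?n = "2 * CARD('n)"
  obtain e where e: "\<And>i. e i \<in> tangent_space S p" "frame_volume p e \<noteq> 0"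
    using tangent_frame[OF p'(1)] by metis
  define V where "V i q = prj (emb (e i) - conormal q (emb (e i)) *\<^sub>R pt q)" for i q
  have con: "conormal q (emb (e i) - conormal q (emb (e i)) *\<^sub>R pt q) = 0" if "q \<in> S" for i q
    using conormal_pt[OF that] by (simp add: linear_diff[OF conormal_linear] linear_scale[OF conormal_linear])
  have VT: "V i q \<in> tangent_space S q" if "q \<in> S" for i q
    unfolding V_def
    using e(1) pt_slice[OF that] tangent_S'[OF p'(1)]
    by (intro prj_tangent[OF that _ con[OF that]] subspace_diff[OF subspace_real_slice]
        subspace_mul[OF subspace_real_slice]) auto
  have Vp: "V i p = e i" for i
    using e(1)[of i] by (simp add: V_def tangent_S'[OF p'(1)] prj_emb)
  have contV: "continuous_on S (V i)" for i
    unfolding V_def conormal_def zc_def uc_def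
    by (intro bounded_linear.continuous_on[OF prj] continuous_intros
        continuous_on_subset[OF continuous_pt subset_UNIV])
  \<comment> \<open>At each point h is the factor between \<sigma> and \<open>frame_volume\<close>
    times a square, so where h is nonzero its sign is the sign of the normal relative to
    \<open>unit_normal\<close>.\<close>
  define h where "h q = \<sigma> q (\<lambda>i. V i q) * frame_volume q (\<lambda>i. V i q)" for q
  have "continuous_on S h"
    unfolding h_def
  proof (rule continuous_on_mult)
    have "openin (top_of_set S) S" by simp
    then show "continuous_on S (\<lambda>q. \<sigma> q (\<lambda>i. V i q))"
      using conjunct2[OF \<sigma>[unfolded orientation_form_def], rule_format, of S V] contV VT by blast
    show "continuous_on S (\<lambda>q. frame_volume q (\<lambda>i. V i q))"
      unfolding frame_volume_def
      by (intro continuous_on_slice_volume bounded_linear.continuous_on[OF emb] contV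
          continuous_on_subset[OF continuous_pt subset_UNIV])
  qed
  have h: "\<exists>k. k \<noteq> 0 \<and> subriem_normal M S \<sigma> q = sgn k *\<^sub>R unit_normal q \<and>
      h q = k * (frame_volume q (\<lambda>i. V i q))\<^sup>2" if q: "q \<in> regular_part M S" for q
  proof -
    obtain k where k: "k \<noteq> 0"
      "\<And>Z. (\<And>i. i < ?n \<Longrightarrow> Z i \<in> tangent_space S q) \<Longrightarrow> \<sigma> q Z = k * frame_volume q Z"
      using orientation_proportional[OF regularD(1)[OF q] \<sigma>] by metis
    moreover have "h q = k * (frame_volume q (\<lambda>i. V i q))\<^sup>2"
      unfolding h_def by (subst k(2)) (auto simp: VT[OF regularD(1)[OF q]] power2_eq_square)
    ultimately show ?thesis using subriem_normal_eq[where \<sigma> = \<sigma>, OF q k] by blast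
  qed
  obtain k where k: "k \<noteq> 0" "h p = k * (frame_volume p (\<lambda>i. V i p))\<^sup>2" using h[OF p] by blast
  have "k * h p = (k * frame_volume p e)\<^sup>2" by (simp add: k(2) Vp power2_eq_square)
  then have hp: "k * h p > 0" using k(1) e(2) by simp
  have "open {x. k * x > 0}" by (intro open_Collect_less continuous_intros)
  then obtain U where U: "open U" "U \<inter> S = h -` {x. k * x > 0} \<inter> S"
    using \<open>continuous_on S h\<close> unfolding continuous_on_open_invariant by blast
  show thesis
  proof (rule that[of "sgn k" U])
    show "sgn k = 1 \<or> sgn k = - 1" using k(1) by (auto simp: sgn_if)
    show "p \<in> U" using hp U(2) p'(1) by blast
    show "subriem_normal M S \<sigma> q = sgn k *\<^sub>R unit_normal q" if q: "q \<in> regular_part M S" "q \<in> U" for q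
    proof -
      obtain l where l: "l \<noteq> 0" "subriem_normal M S \<sigma> q = sgn l *\<^sub>R unit_normal q"
        "h q = l * (frame_volume q (\<lambda>i. V i q))\<^sup>2" using h[OF q(1)] by blast
      have "k * h q > 0" using U(2) q(2) regularD(1)[OF q(1)] by blast
      then have "0 < (k * l) * (frame_volume q (\<lambda>i. V i q))\<^sup>2" by (simp add: l(3) mult.assoc)
      then have "0 < k * l" by (auto simp: zero_less_mult_iff[of "k * l"])
      then have "sgn l = sgn k" by (auto simp: sgn_if zero_less_mult_iff)
      then show ?thesis using l(2) by simp
    qed
  qed (fact U(1))
qed

subsection \<open>The sub-Laplacian of radial functions\<close>

lemma pt_has_derivative: "(pt has_derivative emb) (at p within A)"
  unfolding pt_def
  using has_derivative_add[OF has_derivative_const bounded_linear_imp_has_derivative[OF emb]] by simp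

lemma zc_has_derivative: "(zc has_derivative (\<lambda>v. fst (emb v))) (at p within A)"
  unfolding zc_def by (rule has_derivative_fst[OF pt_has_derivative])

lemma uc_has_derivative: "(uc has_derivative (\<lambda>v. Re (snd (emb v)))) (at p within A)"
  unfolding uc_def
  by (intro bounded_linear.has_derivative[OF bounded_linear_Re] has_derivative_snd pt_has_derivative)

lemma rho_has_derivative: "(rho has_derivative (\<lambda>v. 2 * (zc p \<bullet> fst (emb v)))) (at p within A)"
  unfolding rho_def
  using has_derivative_inner[OF zc_has_derivative zc_has_derivative, of p A]
  by (simp add: inner_commute)

lemma radial_has_derivative:
  assumes "(\<psi> has_real_derivative \<psi>') (at (rho p))"
  shows "((\<lambda>q. \<psi> (rho q)) has_derivative (\<lambda>v. \<psi>' * (2 * (zc p \<bullet> fst (emb v))))) (at p within A)"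
  using has_derivative_compose[OF rho_has_derivative assms[unfolded has_field_derivative_def]] .

text \<open>On S this is (z, 0) - \<epsilon> \<rho> (z, u), the Euclidean gradient of |z|^2 / 2
  projected along the position vector to the tangent space, rewritten with u^2 = 1 - \<epsilon>
  \<rho>.\<close>

definition radial_vector :: "'a \<Rightarrow> (complex ^ 'n) \<times> complex" where
  "radial_vector p = ((uc p)\<^sup>2 *\<^sub>R zc p, of_real (- \<epsilon> * uc p * rho p))"

lemma conormal_radial_vector: "conormal p (radial_vector p) = 0"
  by (simp add: conormal_def radial_vector_def rho_def power2_eq_square)

lemma radial_vector_slice: "radial_vector p \<in> real_slice"
  by (simp add: radial_vector_def real_slice_def)

lemma radial_vector_horizontal:
  assumes "p \<in> S"
  shows "emb (prj (c *\<^sub>R radial_vector p)) = c *\<^sub>R radial_vector p"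
    and "prj (c *\<^sub>R radial_vector p) \<in> horizontal_space M S p"
proof -
  show *: "emb (prj (c *\<^sub>R radial_vector p)) = c *\<^sub>R radial_vector p"
    by (rule emb_prj_tangent[OF assms]) (simp add: linear_scale[OF conormal_linear] conormal_radial_vector)
  show "prj (c *\<^sub>R radial_vector p) \<in> horizontal_space M S p"
    unfolding horizontal_space_eq[OF assms]
    using subspace_mul[OF subspace_real_slice radial_vector_slice]
    by (simp add: * linear_scale[OF conormal_linear] conormal_radial_vector)
      (simp add: radial_vector_def)
qed

text \<open>The pairing with a horizontal Y reduces to the inner product of z with its first
  component by the tangency relation for Y and \<epsilon>^3 = \<epsilon>. Uniqueness is
  \<open>horizontal_perp\<close>, since a horizontal multiple of \<i> z is 0.\<close>

lemma horizontal_gradient_radial: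
  assumes p: "p \<in> regular_part M S" and \<psi>: "(\<psi> has_real_derivative \<psi>') (at (rho p))"
  shows "horizontal_gradient M S (\<lambda>q. \<psi> (rho q)) p = prj ((2 * \<kappa> * \<psi>') *\<^sub>R radial_vector p)"
proof -
  note p' = regularD[OF p]
  let ?v = "prj ((2 * \<kappa> * \<psi>') *\<^sub>R radial_vector p)"
  let ?H = "horizontal_space M S p"
  have sub: "?H \<subseteq> tangent_space (regular_part M S) p"
    unfolding tangent_regular[OF p] horizontal_space_def by blast
  have der: "deriv_along (regular_part M S) p Y (\<lambda>q. \<psi> (rho q)) = \<psi>' * (2 * (zc p \<bullet> fst (emb Y)))"
    if "Y \<in> ?H" for Y
    by (rule deriv_along_eq[OF radial_has_derivative[OF \<psi>]]) (use that sub in blast)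
  have grad: "cmetric M p ?v Y = \<psi>' * (2 * (zc p \<bullet> fst (emb Y)))" if Y: "Y \<in> ?H" for Y
  proof -
    let ?y = "zc p \<bullet> fst (emb Y)" and ?r = "Re (snd (emb Y))"
    have con: "uc p * ?r = - \<epsilon> * ?y" using Y by (simp add: horizontal_space_eq[OF p'(1)] conormal_def)
    have "cmetric M p ?v Y = 2 * \<psi>' * ((uc p)\<^sup>2 * ?y + \<epsilon> * (- \<epsilon> * rho p * (uc p * ?r)))"
      unfolding cmetric radial_vector_horizontal(1)[OF p'(1)]
      using pos by (simp add: radial_vector_def inner_complex_def field_simps)
    also have "\<dots> = 2 * \<psi>' * (((uc p)\<^sup>2 + \<epsilon> * \<epsilon> * \<epsilon> * rho p) * ?y)"
      unfolding con by (simp add: algebra_simps)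
    also have "(uc p)\<^sup>2 + \<epsilon> * \<epsilon> * \<epsilon> * rho p = 1" using quadric[OF p'(1)] by (simp add: eps_cube)
    finally show ?thesis by simp
  qed
  show ?thesis
    unfolding horizontal_gradient_def
  proof (rule the_equality)
    show "?v \<in> ?H \<and> (\<forall>Y\<in>?H. cmetric M p ?v Y = deriv_along (regular_part M S) p Y (\<lambda>q. \<psi> (rho q)))"
      using radial_vector_horizontal(2)[OF p'(1)] der grad by simp
    fix v assume v: "v \<in> ?H \<and> (\<forall>Y\<in>?H. cmetric M p v Y = deriv_along (regular_part M S) p Y (\<lambda>q. \<psi> (rho q)))"
    let ?d = "emb v - emb ?v"
    have H: "?d \<in> real_slice" "conormal p ?d = 0" "cvec_i (zc p) \<bullet> fst ?d = 0"
      using v radial_vector_horizontal(2)[OF p'(1), of "2 * \<kappa> * \<psi>'"] unfolding horizontal_space_eq[OF p'(1)]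
      by (simp_all add: subspace_diff[OF subspace_real_slice] linear_diff[OF conormal_linear] inner_diff_right)
    have "fst ?d \<bullet> fst (emb Y) + \<epsilon> * (snd ?d \<bullet> snd (emb Y)) = 0" if Y: "Y \<in> ?H" for Y
    proof -
      have "cmetric M p v Y = cmetric M p ?v Y" using v der[OF Y] grad[OF Y] Y by simp
      then show ?thesis using pos by (simp add: cmetric inner_diff_left algebra_simps)
    qed
    from horizontal_perp[OF p H(2) this] obtain c where c: "fst ?d = c *\<^sub>R cvec_i (zc p)" "Re (snd ?d) = 0" .
    have "c = 0" using H(3) p'(3) unfolding c(1) by (simp add: rho_def)
    then have "?d = 0" using c H(1) by (auto simp: prod_eq_iff complex_eq_iff real_slice_def)
    then have "prj (emb v) = prj (emb ?v)" by simp
    then show "v = ?v" by (simp only: prj_emb)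
  qed
qed

lemma emb_prj_real: "emb (prj (y, of_real (\<epsilon> * r))) = (y, of_real (\<epsilon> * r))"
  by (rule emb_prj) auto

lemma hypersurface_volume_eq:
  assumes q: "q \<in> regular_part M S" and N: "subriem_normal M S \<sigma> q = s *\<^sub>R unit_normal q"
    and v: "\<And>i. i < 2 * CARD('n) \<Longrightarrow> emb (v i) \<in> real_slice"
  shows "hypersurface_volume M S \<sigma> q v = s * (sqrt \<kappa> * a / b) * (norm (zc q) * frame_volume q v)"
  using contact_volume_normal[OF regularD(1)[OF q] v]
  by (simp add: hypersurface_volume_def interior_product_def N contact_volume_scale)

lemma sub_laplacian_radial:
  assumes p: "p \<in> regular_part M S" and \<sigma>: "orientation_form (2 * CARD('n)) S \<sigma>"
    and \<psi>: "\<And>r. r > 0 \<Longrightarrow> (\<psi> has_real_derivative \<psi>1 r) (at r)"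
      "\<And>r. r > 0 \<Longrightarrow> (\<psi>1 has_real_derivative \<psi>2 r) (at r)"
  shows "sub_laplacian M S \<sigma> (\<lambda>q. \<psi> (rho q)) p = 2 * \<kappa> * (2 * rho p * (uc p)\<^sup>2 * \<psi>2 (rho p) +
    ((2 * real CARD('n) + 1) * (uc p)\<^sup>2 - \<epsilon> * rho p) * \<psi>1 (rho p))"
proof -
  note p' = regularD[OF p]
  let ?n = "2 * CARD('n)" and ?R = "regular_part M S" and ?T = "tangent_space S p"
  let ?z = "zc p" and ?u = "uc p" and ?r = "rho p" and ?Y = "radial_vector p"
  define \<phi> \<phi>1 where "\<phi> = 2 * \<kappa> * \<psi>1 ?r" and "\<phi>1 = 2 * \<kappa> * \<psi>2 ?r"
  define X where "X = horizontal_gradient M S (\<lambda>q. \<psi> (rho q))"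
  have X: "X q = prj ((2 * \<kappa> * \<psi>1 (rho q)) *\<^sub>R radial_vector q)" if "q \<in> ?R" for q
    unfolding X_def by (rule horizontal_gradient_radial[OF that \<psi>(1)]) (rule regularD(3)[OF that])
  have Xp: "X p = prj (\<phi> *\<^sub>R ?Y)" unfolding X[OF p] \<phi>_def ..
  have embX: "emb (X p) = \<phi> *\<^sub>R ?Y" unfolding Xp by (rule radial_vector_horizontal(1)[OF p'(1)])
  have XT: "X p \<in> ?T"
    unfolding Xp using radial_vector_horizontal(2)[OF p'(1)] by (simp add: horizontal_space_def)
  \<comment> \<open>The differential at p of
    \<open>(2 * \<kappa> * \<psi>1 (rho q)) *\<^sub>R radial_vector q\<close>, written as a map of
    the ambient space of positions.\<close>
  define G :: "(complex ^ 'n) \<times> complex \<Rightarrow> (complex ^ 'n) \<times> complex" where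
    "G w = (2 * \<phi>1 * (?z \<bullet> fst w)) *\<^sub>R ?Y + \<phi> *\<^sub>R ((2 * ?u * Re (snd w)) *\<^sub>R ?z + ?u\<^sup>2 *\<^sub>R fst w,
      of_real (- \<epsilon> * (Re (snd w) * ?r + ?u * (2 * (?z \<bullet> fst w)))))" for w
  have "((\<lambda>q. prj ((2 * \<kappa> * \<psi>1 (rho q)) *\<^sub>R radial_vector q)) has_derivative (\<lambda>v. prj (G (emb v)))) (at p within ?R)"
  proof (rule bounded_linear.has_derivative[OF prj])
    have 1: "((\<lambda>q. 2 * \<kappa> * \<psi>1 (rho q)) has_derivative (\<lambda>v. 2 * \<phi>1 * (?z \<bullet> fst (emb v)))) (at p within ?R)"
      using has_derivative_mult_right[OF radial_has_derivative[OF \<psi>(2)[OF p'(3)]], of "2 * \<kappa>"]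
      by (simp add: \<phi>1_def mult_ac)
    have 2: "(radial_vector has_derivative (\<lambda>v. ((2 * ?u * Re (snd (emb v))) *\<^sub>R ?z + ?u\<^sup>2 *\<^sub>R fst (emb v),
      of_real (- \<epsilon> * (Re (snd (emb v)) * ?r + ?u * (2 * (?z \<bullet> fst (emb v)))))))) (at p within ?R)"
    proof (rule has_derivative_eq_rhs)
      show "(radial_vector has_derivative (\<lambda>v. ((?u * ?u) *\<^sub>R fst (emb v) +
          (?u * Re (snd (emb v)) + Re (snd (emb v)) * ?u) *\<^sub>R ?z,
          of_real (- \<epsilon> * ?u * (2 * (?z \<bullet> fst (emb v))) + - \<epsilon> * Re (snd (emb v)) * ?r)))) (at p within ?R)"
        unfolding radial_vector_def power2_eq_square
        by (intro has_derivative_Pair bounded_linear.has_derivative[OF bounded_linear_of_real]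
            has_derivative_scaleR has_derivative_mult has_derivative_mult_right
            zc_has_derivative uc_has_derivative rho_has_derivative)
      have "?u * x + x * ?u = 2 * ?u * x" for x by simp
      then show "(\<lambda>v. ((?u * ?u) *\<^sub>R fst (emb v) + (?u * Re (snd (emb v)) + Re (snd (emb v)) * ?u) *\<^sub>R ?z,
          of_real (- \<epsilon> * ?u * (2 * (?z \<bullet> fst (emb v))) + - \<epsilon> * Re (snd (emb v)) * ?r))) =
          (\<lambda>v. ((2 * ?u * Re (snd (emb v))) *\<^sub>R ?z + ?u\<^sup>2 *\<^sub>R fst (emb v),
          complex_of_real (- \<epsilon> * (Re (snd (emb v)) * ?r + ?u * (2 * (?z \<bullet> fst (emb v)))))))"
        by (simp add: fun_eq_iff power2_eq_square algebra_simps)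
    qed
    show "((\<lambda>q. (2 * \<kappa> * \<psi>1 (rho q)) *\<^sub>R radial_vector q) has_derivative (\<lambda>v. G (emb v))) (at p within ?R)"
      using has_derivative_scaleR[OF 1 2] by (simp add: G_def \<phi>_def add.commute)
  qed
  then have derX: "(X has_derivative (\<lambda>v. prj (G (emb v)))) (at p within ?R)"
    by (rule has_derivative_transform_within[OF _ zero_less_one p]) (simp add: X)
  \<comment> \<open>The last component of G w carries the factor \<epsilon>, so it is 0 in the model
    where \<open>emb\<close> reaches only imaginary last coordinates.\<close>
  have embG: "emb (prj (G w)) = G w" for w
  proof -
    have *: "G w = ((2 * \<phi>1 * (?z \<bullet> fst w)) *\<^sub>R (?u\<^sup>2 *\<^sub>R ?z) + \<phi> *\<^sub>R ((2 * ?u * Re (snd w)) *\<^sub>R ?z + ?u\<^sup>2 *\<^sub>R fst w),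
      of_real (\<epsilon> * (- 2 * \<phi>1 * (?z \<bullet> fst w) * ?u * ?r - \<phi> * (Re (snd w) * ?r + ?u * (2 * (?z \<bullet> fst w))))))"
      unfolding G_def radial_vector_def by (simp add: complex_eq_iff algebra_simps)
    show ?thesis unfolding * by (rule emb_prj_real)
  qed
  have G_slice: "G w \<in> real_slice" for w by (simp add: G_def radial_vector_def real_slice_def)
  obtain s U where s: "s = 1 \<or> s = - 1" and U: "open U" "p \<in> U"
    and N: "\<And>q. q \<in> ?R \<Longrightarrow> q \<in> U \<Longrightarrow> subriem_normal M S \<sigma> q = s *\<^sub>R unit_normal q"
    using subriem_normal_locally[OF p \<sigma>] by metis
  define K where "K = s * (sqrt \<kappa> * a / b)"
  have K: "K \<noteq> 0" using s pos by (auto simp: K_def)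
  let ?\<mu> = "hypersurface_volume M S \<sigma>"
  have \<mu>: "?\<mu> q v = K * (norm (zc q) * frame_volume q v)"
    if "q \<in> ?R" "q \<in> U" "\<And>i. i < ?n \<Longrightarrow> emb (v i) \<in> real_slice" for q v
    unfolding K_def by (rule hypersurface_volume_eq[OF that(1) N[OF that(1,2)] that(3)])
  text \<open>The form \<open>K |z| slice_volume (pt q)\<close> is differentiated in its first slot as well, so that
    the Lie derivative becomes a derivation on all \<open>2n + 1\<close> slots, i.e. a trace on \<open>real_slice\<close>.\<close>
  define C where "C = \<phi> *\<^sub>R ?Y - G (pt p)"
  define L where "L w = G w + conormal p w *\<^sub>R C" for w
  have L: "linear L"
    unfolding L_def G_def
    by (rule linearI) (simp_all add: linear_add[OF conormal_linear] linear_scale[OF conormal_linear]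
        inner_simps algebra_simps prod_eq_iff complex_eq_iff)
  have CY: "C = (- 2 * ?r * \<phi>1 - 2 * \<phi>) *\<^sub>R ?Y"
  proof -
    have "pt p = (?z, of_real ?u)"
      using Im_pt[OF p'(1)] by (simp add: prod_eq_iff complex_eq_iff zc_def uc_def)
    then have "G (pt p) = (2 * \<phi>1 * ?r) *\<^sub>R ?Y + \<phi> *\<^sub>R ((2 * ?u * ?u) *\<^sub>R ?z + ?u\<^sup>2 *\<^sub>R ?z,
        of_real (- \<epsilon> * (?u * ?r + ?u * (2 * ?r))))"
      unfolding G_def rho_def by simp
    \<comment> \<open>Euler's identity: the components of \<open>radial_vector\<close> are
      homogeneous of degree 3 in (z, u).\<close>
    also have "((2 * ?u * ?u) *\<^sub>R ?z + ?u\<^sup>2 *\<^sub>R ?z, of_real (- \<epsilon> * (?u * ?r + ?u * (2 * ?r)))) = 3 *\<^sub>R ?Y"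
      unfolding radial_vector_def by (simp add: complex_eq_iff power2_eq_square flip: scaleR_left_distrib)
    finally have "C = (\<phi> - (2 * \<phi>1 * ?r + \<phi> * 3)) *\<^sub>R ?Y"
      by (simp only: C_def scaleR_scaleR scaleR_left_distrib scaleR_left_diff_distrib)
    also have "\<phi> - (2 * \<phi>1 * ?r + \<phi> * 3) = - 2 * ?r * \<phi>1 - 2 * \<phi>" by simp
    finally show ?thesis .
  qed
  have L_slice: "L w \<in> real_slice" for w
    unfolding L_def CY
    by (intro subspace_add[OF subspace_real_slice] subspace_mul[OF subspace_real_slice] G_slice radial_vector_slice)
  have trace: "(\<Sum>i<1 + ?n. L (darboux_frame i) \<bullet> darboux_frame i) =
      \<phi> * (2 * real CARD('n) * ?u\<^sup>2 - \<epsilon> * ?r) + 2 * \<phi>1 * ?u\<^sup>2 * ?r"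
  proof -
    \<comment> \<open>On the slice L is \<phi> u^2 times the identity plus three rank one maps,
      whose traces are given by \<open>trace_rank_one\<close>. The term with u^2 in \<zeta>1 takes
      the multiple of the identity back in the last coordinate, where G has no such part.\<close>
    define \<zeta>1 where "\<zeta>1 w = - \<phi> * (?u\<^sup>2 * Re (snd w) + \<epsilon> * (Re (snd w) * ?r + ?u * (2 * (?z \<bullet> fst w))))"
      for w :: "(complex ^ 'n) \<times> complex"
    define \<zeta>2 where "\<zeta>2 w = 2 * \<phi>1 * (?z \<bullet> fst w) + (- 2 * ?r * \<phi>1 - 2 * \<phi>) * conormal p w" for w
    define \<zeta>3 where "\<zeta>3 w = 2 * \<phi> * ?u * Re (snd w)" for w :: "(complex ^ 'n) \<times> complex"
    have lin: "linear \<zeta>1" "linear \<zeta>2" "linear \<zeta>3"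
      unfolding \<zeta>1_def \<zeta>2_def \<zeta>3_def
      by (rule linearI; simp add: linear_add[OF conormal_linear] linear_scale[OF conormal_linear]
          inner_simps algebra_simps)+
    let ?e0 = "(0, 1) :: (complex ^ 'n) \<times> complex" and ?z0 = "(?z, 0) :: (complex ^ 'n) \<times> complex"
    have slice: "?e0 \<in> real_slice" "?z0 \<in> real_slice" by (simp_all add: real_slice_def)
    have Lw: "L w = (\<phi> * ?u\<^sup>2) *\<^sub>R w + \<zeta>1 w *\<^sub>R ?e0 + \<zeta>2 w *\<^sub>R ?Y + \<zeta>3 w *\<^sub>R ?z0" if "w \<in> real_slice" for w
      using that unfolding L_def CY G_def \<zeta>1_def \<zeta>2_def \<zeta>3_def real_slice_def
      by (simp add: prod_eq_iff complex_eq_iff algebra_simps)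
    have "(\<Sum>i<1 + ?n. L (darboux_frame i) \<bullet> darboux_frame i) =
        (\<Sum>i<1 + ?n. \<phi> * ?u\<^sup>2 + \<zeta>1 (darboux_frame i) * (?e0 \<bullet> darboux_frame i) +
          \<zeta>2 (darboux_frame i) * (?Y \<bullet> darboux_frame i) + \<zeta>3 (darboux_frame i) * (?z0 \<bullet> darboux_frame i))"
      by (simp only: Lw[OF darboux_frame_in] inner_add_left inner_scaleR_left darboux_frame_unit mult_1_right)
    also have "\<dots> = real (1 + ?n) * (\<phi> * ?u\<^sup>2) + \<zeta>1 ?e0 + \<zeta>2 ?Y + \<zeta>3 ?z0"
      unfolding sum.distrib trace_rank_one[OF lin(1) slice(1)] trace_rank_one[OF lin(2) radial_vector_slice]
        trace_rank_one[OF lin(3) slice(2)] by simp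
    also have "\<dots> = \<phi> * (2 * real CARD('n) * ?u\<^sup>2 - \<epsilon> * ?r) + 2 * \<phi>1 * ?u\<^sup>2 * ?r"
      by (simp add: \<zeta>1_def \<zeta>2_def \<zeta>3_def conormal_radial_vector)
        (simp add: radial_vector_def rho_def algebra_simps)
    finally show ?thesis .
  qed
  \<comment> \<open>The first summand stems from the factor |z| of \<mu>, the bracket is the trace
    of L.\<close>
  define t where "t = \<phi> * ?u\<^sup>2 + (\<phi> * (2 * real CARD('n) * ?u\<^sup>2 - \<epsilon> * ?r) + 2 * \<phi>1 * ?u\<^sup>2 * ?r)"
  have lie: "lie_derivative ?n ?R X ?\<mu> p v = t * ?\<mu> p v" if v: "\<And>i. i < ?n \<Longrightarrow> v i \<in> ?T" for v
  proof -
    have ev: "emb (v i) \<in> real_slice" "conormal p (emb (v i)) = 0" if "i < ?n" for i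
      using v[OF that] tangent_S'[OF p'(1)] by auto
    \<comment> \<open>The correction by C is invisible on tangent vectors, where the conormal is 0.
      On the position it has weight 1 and turns the value of G into the velocity of the position,
      which is X p.\<close>
    have Lv: "L (emb (v i)) = G (emb (v i))" if "i < ?n" for i using ev[OF that] by (simp add: L_def)
    have Lp: "L (pt p) = \<phi> *\<^sub>R ?Y" using conormal_pt[OF p'(1)] by (simp add: L_def C_def)
    let ?V = "\<lambda>x. slice_volume a b x (\<lambda>i. emb (v i))"
    have "((\<lambda>q. K * (norm (zc q) * ?V (pt q))) has_derivative
        (\<lambda>w. K * (norm ?z * ?V (emb w) + (fst (emb w) \<bullet> sgn ?z) * ?V (pt p)))) (at p within ?R)"
      by (intro has_derivative_mult_right has_derivative_mult
          has_derivative_compose[OF zc_has_derivative has_derivative_norm[OF p'(2)]]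
          bounded_linear.has_derivative[OF slice_volume_linear] pt_has_derivative)
    then have "((\<lambda>q. ?\<mu> q v) has_derivative
        (\<lambda>w. K * (norm ?z * ?V (emb w) + (fst (emb w) \<bullet> sgn ?z) * ?V (pt p)))) (at p within ?R)"
    proof (rule has_derivative_transform_eventually)
      have eq: "K * (norm (zc q) * ?V (pt q)) = ?\<mu> q v" if "q \<in> U" "q \<in> ?R" for q
        using \<mu>[OF that(2,1)] ev by (simp add: frame_volume_def)
      show "\<forall>\<^sub>F q in at p within ?R. K * (norm (zc q) * ?V (pt q)) = ?\<mu> q v"
        unfolding eventually_at_topological using U eq by blast
      show "K * (norm ?z * ?V (pt p)) = ?\<mu> p v" by (rule eq[OF U(2) p])
    qed (rule p)
    then have "deriv_along ?R p (X p) (\<lambda>q. ?\<mu> q v) =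
        K * (norm ?z * ?V (emb (X p)) + (fst (emb (X p)) \<bullet> sgn ?z) * ?V (pt p))"
      by (rule deriv_along_eq) (use XT tangent_regular[OF p] in simp)
    also have "fst (emb (X p)) \<bullet> sgn ?z = \<phi> * ?u\<^sup>2 * norm ?z"
      using p'(2) unfolding embX
      by (simp add: radial_vector_def sgn_div_norm power2_norm_eq_inner[symmetric] power2_eq_square field_simps)
    finally have D1: "deriv_along ?R p (X p) (\<lambda>q. ?\<mu> q v) =
        K * norm ?z * (?V (L (pt p)) + \<phi> * ?u\<^sup>2 * ?V (pt p))"
      unfolding embX Lp by (simp add: algebra_simps)
    let ?\<beta> = "\<lambda>w :: nat \<Rightarrow> (complex ^ 'n) \<times> complex. slice_volume a b (w 0) (\<lambda>i. w (Suc i))"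
    let ?w = "case_nat (pt p) (\<lambda>i. emb (v i))"
    have D2: "?\<mu> p (v(i := deriv_along ?R p (v i) X)) = K * norm ?z * ?\<beta> (?w(Suc i := L (?w (Suc i))))"
      if i: "i < ?n" for i
    proof -
      have "deriv_along ?R p (v i) X = prj (G (emb (v i)))"
        by (rule deriv_along_eq[OF derX]) (use v[OF i] tangent_regular[OF p] in simp)
      then have "emb ((v(i := deriv_along ?R p (v i) X)) j) = (?w(Suc i := L (?w (Suc i)))) (Suc j)" for j
        using Lv[OF i] by (simp add: embG)
      moreover from this have "emb ((v(i := deriv_along ?R p (v i) X)) j) \<in> real_slice" if "j < ?n" for j
        using ev(1)[OF that] L_slice by simp
      ultimately show ?thesis
        by (subst \<mu>[OF p U(2)]) (simp_all only: frame_volume_def, simp)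
    qed
    have "lie_derivative ?n ?R X ?\<mu> p v = K * norm ?z * (\<phi> * ?u\<^sup>2 * ?V (pt p)) +
        K * norm ?z * (?\<beta> (?w(0 := L (?w 0))) + (\<Sum>i<?n. ?\<beta> (?w(Suc i := L (?w (Suc i))))))"
      unfolding lie_derivative_def D1 by (simp add: D2 algebra_simps sum_distrib_left)
    \<comment> \<open>Slot 0 holds the moving position and the other 2n slots hold the vectors v;
      together they form the derivation by L of a top-degree form on
      \<open>real_slice\<close>.\<close>
    also have "?\<beta> (?w(0 := L (?w 0))) + (\<Sum>i<?n. ?\<beta> (?w(Suc i := L (?w (Suc i))))) =
        (\<Sum>i<1 + ?n. ?\<beta> (?w(i := L (?w i))))"
      unfolding plus_1_eq_Suc by (rule sum.lessThan_Suc_shift[symmetric])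
    also have "\<dots> = (\<Sum>i<1 + ?n. L (darboux_frame i) \<bullet> darboux_frame i) * ?\<beta> ?w"
      by (rule alternating_form_trace[OF alternating_form_mono[OF alternating_form_slice_volume subset_UNIV]
            subspace_real_slice L L_slice darboux_frame_in darboux_frame_expansion])
        (use ev pt_slice[OF p'(1)] in \<open>auto split: nat.splits\<close>)
    also have "?\<beta> ?w = ?V (pt p)" by simp
    finally show ?thesis
      unfolding trace using \<mu>[OF p U(2), of v] ev
      by (simp add: t_def frame_volume_def algebra_simps)
  qed
  obtain e where e: "\<And>i. e i \<in> ?T" "frame_volume p e \<noteq> 0" using tangent_frame[OF p'(1)] by metis
  \<comment> \<open>A frame of nonzero volume makes the factor described by
    \<open>divergence\<close> unique.\<close>
  have "?\<mu> p e \<noteq> 0"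
    using \<mu>[OF p U(2), of e] e K p'(2) tangent_S'[OF p'(1)] by auto
  have "divergence ?n ?R ?\<mu> X p = t"
    unfolding divergence_def tangent_regular[OF p]
  proof (rule the_equality)
    show "\<forall>v. (\<forall>i<?n. v i \<in> ?T) \<longrightarrow> lie_derivative ?n ?R X ?\<mu> p v = t * ?\<mu> p v"
      using lie by blast
    show "c = t" if "\<forall>v. (\<forall>i<?n. v i \<in> ?T) \<longrightarrow> lie_derivative ?n ?R X ?\<mu> p v = c * ?\<mu> p v" for c
      using that[rule_format, of e] lie[of e] e(1) \<open>?\<mu> p e \<noteq> 0\<close> by simp
  qed
  then show ?thesis
    unfolding sub_laplacian_def chalf X_def[symmetric] t_def \<phi>_def \<phi>1_def by (simp add: algebra_simps)
qed

end

section \<open>A Lyapunov function\<close>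

text \<open>The singular terms are 2 w / r from the second derivative and - (2n + 1) w / r from the
  first, and the latter dominates. As w \<le> 1 + r, the other terms contribute at most 4n + 2, 2
  and 1.\<close>

lemma lyapunov_bound:
  fixes r w \<epsilon> n :: real
  assumes r: "r > 0" and w: "w = 1 - \<epsilon> * r" "w \<ge> 0" and \<epsilon>: "\<bar>\<epsilon>\<bar> \<le> 1" and n: "n \<ge> 1"
  shows "2 * r * w * (1 / r\<^sup>2 - 2 / (1 + r)\<^sup>2) + ((2 * n + 1) * w - \<epsilon> * r) * (2 / (1 + r) - 1 / r) \<le> 4 * n + 5"
proof -
  have *: "P - Q + (R - P' - 2 * Z + \<epsilon>) \<le> 4 * n + 5"
    if "P \<le> P'" "0 \<le> Q" "R \<le> (4 * n + 2) * 1" "- Z \<le> 1 * 1" for P P' Q R Z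
    using that abs_le_D1[OF \<epsilon>] by simp
  have 1: "2 * r * w * (1 / r\<^sup>2 - 2 / (1 + r)\<^sup>2) = 2 * (w / r) - 4 * r * w / (1 + r)\<^sup>2"
    using r by (simp add: power2_eq_square right_diff_distrib)
  have 2: "((2 * n + 1) * w - \<epsilon> * r) * (2 / (1 + r) - 1 / r) =
      (4 * n + 2) * (w / (1 + r)) - (2 * n + 1) * (w / r) - 2 * (\<epsilon> * (r / (1 + r))) + \<epsilon>"
    using r by (simp add: algebra_simps)
  show ?thesis
    unfolding 1 2
  proof (rule *)
    show "2 * (w / r) \<le> (2 * n + 1) * (w / r)"
      using n r w(2) by (intro mult_right_mono) auto
    show "0 \<le> 4 * r * w / (1 + r)\<^sup>2" using r w(2) by simp
    show "(4 * n + 2) * (w / (1 + r)) \<le> (4 * n + 2) * 1"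
    proof (rule mult_left_mono)
      have "- \<epsilon> * r \<le> 1 * r" using \<epsilon> r by (intro mult_right_mono) auto
      then show "w / (1 + r) \<le> 1" using r w(1) by simp
    qed (use n in simp)
    show "- (\<epsilon> * (r / (1 + r))) \<le> 1 * 1"
      unfolding minus_mult_left using r \<epsilon> by (intro mult_mono) auto
  qed
qed

section \<open>Test functions and the lower bound on the generator\<close>

context model_hypersurface
begin

lemma Ck_on_rho: "Ck_on k rho UNIV"
proof -
  have 1: "Ck_on k (\<lambda>q. zc q \<bullet> c) UNIV" for c
  proof -
    have "bounded_linear (\<lambda>q. fst (emb q) \<bullet> c)"
      by (intro bounded_linear_inner_left_comp bounded_linear_fst_comp emb)
    then have "Ck_on k (\<lambda>q. fst off \<bullet> c + fst (emb q) \<bullet> c) UNIV"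
      by (intro Ck_on_add Ck_on_const Ck_on_linear) auto
    then show ?thesis by (simp add: zc_def pt_def inner_add_left)
  qed
  have "Ck_on k (\<lambda>q. \<Sum>c\<in>A. (zc q \<bullet> c) * (zc q \<bullet> c)) UNIV" if "finite A" for A
    using that
  proof (induction A rule: finite_induct)
    case empty
    show ?case by (simp add: Ck_on_const)
  next
    case (insert x A)
    then show ?case by (simp add: Ck_on_add Ck_on_mult 1)
  qed
  from this[OF finite_Basis] show ?thesis
    unfolding rho_def by (subst euclidean_inner)
qed

lemma Ck_on_subset: "V \<subseteq> U \<Longrightarrow> Ck_on k f U \<Longrightarrow> Ck_on k f V"
  by (induction k arbitrary: f) (auto intro: continuous_on_subset)

definition lyapunov :: "real \<Rightarrow> real" where
  "lyapunov r = 2 * ln (1 + r) - ln r"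

lemma lyapunov_nonneg:
  assumes "r > 0" shows "lyapunov r \<ge> 0"
proof -
  have "r \<le> (1 + r)\<^sup>2" using assms by (simp add: power2_eq_square algebra_simps)
  then have "ln r \<le> ln ((1 + r)\<^sup>2)" using assms by simp
  then show ?thesis using assms by (simp add: lyapunov_def ln_realpow)
qed

lemma lyapunov_large:
  assumes "r > 0" "c > 0" "r < exp (- c) \<or> exp c < r"
  shows "c \<le> lyapunov r"
  using assms(3)
proof
  assume "r < exp (- c)"
  then have "ln r < - c" using assms by (metis ln_exp ln_less_cancel_iff exp_gt_zero)
  moreover have "0 \<le> ln (1 + r)" using assms by simp
  ultimately show ?thesis by (simp add: lyapunov_def)
next
  assume "exp c < r"
  then have "c < ln r" using assms by (metis ln_exp ln_less_cancel_iff exp_gt_zero)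
  moreover have "ln r \<le> ln (1 + r)" using assms by simp
  ultimately show ?thesis by (simp add: lyapunov_def)
qed

lemma lyapunov_has_derivatives:
  assumes "r > 0"
  shows "(lyapunov has_real_derivative 2 / (1 + r) - 1 / r) (at r)"
    "((\<lambda>r. 2 / (1 + r) - 1 / r) has_real_derivative 1 / r\<^sup>2 - 2 / (1 + r)\<^sup>2) (at r)"
  using assms unfolding lyapunov_def
  by (auto intro!: derivative_eq_intros simp: power2_eq_square)

text \<open>The function vanishes outside the shell exp(- c) \<le> \<rho> \<le> exp c of S, which is
  closed and bounded and stays away from the characteristic points.\<close>

lemma test_function_lyapunov:
  assumes \<eta>: "smooth_real \<eta> UNIV" "\<And>s. 1 \<le> s \<Longrightarrow> \<eta> s = 0" and c: "c > 0"
  shows "test_function (regular_part M S) (\<lambda>p. \<eta> (lyapunov (rho p) / c))"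
  unfolding test_function_def
proof
  let ?f = "\<lambda>p. \<eta> (lyapunov (rho p) / c)"
  let ?U = "{q. zc q \<noteq> 0}"
  have pos: "rho q > 0" if "q \<in> ?U" for q using that by (simp add: rho_def)
  have rho: "Ck_on k rho ?U" for k by (rule Ck_on_subset[OF subset_UNIV Ck_on_rho])
  have "Ck_on k (\<lambda>p. ln (rho p)) ?U" for k
    by (rule Ck_on_compose_smooth[OF open_regular smooth_real_ln rho]) (use pos in auto)
  moreover have "Ck_on k (\<lambda>p. ln (1 + rho p)) ?U" for k
    by (rule Ck_on_compose_smooth[OF open_regular smooth_real_ln Ck_on_add[OF open_regular Ck_on_const rho]])
      (use pos in \<open>auto intro: add_pos_pos\<close>)
  ultimately have "Ck_on k (\<lambda>p. 1 / c * (2 * ln (1 + rho p) + - 1 * ln (rho p))) ?U" for k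
    by (intro Ck_on_mult[OF open_regular] Ck_on_add[OF open_regular] Ck_on_const)
  then have "Ck_on k (\<lambda>p. lyapunov (rho p) / c) ?U" for k by (simp add: lyapunov_def)
  from Ck_on_compose_smooth[OF open_regular \<eta>(1) this] have "Ck_on k ?f ?U" for k by simp
  then show "smooth_on_submanifold (regular_part M S) ?f"
    unfolding smooth_on_submanifold_def
    by (intro ballI exI[of _ ?U] exI[of _ ?f]) (auto simp: open_regular regularD)
  define K where "K = S \<inter> {p. exp (- c) \<le> rho p} \<inter> {p. rho p \<le> exp c}"
  have cont: "continuous_on UNIV rho"
    unfolding rho_def zc_def by (intro continuous_intros continuous_pt)
  have "closed K"
    unfolding K_def by (intro closed_Int closed_S closed_Collect_le cont continuous_intros)
  moreover have "bounded K"
  proof -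
    \<comment> \<open>The squared norm of the position is \<rho> + u^2, and u^2 = 1 - \<epsilon>
      \<rho> \<le> 1 + \<rho> on S, while \<rho> \<le> exp c on K.\<close>
    let ?D = "sqrt (exp c + (1 + exp c))"
    have "K \<subseteq> (\<lambda>w. prj (w - off)) ` cball 0 ?D"
    proof
      fix p assume "p \<in> K"
      then have p: "p \<in> S" and r: "rho p \<le> exp c" "0 \<le> rho p"
        unfolding K_def rho_def by auto
      have "- \<epsilon> * rho p \<le> 1 * rho p" using eps r by (intro mult_right_mono) auto
      then have "(uc p)\<^sup>2 \<le> 1 + exp c" using quadric[OF p] r by simp
      moreover have "(norm (pt p))\<^sup>2 = rho p + (uc p)\<^sup>2"
        unfolding power2_norm_eq_inner rho_def zc_def uc_def
        using Im_pt[OF p] by (simp add: inner_prod_def inner_complex_def power2_eq_square)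
      ultimately have "(norm (pt p))\<^sup>2 \<le> exp c + (1 + exp c)" using r by simp
      then have "norm (pt p) \<le> ?D" by (rule real_le_rsqrt)
      moreover have "p = prj (pt p - off)" by (simp add: pt_def prj_emb)
      ultimately show "p \<in> (\<lambda>w. prj (w - off)) ` cball 0 ?D" by (intro image_eqI[of _ _ "pt p"]) auto
    qed
    moreover have "compact ((\<lambda>w. prj (w - off)) ` cball 0 ?D)"
      by (intro compact_continuous_image bounded_linear.continuous_on[OF prj] continuous_intros compact_cball)
    ultimately show ?thesis using bounded_subset compact_imp_bounded by blast
  qed
  ultimately have "compact K" by (simp add: compact_eq_bounded_closed)
  moreover have "K \<subseteq> regular_part M S"
  proof
    fix p assume "p \<in> K"
    then have "p \<in> S" "rho p > 0" unfolding K_def using less_le_trans[OF exp_gt_zero] by auto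
    then show "p \<in> regular_part M S" by (auto simp: regular_part_eq rho_def)
  qed
  moreover have "?f p = 0" if "p \<in> regular_part M S - K" for p
  proof (rule \<eta>(2))
    have "p \<in> S" "rho p > 0" using that regularD by auto
    then have "c \<le> lyapunov (rho p)" using that c by (intro lyapunov_large) (auto simp: K_def)
    then show "1 \<le> lyapunov (rho p) / c" using c by simp
  qed
  ultimately show "\<exists>K. compact K \<and> K \<subseteq> regular_part M S \<and> (\<forall>p\<in>regular_part M S - K. ?f p = 0)" by blast
qed

lemma sub_laplacian_stochastically_complete:
  assumes \<sigma>: "orientation_form (2 * CARD('n)) S \<sigma>"
  shows "stochastically_complete TYPE('w) (regular_part M S) (sub_laplacian M S \<sigma>)"
proof (rule stochastically_completeI)
  fix x and e :: real assume x: "x \<in> regular_part M S" and e: "e > 0"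
  obtain \<eta> \<eta>1 \<eta>2 :: "real \<Rightarrow> real" and C where smooth: "smooth_real \<eta> UNIV"
    and d1: "\<And>s. (\<eta> has_real_derivative \<eta>1 s) (at s)" and d2: "\<And>s. (\<eta>1 has_real_derivative \<eta>2 s) (at s)"
    and \<eta>: "\<eta> 0 = 1" "\<And>s. 0 \<le> s \<Longrightarrow> \<eta> s \<le> 1" "\<And>s. 1 \<le> s \<Longrightarrow> \<eta> s = 0"
    and \<eta>1: "\<And>s. - C \<le> \<eta>1 s" "\<And>s. \<eta>1 s \<le> 0" and \<eta>2: "\<And>s. 0 \<le> s \<Longrightarrow> 0 \<le> \<eta>2 s" and C: "C > 0"
    using convex_cutoff by metis
  define B where "B = 4 * real CARD('n) + 5"
  have "((\<lambda>c. \<eta> (lyapunov (rho x) / c)) \<longlongrightarrow> \<eta> 0) at_top"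
    by (intro isCont_tendsto_compose[OF DERIV_isCont[OF d1]] tendsto_divide_0[OF tendsto_const]
        filterlim_at_top_imp_at_infinity filterlim_ident)
  from order_tendstoD(1)[OF this, of "1 - e"]
  have "\<forall>\<^sub>F c in at_top. 1 - e < \<eta> (lyapunov (rho x) / c)" using \<eta>(1) e by simp
  \<comment> \<open>For such c the lower bound - \<kappa> C B / c on the generator is at least -
    e.\<close>
  moreover have "\<forall>\<^sub>F c in at_top. c > \<kappa> * C * B / e \<and> c > (0 :: real)"
    by (intro eventually_conj eventually_gt_at_top)
  ultimately have "\<forall>\<^sub>F c in at_top. 1 - e < \<eta> (lyapunov (rho x) / c) \<and> c > \<kappa> * C * B / e \<and> c > 0"
    by (rule eventually_conj)
  then obtain c where c: "1 - e < \<eta> (lyapunov (rho x) / c)" "c > \<kappa> * C * B / e" "c > 0"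
    using eventually_happens'[OF trivial_limit_at_top_linorder] by blast
  let ?f = "\<lambda>p. \<eta> (lyapunov (rho p) / c)"
  have "- e \<le> sub_laplacian M S \<sigma> ?f p / 2" if p: "p \<in> regular_part M S" for p
  proof -
    note p' = regularD[OF p]
    let ?r = "rho p" and ?w = "(uc p)\<^sup>2"
    let ?V1 = "\<lambda>r. 2 / (1 + r) - 1 / r :: real" and ?V2 = "\<lambda>r. 1 / r\<^sup>2 - 2 / (1 + r)\<^sup>2 :: real"
    let ?s = "lyapunov ?r / c"
    have D1: "((\<lambda>r. lyapunov r / c) has_real_derivative ?V1 r / c) (at r)" if "r > 0" for r
      by (rule DERIV_cdivide[OF lyapunov_has_derivatives(1)[OF that]])
    have "sub_laplacian M S \<sigma> ?f p = 2 * \<kappa> * (2 * ?r * ?w *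
        (\<eta>2 ?s * (?V1 ?r / c) * (?V1 ?r / c) + ?V2 ?r / c * \<eta>1 ?s) +
        ((2 * real CARD('n) + 1) * ?w - \<epsilon> * ?r) * (\<eta>1 ?s * (?V1 ?r / c)))"
    proof (rule sub_laplacian_radial[OF p \<sigma>])
      fix r :: real assume r: "r > 0"
      show "((\<lambda>r. \<eta> (lyapunov r / c)) has_real_derivative \<eta>1 (lyapunov r / c) * (?V1 r / c)) (at r)"
        by (rule DERIV_chain2[OF d1 D1[OF r]])
      show "((\<lambda>r. \<eta>1 (lyapunov r / c) * (?V1 r / c)) has_real_derivative
          \<eta>2 (lyapunov r / c) * (?V1 r / c) * (?V1 r / c) + ?V2 r / c * \<eta>1 (lyapunov r / c)) (at r)"
        by (rule DERIV_mult[OF DERIV_chain2[OF d2 D1[OF r]] DERIV_cdivide[OF lyapunov_has_derivatives(2)[OF r]]])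
    qed
    \<comment> \<open>Separates the convexity term, \<eta>2 times a square, from \<eta>1 times the
      expression of \<open>lyapunov_bound\<close>. The factor 1/2 of the generator cancels the 2 in
      2 \<kappa>.\<close>
    moreover have "2 * \<kappa> * (2 * r * w * (y2 * (v1 / c) * (v1 / c) + v2 / c * y1) + d * (y1 * (v1 / c))) / 2 =
        \<kappa> * (2 * r * w * (y2 * (v1 / c)\<^sup>2)) + \<kappa> / c * (y1 * (2 * r * w * v2 + d * v1))"
      for r w y1 y2 v1 v2 d
      by (simp add: algebra_simps power2_eq_square)
    ultimately have eq: "sub_laplacian M S \<sigma> ?f p / 2 = \<kappa> * (2 * ?r * ?w * (\<eta>2 ?s * (?V1 ?r / c)\<^sup>2)) +
        \<kappa> / c * (\<eta>1 ?s * (2 * ?r * ?w * ?V2 ?r + ((2 * real CARD('n) + 1) * ?w - \<epsilon> * ?r) * ?V1 ?r))"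
      by (simp only:)
    have s0: "0 \<le> ?s" using lyapunov_nonneg[OF p'(3)] c(3) by simp
    have "2 * ?r * ?w * ?V2 ?r + ((2 * real CARD('n) + 1) * ?w - \<epsilon> * ?r) * ?V1 ?r \<le> B"
      unfolding B_def
    proof (rule lyapunov_bound[OF p'(3)])
      show "?w = 1 - \<epsilon> * ?r" using quadric[OF p'(1)] by simp
      show "1 \<le> real CARD('n)" by (simp add: Suc_leI)
    qed (use eps in auto)
    \<comment> \<open>As \<eta>1 is nonpositive, the upper bound B turns into a lower bound.\<close>
    then have "\<eta>1 ?s * B \<le> \<eta>1 ?s * (2 * ?r * ?w * ?V2 ?r + ((2 * real CARD('n) + 1) * ?w - \<epsilon> * ?r) * ?V1 ?r)"
      using \<eta>1(2) by (rule mult_left_mono_neg)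
    moreover have "- C * B \<le> \<eta>1 ?s * B" using \<eta>1(1) by (rule mult_right_mono) (simp add: B_def)
    ultimately have "- C * B \<le> \<eta>1 ?s * (2 * ?r * ?w * ?V2 ?r + ((2 * real CARD('n) + 1) * ?w - \<epsilon> * ?r) * ?V1 ?r)"
      by linarith
    then have "\<kappa> / c * (- C * B) \<le>
        \<kappa> / c * (\<eta>1 ?s * (2 * ?r * ?w * ?V2 ?r + ((2 * real CARD('n) + 1) * ?w - \<epsilon> * ?r) * ?V1 ?r))"
      using pos c(3) by (intro mult_left_mono) auto
    moreover have "0 \<le> \<kappa> * (2 * ?r * ?w * (\<eta>2 ?s * (?V1 ?r / c)\<^sup>2))"
      using pos p'(3) \<eta>2[OF s0] by simp
    moreover have "\<kappa> / c * (C * B) \<le> e" using c(2,3) e by (simp add: field_simps)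
    ultimately show ?thesis unfolding eq by simp
  qed
  moreover have "?f p \<le> 1" if "p \<in> regular_part M S" for p
    using lyapunov_nonneg[OF regularD(3)[OF that]] c(3) by (intro \<eta>(2)) simp
  ultimately show "\<exists>f. test_function (regular_part M S) f \<and> (\<forall>p\<in>regular_part M S. f p \<le> 1) \<and> 1 - e \<le> f x \<and>
      (\<forall>p\<in>regular_part M S. - e \<le> sub_laplacian M S \<sigma> f p / 2)"
    using test_function_lyapunov[OF smooth \<eta>(3) c(3)] c(1) by (intro exI[of _ ?f]) auto
qed

lemma sub_laplacian_avoids_characteristic_set:
  assumes "orientation_form (2 * CARD('n)) S \<sigma>"
  shows "almost_surely_avoids TYPE('w) (regular_part M S) (sub_laplacian M S \<sigma>) (characteristic_set M S)"
  by (rule stochastically_complete_avoids[OF sub_laplacian_stochastically_complete[OF assms]])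
    (auto simp: regular_part_def)

end

section \<open>The three models\<close>

lemma tangent_space_level:
  fixes F :: "'a::euclidean_space \<Rightarrow> real"
  assumes "(F has_derivative D) (at p)" and "\<And>q. q \<in> S \<Longrightarrow> F q = c" and "v \<in> tangent_space S p"
  shows "D v = 0"
proof -
  obtain \<gamma> e where e: "e > 0" "\<And>t. \<bar>t\<bar> < e \<Longrightarrow> \<gamma> t \<in> S" "\<gamma> 0 = p"
    "(\<gamma> has_vector_derivative v) (at (0::real))"
    using assms(3) unfolding tangent_space_def by blast
  have "((\<lambda>t. F (\<gamma> t)) has_vector_derivative D v) (at 0)"
    by (rule has_derivative_along_tangent[OF has_derivative_at_withinI[OF assms(1)] e])
  moreover have "((\<lambda>t. F (\<gamma> t)) has_vector_derivative 0) (at 0)"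
  proof (rule has_vector_derivative_transform_within_open[of "\<lambda>_. c" _ _ "{- e<..<e}"])
    show "c = F (\<gamma> t)" if "t \<in> {- e<..<e}" for t using that e(2)[of t] assms(2) by auto
  qed (use e(1) in auto)
  ultimately show ?thesis by (rule vector_derivative_unique_at)
qed

text \<open>The line p + t v is rescaled back onto the quadric: as B p v = 0, its B-square is c (1 +
  d t^2) with d = B v v / c. The set W carries side conditions that survive positive scaling, such
  as the real slice and u > 0.\<close>

lemma tangent_space_quadric:
  fixes B :: "'a::euclidean_space \<Rightarrow> 'a \<Rightarrow> real"
  assumes B: "bilinear B" and sym: "\<And>x y. B x y = B y x" and p: "B p p = c" "c \<noteq> 0" and v: "B p v = 0"
    and e: "e > 0" "\<And>s t. s > 0 \<Longrightarrow> \<bar>t\<bar> < e \<Longrightarrow> s *\<^sub>R (p + t *\<^sub>R v) \<in> W"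
  shows "v \<in> tangent_space ({q. B q q = c} \<inter> W) p"
proof -
  define d where "d = B v v / c"
  define \<gamma> where "\<gamma> t = (1 / sqrt (1 + d * t\<^sup>2)) *\<^sub>R (p + t *\<^sub>R v)" for t
  \<comment> \<open>The second bound keeps |d| t^2 below 1, so that the argument of the square root
    stays positive.\<close>
  define r where "r = min e (1 / (1 + \<bar>d\<bar>))"
  have r: "r > 0" using e by (simp add: r_def)
  have pos: "1 + d * t\<^sup>2 > 0" if t: "\<bar>t\<bar> < r" for t
  proof -
    have t1: "\<bar>t\<bar> < 1 / (1 + \<bar>d\<bar>)" using t by (simp add: r_def)
    then have "\<bar>t\<bar> * (1 + \<bar>d\<bar>) < 1" by (simp add: pos_less_divide_eq)
    moreover have "\<bar>t\<bar> \<le> 1" using t1 by (smt (verit) divide_le_eq_1)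
    then have "t\<^sup>2 \<le> \<bar>t\<bar>" by (metis abs_ge_zero mult_left_le power2_abs power2_eq_square)
    then have "\<bar>d\<bar> * t\<^sup>2 \<le> \<bar>t\<bar> * (1 + \<bar>d\<bar>)"
      by (smt (verit) abs_ge_zero mult_left_mono mult.commute)
    ultimately have "\<bar>d * t\<^sup>2\<bar> < 1" by (simp add: abs_mult)
    then show ?thesis by linarith
  qed
  have "\<gamma> t \<in> {q. B q q = c} \<inter> W" if t: "\<bar>t\<bar> < r" for t
  proof
    note bil = bilinear_ladd[OF B] bilinear_radd[OF B] bilinear_lmul[OF B] bilinear_rmul[OF B]
    have "B (p + t *\<^sub>R v) (p + t *\<^sub>R v) = c + t\<^sup>2 * B v v"
      using v sym[of v p] p(1) by (simp add: bil power2_eq_square)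
    also have "\<dots> = c * (1 + d * t\<^sup>2)" using p(2) by (simp add: d_def field_simps)
    finally have "B (\<gamma> t) (\<gamma> t) = (1 / sqrt (1 + d * t\<^sup>2))\<^sup>2 * (c * (1 + d * t\<^sup>2))"
      unfolding \<gamma>_def bilinear_lmul[OF B] bilinear_rmul[OF B] by (simp add: power2_eq_square)
    also have "\<dots> = c" using pos[OF t] by (simp add: power_divide)
    finally show "\<gamma> t \<in> {q. B q q = c}" by simp
    show "\<gamma> t \<in> W" unfolding \<gamma>_def by (rule e(2)) (use pos[OF t] t in \<open>auto simp: r_def\<close>)
  qed
  moreover have "(\<gamma> has_vector_derivative v) (at 0)"
  proof -
    have "((\<lambda>t. 1 / sqrt (1 + d * t\<^sup>2)) has_real_derivative 0) (at 0)"
      by (auto intro!: derivative_eq_intros)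
    moreover have "((\<lambda>t. p + t *\<^sub>R v) has_vector_derivative v) (at 0)"
      by (auto intro!: derivative_eq_intros)
    ultimately have "((\<lambda>t. (1 / sqrt (1 + d * t\<^sup>2)) *\<^sub>R (p + t *\<^sub>R v)) has_vector_derivative
        (1 / sqrt (1 + d * 0\<^sup>2)) *\<^sub>R v + 0 *\<^sub>R (p + 0 *\<^sub>R v)) (at 0)"
      by (rule has_vector_derivative_scaleR)
    then show ?thesis by (simp add: \<gamma>_def[abs_def])
  qed
  moreover have "\<gamma> 0 = p" by (simp add: \<gamma>_def)
  ultimately show ?thesis unfolding tangent_space_def using r by blast
qed

lemma tangent_space_quadric_level:
  fixes B :: "'a::euclidean_space \<Rightarrow> 'a \<Rightarrow> real"
  assumes B: "bilinear B" and sym: "\<And>x y. B x y = B y x" and "S \<subseteq> {q. B q q = c}"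
    and v: "v \<in> tangent_space S p"
  shows "B p v = 0"
proof -
  have "bounded_bilinear B" using B by (simp add: bilinear_conv_bounded_bilinear)
  from bounded_bilinear.FDERIV[OF this has_derivative_ident has_derivative_ident]
  have "((\<lambda>q. B q q) has_derivative (\<lambda>v. B p v + B v p)) (at p)" .
  from tangent_space_level[OF this _ v, of c] assms(3) have "B p v + B v p = 0" by blast
  then show ?thesis using sym[of v p] by simp
qed

lemma tangent_space_real_slice:
  fixes S :: "((complex ^ 'n::finite) \<times> complex) set"
  assumes "S \<subseteq> real_slice" "v \<in> tangent_space S p"
  shows "v \<in> real_slice"
proof -
  have "((\<lambda>q :: (complex ^ 'n) \<times> complex. Im (snd q)) has_derivative (\<lambda>v. Im (snd v))) (at p)"
    by (intro bounded_linear_imp_has_derivative bounded_linear_compose[OF bounded_linear_Im bounded_linear_snd])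
  from tangent_space_level[OF this _ assms(2), of 0] assms(1) show ?thesis
    by (auto simp: real_slice_def)
qed

lemma bilinear_inner: "bilinear ((\<bullet>) :: 'a::euclidean_space \<Rightarrow> 'a \<Rightarrow> real)"
  by (simp add: bilinear_conv_bounded_bilinear bounded_bilinear_inner)

lemma bilinear_ads_product: "bilinear ads_product"
  unfolding bilinear_def by (auto intro!: linearI simp: ads_product_def inner_simps algebra_simps)

lemma ads_product_sym: "ads_product x y = ads_product y x"
  by (simp add: ads_product_def inner_commute)

text \<open>The last coordinate s is placed as 1 - \<i> s. Paired with a velocity - \<i> s' the area
  form gives - s', so the weights 1/2 and 1 reproduce the Heisenberg contact form, and the quadric
  degenerates to the hyperplane u = 1.\<close>

lemma model_heisenberg:
  "model_hypersurface (heisenberg :: ((complex ^ 'n::finite) \<times> real) contact_space) heisenberg_hypersurface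
     (\<lambda>v. (fst v, Complex 0 (- snd v))) (\<lambda>w. (fst w, - Im (snd w))) (0, 1) 0 1 (1 / 2) 1"
proof (rule model_hypersurface.intro)
  let ?S = "heisenberg_hypersurface :: ((complex ^ 'n) \<times> real) set"
  show "chalf (heisenberg :: ((complex ^ 'n) \<times> real) contact_space) = CARD('n)"
    by (simp add: heisenberg_def)
  have "linear (\<lambda>v :: (complex ^ 'n) \<times> real. (fst v, Complex 0 (- snd v)))"
    by (rule linearI) (auto simp: complex_eq_iff)
  then show "bounded_linear (\<lambda>v :: (complex ^ 'n) \<times> real. (fst v, Complex 0 (- snd v)))"
    by (simp add: linear_conv_bounded_linear)
  have "linear (\<lambda>w :: (complex ^ 'n) \<times> complex. (fst w, - Im (snd w)))"
    by (rule linearI) auto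
  then show "bounded_linear (\<lambda>w :: (complex ^ 'n) \<times> complex. (fst w, - Im (snd w)))"
    by (simp add: linear_conv_bounded_linear)
  have UNIV: "tangent_space UNIV p = UNIV" for p :: "(complex ^ 'n) \<times> real"
  proof -
    have "v \<in> tangent_space UNIV p" for v
      unfolding tangent_space_def
      by (intro CollectI exI[of _ "\<lambda>t. p + t *\<^sub>R v"] exI[of _ 1]) (auto intro!: derivative_eq_intros)
    then show ?thesis by auto
  qed
  have S: "tangent_space ?S p = {v. snd v = 0}" if p: "p \<in> ?S" for p
  proof (intro equalityI subsetI)
    fix v assume v: "v \<in> tangent_space ?S p"
    have "(snd has_derivative snd) (at p)" by (intro bounded_linear_imp_has_derivative bounded_linear_snd)
    from tangent_space_level[OF this _ v, of 0] show "v \<in> {v. snd v = 0}"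
      by (simp add: heisenberg_hypersurface_def)
  next
    fix v :: "(complex ^ 'n) \<times> real" assume "v \<in> {v. snd v = 0}"
    then show "v \<in> tangent_space ?S p"
      unfolding tangent_space_def using p
      by (intro CollectI exI[of _ "\<lambda>t. p + t *\<^sub>R v"] exI[of _ 1])
        (auto simp: heisenberg_hypersurface_def intro!: derivative_eq_intros)
  qed
  fix p :: "(complex ^ 'n) \<times> real" assume p: "p \<in> ?S"
  show "tangent_space ?S p = {v. (fst v, Complex 0 (- snd v)) \<in> real_slice \<and>
      0 * (fst ((0, 1) + (fst p, Complex 0 (- snd p))) \<bullet> fst (fst v, Complex 0 (- snd v))) +
      Re (snd ((0, 1) + (fst p, Complex 0 (- snd p)))) * Re (snd (fst v, Complex 0 (- snd v))) = 0}"
    unfolding S[OF p] by (simp add: real_slice_def)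
  show "tangent_space (cmanifold heisenberg) p = {v.
      0 * (fst ((0, 1) + (fst p, Complex 0 (- snd p))) \<bullet> fst (fst v, Complex 0 (- snd v))) +
      Re (snd ((0, 1) + (fst p, Complex 0 (- snd p)))) * Re (snd (fst v, Complex 0 (- snd v))) = 0}"
    by (simp add: heisenberg_def UNIV)
qed (auto simp: heisenberg_def heisenberg_hypersurface_def symplectic_def inner_cvec_i area_form_def
    real_slice_def complex_eq_iff intro!: closed_Collect_eq continuous_intros)

lemma model_sphere:
  assumes k: "k > 0"
  shows "model_hypersurface (sphere_contact k :: ((complex ^ 'n::finite) \<times> complex) contact_space)
     sphere_hypersurface (\<lambda>v. v) (\<lambda>w. w) 0 1 (k\<^sup>2) (1 / (2 * k\<^sup>2)) (1 / (2 * k\<^sup>2))"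
proof (rule model_hypersurface.intro)
  let ?S = "sphere_hypersurface :: ((complex ^ 'n) \<times> complex) set"
  have S: "?S = {q. q \<bullet> q = 1} \<inter> real_slice" by (auto simp: sphere_hypersurface_def real_slice_def)
  have pv: "fst p \<bullet> fst v + Re (snd p) * Re (snd v) = p \<bullet> v" if "p \<in> ?S" for p v
    using that by (simp add: sphere_hypersurface_def inner_prod_def inner_complex_def)
  show "closed ?S"
    unfolding S real_slice_def by (intro closed_Int closed_Collect_eq continuous_intros)
  fix p assume p: "p \<in> ?S"
  then have p1: "p \<bullet> p = 1" "p \<in> real_slice" by (auto simp: S)
  have "tangent_space ?S p = {v. v \<in> real_slice \<and> p \<bullet> v = 0}"
  proof (intro equalityI subsetI)
    fix v assume v: "v \<in> tangent_space ?S p"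
    then show "v \<in> {v. v \<in> real_slice \<and> p \<bullet> v = 0}"
      using tangent_space_real_slice[OF _ v] tangent_space_quadric_level[OF bilinear_inner inner_commute _ v, of 1]
      by (simp add: S)
  next
    fix v assume v: "v \<in> {v. v \<in> real_slice \<and> p \<bullet> v = 0}"
    then show "v \<in> tangent_space ?S p"
      unfolding S using p1
      by (intro tangent_space_quadric[OF bilinear_inner inner_commute p1(1), of _ 1])
        (auto simp: real_slice_def)
  qed
  then show "tangent_space ?S p = {v. v \<in> real_slice \<and>
      1 * (fst (0 + p) \<bullet> fst v) + Re (snd (0 + p)) * Re (snd v) = 0}"
    using pv[OF p] by simp
  have "tangent_space {q. q \<bullet> q = 1} p = {v. p \<bullet> v = 0}"
  proof (intro equalityI subsetI)
    fix v assume v: "v \<in> tangent_space {q. q \<bullet> q = 1} p"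
    then show "v \<in> {v. p \<bullet> v = 0}"
      using tangent_space_quadric_level[OF bilinear_inner inner_commute _ v, of 1] by simp
  next
    fix v assume "v \<in> {v. p \<bullet> v = 0}"
    then show "v \<in> tangent_space {q. q \<bullet> q = 1} p"
      using tangent_space_quadric[OF bilinear_inner inner_commute p1(1), of v 1 UNIV] by simp
  qed
  then show "tangent_space (cmanifold (sphere_contact k)) p = {v.
      1 * (fst (0 + p) \<bullet> fst v) + Re (snd (0 + p)) * Re (snd v) = 0}"
    using pv[OF p] by (simp add: sphere_contact_def)
  show "1 * (fst (0 + p) \<bullet> fst (0 + p)) + (Re (snd (0 + p)))\<^sup>2 = 1"
    using pv[OF p, of p] p1 by (simp add: power2_eq_square)
qed (use k in \<open>auto simp: sphere_contact_def sphere_hypersurface_def symplectic_def inner_cvec_i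
    real_slice_def inner_prod_def distrib_left add_divide_distrib\<close>)

lemma model_anti_de_sitter:
  assumes k: "k > 0"
  shows "model_hypersurface (anti_de_sitter k :: ((complex ^ 'n::finite) \<times> complex) contact_space)
     anti_de_sitter_hypersurface (\<lambda>v. v) (\<lambda>w. w) 0 (- 1) (k\<^sup>2) (1 / (2 * k\<^sup>2)) (1 / (2 * k\<^sup>2))"
proof (rule model_hypersurface.intro)
  let ?S = "anti_de_sitter_hypersurface :: ((complex ^ 'n) \<times> complex) set"
  let ?W = "real_slice \<inter> {q. Re (snd q) > 0} :: ((complex ^ 'n) \<times> complex) set"
  have S: "?S = {q. ads_product q q = - 1} \<inter> ?W"
    by (auto simp: anti_de_sitter_hypersurface_def real_slice_def)
  have pv: "- 1 * (fst p \<bullet> fst v) + Re (snd p) * Re (snd v) = - ads_product p v" if "p \<in> ?S" for p v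
    using that by (simp add: anti_de_sitter_hypersurface_def ads_product_def inner_complex_def)
  \<comment> \<open>As u does not vanish on the quadric, u > 0 may be relaxed to u \<ge> 0, which
    shows that S is closed.\<close>
  have "Re (snd q) \<noteq> 0" if "ads_product q q = - 1" "q \<in> real_slice" for q :: "(complex ^ 'n) \<times> complex"
  proof
    assume "Re (snd q) = 0"
    then have "fst q \<bullet> fst q = - 1"
      using that by (simp add: ads_product_def real_slice_def inner_complex_def)
    with inner_ge_zero[of "fst q"] show False by linarith
  qed
  then have S': "?S = {q. ads_product q q = - 1} \<inter> real_slice \<inter> {q. 0 \<le> Re (snd q)}"
    unfolding S by (auto simp: less_le)
  show "closed ?S"
    unfolding S' real_slice_def ads_product_def
    by (intro closed_Int closed_Collect_eq closed_Collect_le continuous_intros)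
  fix p assume p: "p \<in> ?S"
  then have p1: "ads_product p p = - 1" "p \<in> real_slice" "Re (snd p) > 0" by (auto simp: S)
  have "tangent_space ?S p = {v. v \<in> real_slice \<and> ads_product p v = 0}"
  proof (intro equalityI subsetI)
    fix v assume v: "v \<in> tangent_space ?S p"
    have "?S \<subseteq> real_slice" "?S \<subseteq> {q. ads_product q q = - 1}" unfolding S by auto
    then show "v \<in> {v. v \<in> real_slice \<and> ads_product p v = 0}"
      using tangent_space_real_slice[OF _ v] tangent_space_quadric_level[OF bilinear_ads_product ads_product_sym _ v, of "- 1"]
      by blast
  next
    fix v assume v: "v \<in> {v. v \<in> real_slice \<and> ads_product p v = 0}"
    \<comment> \<open>For |t| below this bound the line p + t v stays in the half space u >
      0.\<close>
    define e where "e = Re (snd p) / (1 + \<bar>Re (snd v)\<bar>)"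
    have e: "e > 0" using p1 by (simp add: e_def)
    have "Re (snd p) + t * Re (snd v) > 0" if "\<bar>t\<bar> < e" for t
    proof -
      have "\<bar>t\<bar> * (1 + \<bar>Re (snd v)\<bar>) < Re (snd p)"
        using that by (simp add: e_def pos_less_divide_eq)
      then have "\<bar>t * Re (snd v)\<bar> < Re (snd p)"
        unfolding abs_mult distrib_left by (smt (verit) abs_ge_zero mult_1_right)
      then show ?thesis by linarith
    qed
    then show "v \<in> tangent_space ?S p"
      unfolding S using v p1 e
      by (intro tangent_space_quadric[OF bilinear_ads_product ads_product_sym p1(1), of _ e])
        (auto simp: real_slice_def)
  qed
  then show "tangent_space ?S p = {v. v \<in> real_slice \<and>
      - 1 * (fst (0 + p) \<bullet> fst v) + Re (snd (0 + p)) * Re (snd v) = 0}"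
    using pv[OF p] by simp
  have "tangent_space {q. ads_product q q = - 1} p = {v. ads_product p v = 0}"
  proof (intro equalityI subsetI)
    fix v assume v: "v \<in> tangent_space {q. ads_product q q = - 1} p"
    then show "v \<in> {v. ads_product p v = 0}"
      using tangent_space_quadric_level[OF bilinear_ads_product ads_product_sym _ v, of "- 1"] by simp
  next
    fix v assume "v \<in> {v. ads_product p v = 0}"
    then show "v \<in> tangent_space {q. ads_product q q = - 1} p"
      using tangent_space_quadric[OF bilinear_ads_product ads_product_sym p1(1), of v 1 UNIV] by simp
  qed
  then show "tangent_space (cmanifold (anti_de_sitter k)) p = {v.
      - 1 * (fst (0 + p) \<bullet> fst v) + Re (snd (0 + p)) * Re (snd v) = 0}"
    using pv[OF p] by (simp add: anti_de_sitter_def)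
  show "- 1 * (fst (0 + p) \<bullet> fst (0 + p)) + (Re (snd (0 + p)))\<^sup>2 = 1"
    using pv[OF p, of p] p1 by (simp add: power2_eq_square)
qed (use k in \<open>auto simp: anti_de_sitter_def anti_de_sitter_hypersurface_def symplectic_def inner_cvec_i
    real_slice_def ads_product_def distrib_left diff_divide_distrib\<close>)

theorem mainTheorem4:
  fixes k :: real
  assumes "k > 0"
  shows "(\<forall>\<sigma>. orientation_form (2 * CARD('n)) (heisenberg_hypersurface :: ((complex ^ 'n::finite) \<times> real) set) \<sigma> \<longrightarrow>
       stochastically_complete TYPE('w) (regular_part heisenberg heisenberg_hypersurface)
         (sub_laplacian heisenberg heisenberg_hypersurface \<sigma>) \<and>
       almost_surely_avoids TYPE('w) (regular_part heisenberg heisenberg_hypersurface)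
         (sub_laplacian heisenberg heisenberg_hypersurface \<sigma>)
         (characteristic_set heisenberg heisenberg_hypersurface)) \<and>
     (\<forall>\<sigma>. orientation_form (2 * CARD('n)) (sphere_hypersurface :: ((complex ^ 'n) \<times> complex) set) \<sigma> \<longrightarrow>
       stochastically_complete TYPE('w) (regular_part (sphere_contact k) sphere_hypersurface)
         (sub_laplacian (sphere_contact k) sphere_hypersurface \<sigma>) \<and>
       almost_surely_avoids TYPE('w) (regular_part (sphere_contact k) sphere_hypersurface)
         (sub_laplacian (sphere_contact k) sphere_hypersurface \<sigma>)
         (characteristic_set (sphere_contact k) sphere_hypersurface)) \<and>
     (\<forall>\<sigma>. orientation_form (2 * CARD('n)) (anti_de_sitter_hypersurface :: ((complex ^ 'n) \<times> complex) set) \<sigma> \<longrightarrow>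
       stochastically_complete TYPE('w) (regular_part (anti_de_sitter k) anti_de_sitter_hypersurface)
         (sub_laplacian (anti_de_sitter k) anti_de_sitter_hypersurface \<sigma>) \<and>
       almost_surely_avoids TYPE('w) (regular_part (anti_de_sitter k) anti_de_sitter_hypersurface)
         (sub_laplacian (anti_de_sitter k) anti_de_sitter_hypersurface \<sigma>)
         (characteristic_set (anti_de_sitter k) anti_de_sitter_hypersurface))"
  by (intro conjI allI impI)
    (erule model_hypersurface.sub_laplacian_stochastically_complete[OF model_heisenberg]
      model_hypersurface.sub_laplacian_avoids_characteristic_set[OF model_heisenberg]
      model_hypersurface.sub_laplacian_stochastically_complete[OF model_sphere[OF assms]]
      model_hypersurface.sub_laplacian_avoids_characteristic_set[OF model_sphere[OF assms]]
      model_hypersurface.sub_laplacian_stochastically_complete[OF model_anti_de_sitter[OF assms]]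
      model_hypersurface.sub_laplacian_avoids_characteristic_set[OF model_anti_de_sitter[OF assms]])+

end
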